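(* Let $A(\mathbb{Q})$ be a quaternion algebra over $\mathbb{Q}$ ramified over $\mathbb{R}$, $A(\mathbb{R})=A(\mathbb{Q})\otimes_{\mathbb{Q}}\mathbb{R}$, $N$ the reduced norm on $A(\mathbb{R})$, $\mathcal{O}'$ an order of $A(\mathbb{Q})$ and $\mathcal{I}'$ a nonzero two-sided ideal of $\mathcal{O}'$. Let $$\mathcal{E}_{\mathcal{I}'}=\{(p,q)\in\mathcal{O}'\times\mathcal{I}':\ \exists\, r,s\in\mathcal{O}',\ N(qr-qpq^{-1}s)=1\}.$$ For $x\in A(\mathbb{R})-A(\mathbb{Q})$ let $$c_{\mathcal{I}'}(x)=\liminf_{(p,q)\in\mathcal{E}_{\mathcal{I}'},\ N(q)\to\infty}\ N(q)\,N(x-pq^{-1})^{1/2}.$$ Then the set $\mathrm{Sp}_{\mathcal{I}'}=\{c_{\mathcal{I}'}(x): x\in A(\mathbb{R})-A(\mathbb{Q})\}$ is a closed subset of $\mathbb{R}$.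
   Context: "Ramified over $\mathbb{R}$" means $A(\mathbb{R})$ is isomorphic to Hamilton's quaternion algebra $\mathbb{H}$ (a division algebra); a typical example is Hamilton's quaternion algebra over $\mathbb{Q}$ with the Hurwitz order $\mathcal{O}'=\mathbb{Z}[\frac12(1+i+j+k),i,j,k]$. *)

theory Defs
  imports "HOL-Analysis.Analysis" "HOL-Library.Multiset"
begin

section \<open>Algebras over the rationals\<close>

class rat_algebra_1 = ring_1 +
  fixes scaleQ :: "rat \<Rightarrow> 'a \<Rightarrow> 'a"  (infixr \<open>*\<^sub>Q\<close> 75)
  assumes scaleQ_add_right: "c *\<^sub>Q (x + y) = c *\<^sub>Q x + c *\<^sub>Q y"
    and scaleQ_add_left: "(c + d) *\<^sub>Q x = c *\<^sub>Q x + d *\<^sub>Q x"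
    and scaleQ_scaleQ: "c *\<^sub>Q d *\<^sub>Q x = (c * d) *\<^sub>Q x"
    and scaleQ_one: "1 *\<^sub>Q x = x"
    and mult_scaleQ_left: "c *\<^sub>Q x * y = c *\<^sub>Q (x * y)"
    and mult_scaleQ_right: "x * c *\<^sub>Q y = c *\<^sub>Q (x * y)"

lemma vector_space_scaleQ: "vector_space (scaleQ :: rat \<Rightarrow> 'a \<Rightarrow> 'a::rat_algebra_1)"
  by unfold_locales (auto simp: scaleQ_add_right scaleQ_add_left scaleQ_scaleQ scaleQ_one)

lemma scaleQ_zero_left: "0 *\<^sub>Q (x::'a::rat_algebra_1) = 0"
  using scaleQ_add_left[of 0 0 x] by simp

lemma scaleQ_zero_right: "c *\<^sub>Q (0::'a::rat_algebra_1) = 0"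
  using scaleQ_add_right[of c 0 "0::'a"] by simp


section \<open>Ideals, orders and quaternion algebras\<close>

definition two_sided_ideal :: "'a::ring_1 set \<Rightarrow> 'a set \<Rightarrow> bool" where
  "two_sided_ideal R J \<longleftrightarrow>
     J \<subseteq> R \<and> 0 \<in> J \<and> (\<forall>x\<in>J. \<forall>y\<in>J. x - y \<in> J) \<and>
     (\<forall>a\<in>R. \<forall>x\<in>J. a * x \<in> J \<and> x * a \<in> J)"

text \<open>A quaternion algebra over a field is a central simple algebra of dimension 4. The
  library's \<open>dim\<close> is 0 for infinite-dimensional spaces, so the value 4 includes finiteness;
  the algebra is nonzero because \<open>0 \<noteq> 1\<close> in \<^class>\<open>ring_1\<close>.\<close>

definition quaternion_algebra :: "('k::field \<Rightarrow> 'a \<Rightarrow> 'a::ring_1) \<Rightarrow> bool" where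
  "quaternion_algebra smul \<longleftrightarrow>
     vector_space smul \<and>
     (\<forall>c x y. smul c x * y = smul c (x * y) \<and> x * smul c y = smul c (x * y)) \<and>
     vector_space.dim smul UNIV = 4 \<and>
     {z. \<forall>x. z * x = x * z} = range (\<lambda>c. smul c 1) \<and>
     (\<forall>J :: 'a set. two_sided_ideal UNIV J \<longrightarrow> J = {0} \<or> J = UNIV)"

text \<open>An order is a unital subring that is a finitely generated \<open>\<int>\<close>-module and spans the
  algebra over \<open>\<rat>\<close>.\<close>

definition is_order :: "'a::rat_algebra_1 set \<Rightarrow> bool" where
  "is_order R \<longleftrightarrow>
     1 \<in> R \<and> (\<forall>x\<in>R. \<forall>y\<in>R. x - y \<in> R \<and> x * y \<in> R) \<and>
     (\<exists>B. finite B \<and> R = module.span (\<lambda>(n::int) x. of_int n * x) B) \<and>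
     module.span scaleQ R = UNIV"

definition ring_inverse :: "'a::ring_1 \<Rightarrow> 'a" where
  "ring_inverse x = (THE y. x * y = 1 \<and> y * x = 1)"


section \<open>Extension of scalars from the rationals to the reals\<close>

text \<open>The tensor product over \<open>\<rat>\<close> of a rational algebra with \<open>\<real>\<close>: the free commutative monoid
  on pairs \<open>(a, r)\<close>, modulo the congruence generated by biadditivity and balancedness. A multiset
  of pairs represents the sum of the pure tensors \<open>a \<otimes> r\<close>. The quotient has additive inverses,
  since \<open>(a \<otimes> r) + (- a \<otimes> r) = 0 \<otimes> r = 0\<close>.\<close>

inductive tensor_eq ::
    "('a::rat_algebra_1 \<times> real) multiset \<Rightarrow> ('a \<times> real) multiset \<Rightarrow> bool" where
  tensor_refl: "tensor_eq M M"
| tensor_sym: "tensor_eq M N \<Longrightarrow> tensor_eq N M"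
| tensor_trans: "tensor_eq M N \<Longrightarrow> tensor_eq N P \<Longrightarrow> tensor_eq M P"
| tensor_plus: "tensor_eq M M' \<Longrightarrow> tensor_eq N N' \<Longrightarrow> tensor_eq (M + N) (M' + N')"
| tensor_zero: "tensor_eq {#(0, 0)#} {#}"
| tensor_add_left: "tensor_eq {#(a + b, r)#} {#(a, r), (b, r)#}"
| tensor_add_right: "tensor_eq {#(a, r + s)#} {#(a, r), (a, s)#}"
| tensor_balanced: "tensor_eq {#(c *\<^sub>Q a, r)#} {#(a, of_rat c * r)#}"

lemma tensor_zero_left: "tensor_eq {#(0, r)#} {#}"
  using tensor_balanced[of 0 0 r] tensor_zero tensor_trans
  by (fastforce simp: scaleQ_zero_left)

quotient_type (overloaded) 'a real_tensor =
  "('a::rat_algebra_1 \<times> real) multiset" / tensor_eq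
  by (rule equivpI; unfold reflp_def symp_def transp_def)
    (blast intro: tensor_refl tensor_sym tensor_trans)+

lemma tensor_eq_map:
  assumes "tensor_eq M N"
    and "tensor_eq (image_mset f {#(0, 0)#}) {#}"
    and "\<And>a b r. tensor_eq (image_mset f {#(a + b, r)#}) (image_mset f {#(a, r), (b, r)#})"
    and "\<And>a r s. tensor_eq (image_mset f {#(a, r + s)#}) (image_mset f {#(a, r), (a, s)#})"
    and "\<And>c a r. tensor_eq (image_mset f {#(c *\<^sub>Q a, r)#}) (image_mset f {#(a, of_rat c * r)#})"
  shows "tensor_eq (image_mset f M) (image_mset f N)"
  using assms(1)
proof induction
  case tensor_zero
  then show ?case using assms(2) by simp
qed (use assms in \<open>auto intro: tensor_refl tensor_sym tensor_trans tensor_plus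
      simp del: image_mset_single image_mset_add_mset\<close>)

definition tensor_pair_mult :: "'a::ring_1 \<times> real \<Rightarrow> 'a \<times> real \<Rightarrow> 'a \<times> real" where
  "tensor_pair_mult u v = (fst u * fst v, snd u * snd v)"

definition tensor_mult ::
    "('a::ring_1 \<times> real) multiset \<Rightarrow> ('a \<times> real) multiset \<Rightarrow> ('a \<times> real) multiset" where
  "tensor_mult M N = (\<Sum>u\<in>#M. image_mset (tensor_pair_mult u) N)"

lemma tensor_mult_simps [simp]:
  "tensor_mult {#} N = {#}"
  "tensor_mult (add_mset u M) N = image_mset (tensor_pair_mult u) N + tensor_mult M N"
  by (simp_all add: tensor_mult_def)

lemma tensor_mult_plus_left: "tensor_mult (M + M') N = tensor_mult M N + tensor_mult M' N"
  by (simp add: tensor_mult_def)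

lemma tensor_mult_plus_right: "tensor_mult M (N + N') = tensor_mult M N + tensor_mult M N'"
  by (induction M) (simp_all add: ac_simps)

lemma tensor_mult_empty_right [simp]: "tensor_mult M {#} = {#}"
  by (induction M) simp_all

lemma tensor_mult_single_right:
  "tensor_mult M {#v#} = image_mset (\<lambda>u. tensor_pair_mult u v) M"
  by (induction M) simp_all

lemma tensor_pair_mult_assoc:
  "tensor_pair_mult (tensor_pair_mult u v) w = tensor_pair_mult u (tensor_pair_mult v w)"
  by (simp add: tensor_pair_mult_def mult.assoc)

lemma image_tensor_pair_mult_assoc:
  "image_mset (tensor_pair_mult (tensor_pair_mult u v)) N =
   image_mset (tensor_pair_mult u) (image_mset (tensor_pair_mult v) N)"
  by (induction N) (simp_all add: tensor_pair_mult_assoc)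

lemma image_tensor_pair_mult_one: "image_mset (tensor_pair_mult (1, 1)) N = N"
  by (induction N) (simp_all add: tensor_pair_mult_def)

lemma tensor_mult_image_left:
  "tensor_mult (image_mset (tensor_pair_mult u) M) N =
   image_mset (tensor_pair_mult u) (tensor_mult M N)"
  by (induction M) (simp_all add: image_tensor_pair_mult_assoc)

lemma tensor_mult_assoc: "tensor_mult (tensor_mult M N) P = tensor_mult M (tensor_mult N P)"
  by (induction M) (simp_all add: tensor_mult_plus_left tensor_mult_image_left)

lemma tensor_mult_cong_right:
  assumes "tensor_eq N N'"
  shows "tensor_eq (tensor_mult M N) (tensor_mult M N')"
proof (induction M)
  case (add u M)
  have "tensor_eq (image_mset (tensor_pair_mult u) N) (image_mset (tensor_pair_mult u) N')"
    using assms
    by (rule tensor_eq_map)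
      (auto simp: tensor_pair_mult_def distrib_left mult_scaleQ_right tensor_zero
        mult.left_commute[of _ "of_rat _"]
        intro: tensor_add_left tensor_add_right tensor_balanced)
  then show ?case using add by (simp add: tensor_plus)
qed (simp add: tensor_refl)

lemma tensor_mult_cong_left:
  assumes "tensor_eq M M'"
  shows "tensor_eq (tensor_mult M N) (tensor_mult M' N)"
proof (induction N)
  case (add v N)
  have "tensor_eq (image_mset (\<lambda>u. tensor_pair_mult u v) M) (image_mset (\<lambda>u. tensor_pair_mult u v) M')"
    using assms
    by (rule tensor_eq_map)
      (auto simp: tensor_pair_mult_def distrib_right mult_scaleQ_left tensor_zero mult.assoc
        intro: tensor_add_left tensor_add_right tensor_balanced)
  then have "tensor_eq (tensor_mult M {#v#} + tensor_mult M N) (tensor_mult M' {#v#} + tensor_mult M' N)"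
    using add by (simp add: tensor_mult_single_right tensor_plus)
  then show ?case
    by (metis tensor_mult_plus_right add_mset_add_single add.commute)
qed (simp add: tensor_refl)

lemma tensor_mult_cong:
  "tensor_eq M M' \<Longrightarrow> tensor_eq N N' \<Longrightarrow> tensor_eq (tensor_mult M N) (tensor_mult M' N')"
  by (blast intro: tensor_trans tensor_mult_cong_left tensor_mult_cong_right)

lemma tensor_eq_neg:
  "tensor_eq M N \<Longrightarrow>
   tensor_eq (image_mset (\<lambda>u. (- fst u, snd u)) M) (image_mset (\<lambda>u. (- fst u, snd u)) N)"
proof (erule tensor_eq_map)
  fix c :: rat and a :: 'a and r :: real
  have "- (c *\<^sub>Q a) = c *\<^sub>Q (- a)"
    using scaleQ_add_right[of c a "- a"] by (simp add: scaleQ_zero_right minus_unique)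
  then show "tensor_eq (image_mset (\<lambda>u. (- fst u, snd u)) {#(c *\<^sub>Q a, r)#})
      (image_mset (\<lambda>u. (- fst u, snd u)) {#(a, of_rat c * r)#})"
    by (simp add: tensor_balanced)
next
  fix a b :: 'a and r :: real
  show "tensor_eq (image_mset (\<lambda>u. (- fst u, snd u)) {#(a + b, r)#})
      (image_mset (\<lambda>u. (- fst u, snd u)) {#(a, r), (b, r)#})"
    using tensor_add_left[of "- a" "- b" r] by (simp add: add.commute)
qed (auto intro: tensor_zero tensor_add_right)

lemma tensor_neg_plus: "tensor_eq (image_mset (\<lambda>u. (- fst u, snd u)) M + M) {#}"
proof (induction M)
  case (add u M)
  have "tensor_eq {#(- fst u, snd u), u#} {#}"
    using tensor_trans[OF tensor_sym[OF tensor_add_left[of "- fst u" "fst u" "snd u"]]]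
      tensor_zero_left[of "snd u"] by simp
  from tensor_plus[OF this add] show ?case by (simp add: ac_simps add_mset_commute)
qed (simp add: tensor_refl)

lemma tensor_eq_scale:
  "tensor_eq M N \<Longrightarrow>
   tensor_eq (image_mset (\<lambda>u. (fst u, t * snd u)) M) (image_mset (\<lambda>u. (fst u, t * snd u)) N)"
  by (erule tensor_eq_map)
    (auto simp: distrib_left mult.left_commute[of _ "of_rat _"]
      intro: tensor_zero tensor_add_left tensor_add_right tensor_balanced)

instantiation real_tensor :: (rat_algebra_1) "{plus, zero, uminus, minus, times, one, scaleR}"
begin

lift_definition zero_real_tensor :: "'a real_tensor" is "{#}" .

lift_definition plus_real_tensor :: "'a real_tensor \<Rightarrow> 'a real_tensor \<Rightarrow> 'a real_tensor"
  is "(+)" by (rule tensor_plus)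

lift_definition uminus_real_tensor :: "'a real_tensor \<Rightarrow> 'a real_tensor"
  is "image_mset (\<lambda>u. (- fst u, snd u))" by (rule tensor_eq_neg)

definition minus_real_tensor :: "'a real_tensor \<Rightarrow> 'a real_tensor \<Rightarrow> 'a real_tensor" where
  "minus_real_tensor x y = x + (- y)"

lift_definition one_real_tensor :: "'a real_tensor" is "{#(1, 1)#}" .

lift_definition times_real_tensor :: "'a real_tensor \<Rightarrow> 'a real_tensor \<Rightarrow> 'a real_tensor"
  is tensor_mult by (rule tensor_mult_cong)

lift_definition scaleR_real_tensor :: "real \<Rightarrow> 'a real_tensor \<Rightarrow> 'a real_tensor"
  is "\<lambda>t. image_mset (\<lambda>u. (fst u, t * snd u))" by (rule tensor_eq_scale)

instance ..

end

lift_definition pure_tensor :: "'a::rat_algebra_1 \<Rightarrow> real \<Rightarrow> 'a real_tensor"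
  is "\<lambda>a r. {#(a, r)#}" .

text \<open>The ring axiom \<open>0 \<noteq> 1\<close> needs a nonzero functional on the tensor product: compose a
  \<open>\<rat>\<close>-linear functional taking 1 to 1 with multiplication.\<close>

lemma tensor_one_neq_zero: "\<not> tensor_eq {#} {#(1::'a::rat_algebra_1, 1)#}"
proof
  assume eq: "tensor_eq {#} {#(1::'a, 1)#}"
  interpret Q: vector_space "scaleQ :: rat \<Rightarrow> 'a \<Rightarrow> 'a" by (rule vector_space_scaleQ)
  interpret QQ: vector_space "(*) :: rat \<Rightarrow> rat \<Rightarrow> rat"
    by unfold_locales (auto simp: algebra_simps)
  interpret P: vector_space_pair "scaleQ :: rat \<Rightarrow> 'a \<Rightarrow> 'a" "(*) :: rat \<Rightarrow> rat \<Rightarrow> rat" ..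
  have "Q.independent {1::'a}" by simp
  from P.linear_independent_extend[OF this, of "\<lambda>_. 1"] obtain f :: "'a \<Rightarrow> rat"
    where lin: "Vector_Spaces.linear scaleQ (*) f" and f1: "f 1 = 1" by auto
  interpret f: Vector_Spaces.linear scaleQ "(*)" f by (rule lin)
  define ev where "ev M = (\<Sum>u\<in>#M. of_rat (f (fst u)) * snd u)" for M :: "('a \<times> real) multiset"
  have "ev M = ev N" if "tensor_eq M N" for M N
    using that
    by induction
      (simp_all add: ev_def f.add f.scale f.zero of_rat_add of_rat_mult algebra_simps)
  from this[OF eq] show False by (simp add: ev_def f1)
qed

instance real_tensor :: (rat_algebra_1) real_algebra_1
proof
  fix x y z :: "'a real_tensor" and s t :: real
  show "x + y + z = x + (y + z)" by transfer (simp add: add.assoc tensor_refl)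
  show "x + y = y + x" by transfer (simp add: add.commute tensor_refl)
  show "0 + x = x" by transfer (simp add: tensor_refl)
  show "- x + x = 0" by transfer (rule tensor_neg_plus)
  show "x - y = x + - y" by (rule minus_real_tensor_def)
  show "x * y * z = x * (y * z)" by transfer (simp add: tensor_mult_assoc tensor_refl)
  show "(x + y) * z = x * z + y * z" by transfer (simp add: tensor_mult_plus_left tensor_refl)
  show "x * (y + z) = x * y + x * z" by transfer (simp add: tensor_mult_plus_right tensor_refl)
  show "1 * x = x" by transfer (simp add: image_tensor_pair_mult_one tensor_refl)
  show "x * 1 = x"
    by transfer (simp add: tensor_mult_single_right tensor_pair_mult_def tensor_refl)
  show "(0 :: 'a real_tensor) \<noteq> 1" by transfer (rule tensor_one_neq_zero)
  show "s *\<^sub>R (x + y) = s *\<^sub>R x + s *\<^sub>R y" by transfer (simp add: tensor_refl)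
  show "(s + t) *\<^sub>R x = s *\<^sub>R x + t *\<^sub>R x"
  proof transfer
    fix s t :: real and M :: "('a \<times> real) multiset"
    show "tensor_eq (image_mset (\<lambda>u. (fst u, (s + t) * snd u)) M)
       (image_mset (\<lambda>u. (fst u, s * snd u)) M + image_mset (\<lambda>u. (fst u, t * snd u)) M)"
    proof (induction M)
      case (add u M)
      from tensor_plus[OF tensor_add_right[of "fst u" "s * snd u" "t * snd u"] add]
      show ?case by (simp add: distrib_right add_mset_commute)
    qed (simp add: tensor_refl)
  qed
  show "s *\<^sub>R t *\<^sub>R x = (s * t) *\<^sub>R x"
    by transfer (simp add: multiset.map_comp comp_def mult.assoc tensor_refl)
  show "1 *\<^sub>R x = x" by transfer (simp add: tensor_refl)
  show "s *\<^sub>R x * y = s *\<^sub>R (x * y)"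
  proof transfer
    fix s :: real and M N :: "('a \<times> real) multiset"
    have "tensor_mult (image_mset (\<lambda>u. (fst u, s * snd u)) M) N =
      image_mset (\<lambda>u. (fst u, s * snd u)) (tensor_mult M N)"
      by (induction M) (simp_all add: multiset.map_comp comp_def tensor_pair_mult_def[abs_def] mult.assoc)
    then show "tensor_eq (tensor_mult (image_mset (\<lambda>u. (fst u, s * snd u)) M) N)
       (image_mset (\<lambda>u. (fst u, s * snd u)) (tensor_mult M N))" by (simp add: tensor_refl)
  qed
  show "x * s *\<^sub>R y = s *\<^sub>R (x * y)"
  proof transfer
    fix s :: real and M N :: "('a \<times> real) multiset"
    have "tensor_mult M (image_mset (\<lambda>u. (fst u, s * snd u)) N) =
      image_mset (\<lambda>u. (fst u, s * snd u)) (tensor_mult M N)"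
      by (induction M)
        (simp_all add: multiset.map_comp comp_def tensor_pair_mult_def[abs_def] mult.left_commute)
    then show "tensor_eq (tensor_mult M (image_mset (\<lambda>u. (fst u, s * snd u)) N))
       (image_mset (\<lambda>u. (fst u, s * snd u)) (tensor_mult M N))" by (simp add: tensor_refl)
  qed
qed

definition to_real :: "'a::rat_algebra_1 \<Rightarrow> 'a real_tensor" where
  "to_real a = pure_tensor a 1"


section \<open>Hamilton's quaternions and ramification at the real place\<close>

datatype hamilton = Hamilton (Re0: real) (Im_i: real) (Im_j: real) (Im_k: real)

lemma hamilton_eq_iff:
  "x = y \<longleftrightarrow> Re0 x = Re0 y \<and> Im_i x = Im_i y \<and> Im_j x = Im_j y \<and> Im_k x = Im_k y"
  by (cases x; cases y) simp

instantiation hamilton :: real_algebra_1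
begin

definition "0 = Hamilton 0 0 0 0"
definition "1 = Hamilton 1 0 0 0"
definition "x + y =
  Hamilton (Re0 x + Re0 y) (Im_i x + Im_i y) (Im_j x + Im_j y) (Im_k x + Im_k y)"
definition "- x = Hamilton (- Re0 x) (- Im_i x) (- Im_j x) (- Im_k x)"
definition "(x::hamilton) - y = x + (- y)"
definition "x * y = Hamilton
  (Re0 x * Re0 y - Im_i x * Im_i y - Im_j x * Im_j y - Im_k x * Im_k y)
  (Re0 x * Im_i y + Im_i x * Re0 y + Im_j x * Im_k y - Im_k x * Im_j y)
  (Re0 x * Im_j y - Im_i x * Im_k y + Im_j x * Re0 y + Im_k x * Im_i y)
  (Re0 x * Im_k y + Im_i x * Im_j y - Im_j x * Im_i y + Im_k x * Re0 y)"
definition "t *\<^sub>R x = Hamilton (t * Re0 x) (t * Im_i x) (t * Im_j x) (t * Im_k x)"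

instance
  by standard
    (simp_all add: hamilton_eq_iff zero_hamilton_def one_hamilton_def plus_hamilton_def
      uminus_hamilton_def minus_hamilton_def times_hamilton_def scaleR_hamilton_def algebra_simps)

end

definition ramified_over_reals :: "'a::rat_algebra_1 itself \<Rightarrow> bool" where
  "ramified_over_reals _ \<longleftrightarrow>
     (\<exists>\<phi> :: 'a real_tensor \<Rightarrow> hamilton.
        bij \<phi> \<and> linear \<phi> \<and> \<phi> 1 = 1 \<and> (\<forall>x y. \<phi> (x * y) = \<phi> x * \<phi> y))"


section \<open>Reduced norm\<close>

text \<open>A standard involution is a linear anti-automorphism of order at most 2 such that
  \<open>x * \<sigma> x\<close> is always a scalar. A quaternion algebra has exactly one, its conjugation, and the
  reduced norm of \<open>x\<close> is the scalar \<open>x * \<sigma> x\<close>.\<close>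

definition standard_involution :: "('b::real_algebra_1 \<Rightarrow> 'b) \<Rightarrow> bool" where
  "standard_involution \<sigma> \<longleftrightarrow>
     linear \<sigma> \<and> \<sigma> 1 = 1 \<and> (\<forall>x. \<sigma> (\<sigma> x) = x) \<and> (\<forall>x y. \<sigma> (x * y) = \<sigma> y * \<sigma> x) \<and>
     (\<forall>x. x * \<sigma> x \<in> range of_real)"

definition conjugation :: "'b::real_algebra_1 \<Rightarrow> 'b" where
  "conjugation = (THE \<sigma>. standard_involution \<sigma>)"

definition reduced_norm :: "'b::real_algebra_1 \<Rightarrow> real" where
  "reduced_norm x = (THE t. of_real t = x * conjugation x)"


section \<open>Approximation constants and the spectrum\<close>

text \<open>If \<open>q = 0\<close>, then \<open>q * r - q * p * ring_inverse q * s = 0\<close> has norm 0, so no pair with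
  \<open>q = 0\<close> belongs to the set below.\<close>

definition approx_pairs :: "'a::rat_algebra_1 set \<Rightarrow> 'a set \<Rightarrow> ('a \<times> 'a) set" where
  "approx_pairs R J =
     {(p, q). p \<in> R \<and> q \<in> J \<and>
        (\<exists>r\<in>R. \<exists>s\<in>R. reduced_norm (to_real (q * r - q * p * ring_inverse q * s)) = 1)}"

definition approx_filter :: "'a::rat_algebra_1 set \<Rightarrow> 'a set \<Rightarrow> ('a \<times> 'a) filter" where
  "approx_filter R J =
     inf (filtercomap (\<lambda>(p, q). reduced_norm (to_real q)) at_top) (principal (approx_pairs R J))"

definition approx_constant ::
    "'a::rat_algebra_1 set \<Rightarrow> 'a set \<Rightarrow> 'a real_tensor \<Rightarrow> ereal" where
  "approx_constant R J x =
     Liminf (approx_filter R J)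
       (\<lambda>(p, q). ereal (reduced_norm (to_real q) *
          sqrt (reduced_norm (x - to_real (p * ring_inverse q)))))"

definition approx_spectrum :: "'a::rat_algebra_1 set \<Rightarrow> 'a set \<Rightarrow> ereal set" where
  "approx_spectrum R J = approx_constant R J ` (UNIV - range to_real)"

end

theory Submission
  imports Defs "HOL-Real_Asymp.Real_Asymp"
begin

text \<open>Identify \<open>A(\<real>)\<close> with Hamilton's quaternions, let \<open>u\<^sub>x\<close> be the unipotent matrix with rows
  \<open>(1, -x)\<close> and \<open>(0, 1)\<close>, and let \<open>a\<^sub>t = diag(exp t, exp (- t))\<close>. The approximants \<open>(p, q)\<close> form (up to
  \<open>q = 0\<close>) an orbit, invariant under the congruence group \<open>\<Gamma>\<close> of the ideal, and \<open>c(x)\<close> is the lower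
  limit of the \<open>a\<^sub>t\<close>-invariant function \<open>|v\<^sub>1| |v\<^sub>2|\<close> at \<open>v = u\<^sub>x (p, q)\<close>. For irrational \<open>x\<close> the orbit
  \<open>a\<^sub>t u\<^sub>x \<Gamma>\<close> returns infinitely often to a compact set that does not depend on \<open>x\<close> (Dirichlet's box
  principle and the finiteness of residue rings); in particular \<open>c(x)\<close> is finite. If \<open>c(x\<^sub>n)\<close> converges
  to \<open>c\<close>, pass to a subsequence such that the orbit of \<open>x\<^sub>n\<close> recurs near \<open>Q\<^sub>n\<close>, with \<open>Q\<^sub>n\<close> converging to
  \<open>Q\<close>. Long pieces of the orbits of the \<open>x\<^sub>n\<close>, starting and ending near \<open>Q\<close>, form a pseudo-orbit with
  jumps tending to 0; since \<open>a\<^sub>t\<close> is hyperbolic, it is shadowed by the orbit of a point \<open>y\<close>, and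
  \<open>c(y) = c\<close>.\<close>

section \<open>Hamilton's quaternions as a normed division algebra\<close>

text \<open>The value c(x) depends only on the tail of the orbit, so a limit of the points x_n says
  nothing about the limit of their values. What can be prescribed is a sequence of orbit pieces,
  each of which realizes its value up to a small error. A piece sees the value of a column v at the
  time when v is balanced, that is, when both entries of a_t v have norm sqrt(|v1| |v2|). Values up
  to c + 1 are thus met in the ball of radius sqrt(c + 1); the radius W = 4 sqrt(c + 1) leaves room
  for the distortion by shadowing. Shadowing is a two-sided problem: conjugation by a_t expands the
  upper right entry of a correction matrix, contracts the lower left one and leaves the diagonal
  alone. The lower row is computed forwards, the upper right entry must be determined from the
  future, and the neutral diagonal is controlled by making the jumps summable. Diagonal 1 and lower
  left entry 0 at the start make the first correction unipotent, so that it can be absorbed into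
  y.\<close>

definition hcnj :: "hamilton \<Rightarrow> hamilton" where
  "hcnj x = Hamilton (Re0 x) (- Im_i x) (- Im_j x) (- Im_k x)"

lemma hamilton_sel [simp]:
  "Re0 0 = 0" "Im_i 0 = 0" "Im_j 0 = 0" "Im_k 0 = 0"
  "Re0 1 = 1" "Im_i 1 = 0" "Im_j 1 = 0" "Im_k 1 = 0"
  "Re0 (x + y) = Re0 x + Re0 y" "Im_i (x + y) = Im_i x + Im_i y"
  "Im_j (x + y) = Im_j x + Im_j y" "Im_k (x + y) = Im_k x + Im_k y"
  "Re0 (x - y) = Re0 x - Re0 y" "Im_i (x - y) = Im_i x - Im_i y"
  "Im_j (x - y) = Im_j x - Im_j y" "Im_k (x - y) = Im_k x - Im_k y"
  "Re0 (- x) = - Re0 x" "Im_i (- x) = - Im_i x" "Im_j (- x) = - Im_j x" "Im_k (- x) = - Im_k x"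
  "Re0 (t *\<^sub>R x) = t * Re0 x" "Im_i (t *\<^sub>R x) = t * Im_i x"
  "Im_j (t *\<^sub>R x) = t * Im_j x" "Im_k (t *\<^sub>R x) = t * Im_k x"
  "Re0 (hcnj x) = Re0 x" "Im_i (hcnj x) = - Im_i x"
  "Im_j (hcnj x) = - Im_j x" "Im_k (hcnj x) = - Im_k x"
  by (simp_all add: zero_hamilton_def one_hamilton_def plus_hamilton_def uminus_hamilton_def
      minus_hamilton_def scaleR_hamilton_def hcnj_def)

lemma hamilton_sel_mult:
  "Re0 (x * y) = Re0 x * Re0 y - Im_i x * Im_i y - Im_j x * Im_j y - Im_k x * Im_k y"
  "Im_i (x * y) = Re0 x * Im_i y + Im_i x * Re0 y + Im_j x * Im_k y - Im_k x * Im_j y"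
  "Im_j (x * y) = Re0 x * Im_j y - Im_i x * Im_k y + Im_j x * Re0 y + Im_k x * Im_i y"
  "Im_k (x * y) = Re0 x * Im_k y + Im_i x * Im_j y - Im_j x * Im_i y + Im_k x * Re0 y"
  by (simp_all add: times_hamilton_def)

lemma hamilton_sel_of_real [simp]:
  "Re0 (of_real r) = r" "Im_i (of_real r) = 0" "Im_j (of_real r) = 0" "Im_k (of_real r) = 0"
  by (simp_all add: of_real_def)

instantiation hamilton :: real_inner
begin

definition inner_hamilton_def:
  "inner x y = Re0 x * Re0 y + Im_i x * Im_i y + Im_j x * Im_j y + Im_k x * Im_k y"

definition norm_hamilton_def: "norm (x::hamilton) = sqrt (inner x x)"

definition sgn_hamilton_def: "sgn (x::hamilton) = x /\<^sub>R norm x"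

definition dist_hamilton_def: "dist (x::hamilton) y = norm (x - y)"

definition uniformity_hamilton_def [code del]:
  "(uniformity :: (hamilton \<times> hamilton) filter) = (INF e\<in>{0 <..}. principal {(x, y). dist x y < e})"

definition open_hamilton_def [code del]:
  "open (U :: hamilton set) \<longleftrightarrow> (\<forall>x\<in>U. eventually (\<lambda>(x', y). x' = x \<longrightarrow> y \<in> U) uniformity)"

instance
proof
  fix r :: real and x y z :: hamilton
  show "inner x y = inner y x" "inner (x + y) z = inner x z + inner y z"
    "inner (r *\<^sub>R x) y = r * inner x y"
    by (simp_all add: inner_hamilton_def algebra_simps)
  show "0 \<le> inner x x" by (simp add: inner_hamilton_def)
  have "a + b + c + d = 0 \<longleftrightarrow> a = 0 \<and> b = 0 \<and> c = 0 \<and> d = 0"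
    if "0 \<le> a" "0 \<le> b" "0 \<le> c" "0 \<le> d" for a b c d :: real
    using that by linarith
  from this[of "Re0 x * Re0 x" "Im_i x * Im_i x" "Im_j x * Im_j x" "Im_k x * Im_k x"]
  show "inner x x = 0 \<longleftrightarrow> x = 0"
    by (simp add: inner_hamilton_def hamilton_eq_iff)
qed (rule norm_hamilton_def sgn_hamilton_def dist_hamilton_def open_hamilton_def
    uniformity_hamilton_def)+

end

lemma norm_hamilton_sq:
  "norm x ^ 2 = Re0 x ^ 2 + Im_i x ^ 2 + Im_j x ^ 2 + Im_k x ^ 2" for x :: hamilton
  by (simp add: norm_hamilton_def inner_hamilton_def power2_eq_square)

lemma hcnj_mult_self: "hcnj x * x = of_real (norm x ^ 2)" "x * hcnj x = of_real (norm x ^ 2)"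
  unfolding norm_hamilton_sq
  by (simp_all add: hamilton_eq_iff hamilton_sel_mult power2_eq_square)

instantiation hamilton :: real_normed_div_algebra
begin

definition inverse_hamilton_def: "inverse (x::hamilton) = hcnj x /\<^sub>R (norm x ^ 2)"

definition divide_hamilton_def: "(x::hamilton) div y = x * inverse y"

instance
proof
  fix x y :: hamilton
  show "inverse x * x = 1" "x * inverse x = 1" if "x \<noteq> 0"
    using that by (simp_all add: inverse_hamilton_def hcnj_mult_self of_real_def)
  show "inverse (0::hamilton) = 0" by (simp add: inverse_hamilton_def)
  show "x div y = x * inverse y" by (rule divide_hamilton_def)
  have "norm (x * y) ^ 2 = (norm x * norm y) ^ 2"
    unfolding power_mult_distrib norm_hamilton_sq
    by (simp add: hamilton_sel_mult power2_eq_square) algebra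
  then show "norm (x * y) = norm x * norm y" by simp
qed

end

instantiation hamilton :: euclidean_space
begin

definition Basis_hamilton_def:
  "Basis = {Hamilton 1 0 0 0, Hamilton 0 1 0 0, Hamilton 0 0 1 0, Hamilton 0 0 0 1}"

instance
proof
  fix u v x :: hamilton
  show "inner u v = (if u = v then 1 else 0)" if "u \<in> Basis" "v \<in> Basis"
    using that unfolding Basis_hamilton_def
    by (elim insertE emptyE) (simp_all add: inner_hamilton_def)
  show "(\<forall>u\<in>Basis. inner x u = 0) \<longleftrightarrow> x = 0"
    by (simp add: Basis_hamilton_def inner_hamilton_def) (simp add: hamilton_eq_iff)
qed (simp_all add: Basis_hamilton_def)

end

lemma hcnj_mult [simp]: "hcnj (x * y) = hcnj y * hcnj x"
  by (simp add: hamilton_eq_iff hamilton_sel_mult algebra_simps)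

lemma hcnj_simps [simp]:
  "hcnj (hcnj x) = x" "hcnj (x + y) = hcnj x + hcnj y" "hcnj (x - y) = hcnj x - hcnj y"
  "hcnj (- x) = - hcnj x" "hcnj (of_real r) = of_real r" "hcnj 0 = 0" "hcnj 1 = 1"
  by (simp_all add: hamilton_eq_iff)

lemma norm_hcnj [simp]: "norm (hcnj x) = norm x"
  by (simp add: norm_hamilton_def inner_hamilton_def)

lemma hcnj_conv: "hcnj x = of_real (2 * Re0 x) - x"
  by (simp add: hamilton_eq_iff del: of_real_mult)

lemma of_real_commute: "of_real r * (x::hamilton) = x * of_real r"
  by (simp add: of_real_def)

lemma Re0_commute: "Re0 (x * y) = Re0 (y * x)"
  by (simp add: hamilton_sel_mult algebra_simps)

lemma Re0_le_norm: "Re0 x \<le> norm x"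
proof -
  have "\<bar>Re0 x\<bar> \<le> norm x"
    by (rule abs_le_square_iff[THEN iffD2, of "Re0 x" "norm x", simplified]) (simp add: norm_hamilton_sq)
  then show ?thesis by simp
qed

lemma norm_add_sq: "norm (x + y) ^ 2 = norm x ^ 2 + norm y ^ 2 + 2 * Re0 (hcnj x * y)"
  unfolding norm_hamilton_sq by (simp add: hamilton_sel_mult power2_eq_square algebra_simps)

section \<open>Two-by-two quaternionic matrices\<close>

definition mat2 :: "hamilton \<Rightarrow> hamilton \<Rightarrow> hamilton \<Rightarrow> hamilton \<Rightarrow> hamilton^2^2" where
  "mat2 a b c d = vector [vector [a, b], vector [c, d]]"

lemma mat2_nth [simp]:
  "mat2 a b c d $ 1 $ 1 = a" "mat2 a b c d $ 1 $ 2 = b"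
  "mat2 a b c d $ 2 $ 1 = c" "mat2 a b c d $ 2 $ 2 = d"
  by (simp_all add: mat2_def)

lemma mat_mult_nth: "(A ** B) $ i $ j = A $ i $ 1 * B $ 1 $ j + A $ i $ 2 * B $ 2 $ j"
  for A B :: "hamilton^2^2"
  by (simp add: matrix_matrix_mult_def sum_2)

lemma mat_vec_mult_nth: "(A *v v) $ i = A $ i $ 1 * v $ 1 + A $ i $ 2 * v $ 2"
  for A :: "hamilton^2^2"
  by (simp add: matrix_vector_mult_def sum_2)

lemma mat_1_nth [simp]:
  "(mat 1 :: hamilton^2^2) $ 1 $ 1 = 1" "(mat 1 :: hamilton^2^2) $ 1 $ 2 = 0"
  "(mat 1 :: hamilton^2^2) $ 2 $ 1 = 0" "(mat 1 :: hamilton^2^2) $ 2 $ 2 = 1"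
  by (simp_all add: mat_def)

lemma mat2_eq_iff:
  "A = B \<longleftrightarrow> A $ 1 $ 1 = B $ 1 $ 1 \<and> A $ 1 $ 2 = B $ 1 $ 2 \<and> A $ 2 $ 1 = B $ 2 $ 1 \<and> A $ 2 $ 2 = B $ 2 $ 2"
  for A B :: "'a^2^2"
  by (auto simp: vec_eq_iff forall_2)

lemma vec2_eq_iff: "v = w \<longleftrightarrow> v $ 1 = w $ 1 \<and> v $ 2 = w $ 2" for v w :: "'a^2"
  by (auto simp: vec_eq_iff forall_2)

text \<open>The reduced norm of \<open>M\<^sub>2\<close>, that is the square of the Dieudonne determinant, written without inverses
  (see \<open>ddet_nz_col\<close> below).\<close>

definition ddet :: "hamilton^2^2 \<Rightarrow> real" where
  "ddet A = norm (A$1$1) ^ 2 * norm (A$2$2) ^ 2 + norm (A$1$2) ^ 2 * norm (A$2$1) ^ 2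
     - 2 * Re0 (hcnj (A$1$2) * A$1$1 * hcnj (A$2$1) * A$2$2)"

text \<open>This is \<open>ddet A\<close> times the inverse of \<open>A\<close>. For commuting
  entries it is the classical adjugate times the conjugate of the determinant; like
  \<open>ddet\<close> it avoids division, so it preserves matrices over an order
  (\<open>adj2_R\<close>).\<close>

definition adj2 :: "hamilton^2^2 \<Rightarrow> hamilton^2^2" where
  "adj2 A = mat2
     (of_real (norm (A$2$2) ^ 2) * hcnj (A$1$1) - hcnj (A$2$1) * A$2$2 * hcnj (A$1$2))
     (of_real (norm (A$1$2) ^ 2) * hcnj (A$2$1) - hcnj (A$1$1) * A$1$2 * hcnj (A$2$2))
     (of_real (norm (A$2$1) ^ 2) * hcnj (A$1$2) - hcnj (A$2$2) * A$2$1 * hcnj (A$1$1))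
     (of_real (norm (A$1$1) ^ 2) * hcnj (A$2$2) - hcnj (A$1$2) * A$1$1 * hcnj (A$2$1))"

lemma of_real_Re0_times_2: "of_real (2 * Re0 x) = x + hcnj x"
  by (simp add: hamilton_eq_iff del: of_real_mult)

lemma hcnj_mult_self_left: "hcnj x * (x * y) = of_real (norm x ^ 2) * y"
  "x * (hcnj x * y) = of_real (norm x ^ 2) * y"
  by (metis hcnj_mult_self(1) mult.assoc, metis hcnj_mult_self(2) mult.assoc)

lemma of_real_left_commute: "x * (of_real r * y) = of_real r * (x * (y::hamilton))"
  by (metis mult.assoc of_real_commute)

lemma Re0_of_real_mult [simp]: "Re0 (of_real r * x) = r * Re0 x" "Re0 (x * of_real r) = r * Re0 x"
  by (simp_all add: hamilton_sel_mult)

section \<open>Multiplicativity of the determinant\<close>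

lemma ddet_swap: "ddet (mat2 0 1 1 0 ** B) = ddet B"
proof -
  have "Re0 (hcnj (B$2$2) * B$2$1 * hcnj (B$1$1) * B$1$2) =
        Re0 (hcnj (hcnj (B$2$2) * B$2$1 * hcnj (B$1$1) * B$1$2))" by (simp only: hamilton_sel)
  also have "\<dots> = Re0 (hcnj (B$1$2) * B$1$1 * hcnj (B$2$1) * B$2$2)"
    by (simp add: mult.assoc del: hamilton_sel)
  finally show ?thesis by (simp add: ddet_def mat_mult_nth)
qed

lemma ddet_diag: "ddet (mat2 u 0 0 v ** B) = norm u ^ 2 * norm v ^ 2 * ddet B"
proof -
  define a b c d where "a = B$1$1" and "b = B$1$2" and "c = B$2$1" and "d = B$2$2"
  have *: "hcnj (w * x) * (w * y) = of_real (norm w ^ 2) * (hcnj x * y)" for w x y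
    by (simp only: hcnj_mult mult.assoc hcnj_mult_self_left of_real_left_commute)
  have "hcnj (u * b) * (u * a) * hcnj (v * c) * (v * d) =
      (of_real (norm u ^ 2) * (hcnj b * a)) * (of_real (norm v ^ 2) * (hcnj c * d))"
    unfolding mult.assoc[of _ "hcnj (v * c)"] * ..
  also have "\<dots> = of_real (norm u ^ 2 * norm v ^ 2) * (hcnj b * a * hcnj c * d)"
    unfolding of_real_mult mult.assoc by (metis mult.assoc of_real_commute)
  also have "Re0 \<dots> = norm u ^ 2 * norm v ^ 2 * Re0 (hcnj b * a * hcnj c * d)"
    by (rule Re0_of_real_mult)
  finally show ?thesis
    unfolding ddet_def by (simp add: mat_mult_nth norm_mult power_mult_distrib algebra_simps
        del: hcnj_mult flip: a_def b_def c_def d_def)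
qed

text \<open>After expanding the two squares and the real part, the terms that contain
  \<open>x\<close> cancel: the linear ones by facts 2 and 3, the quadratic ones by fact 4.\<close>

lemma ddet_upper: "ddet (mat2 1 x 0 1 ** B) = ddet B"
proof -
  define a b c d where "a = B$1$1" and "b = B$1$2" and "c = B$2$1" and "d = B$2$2"
  note defs = a_def b_def c_def d_def
  have 1: "norm (a + x * c) ^ 2 = norm a ^ 2 + norm x ^ 2 * norm c ^ 2 + 2 * Re0 (hcnj a * x * c)"
    "norm (b + x * d) ^ 2 = norm b ^ 2 + norm x ^ 2 * norm d ^ 2 + 2 * Re0 (hcnj b * x * d)"
    by (simp_all add: norm_add_sq norm_mult power_mult_distrib mult.assoc)
  have "Re0 (hcnj (x * d) * a * hcnj c * d) = Re0 (hcnj d * (hcnj x * a * hcnj c * d))"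
    by (simp add: mult.assoc)
  also have "\<dots> = Re0 (hcnj x * a * hcnj c * d * hcnj d)" by (subst Re0_commute) simp
  also have "hcnj x * a * hcnj c * d * hcnj d = hcnj x * a * hcnj c * of_real (norm d ^ 2)"
    by (simp only: mult.assoc hcnj_mult_self)
  also have "Re0 \<dots> = norm d ^ 2 * Re0 (hcnj x * a * hcnj c)" by (rule Re0_of_real_mult)
  also have "Re0 (hcnj x * a * hcnj c) = Re0 (hcnj (hcnj x * a * hcnj c))"
    by (simp only: hamilton_sel)
  also have "\<dots> = Re0 (c * (hcnj a * x))" by (simp add: mult.assoc del: hamilton_sel)
  also have "\<dots> = Re0 (hcnj a * x * c)" by (subst Re0_commute) simp
  finally have 2: "Re0 (hcnj (x * d) * a * hcnj c * d) = norm d ^ 2 * Re0 (hcnj a * x * c)" .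
  have 3: "Re0 (hcnj b * (x * c) * hcnj c * d) = norm c ^ 2 * Re0 (hcnj b * x * d)"
    by (simp add: mult.assoc hcnj_mult_self_left of_real_left_commute flip: of_real_power)
  have 4: "Re0 (hcnj (x * d) * (x * c) * hcnj c * d) = norm x ^ 2 * norm c ^ 2 * norm d ^ 2"
    unfolding hcnj_mult mult.assoc hcnj_mult_self_left
    by (simp only: of_real_left_commute[of "hcnj d"] hcnj_mult_self Re0_of_real_mult hamilton_sel_of_real mult.assoc) (simp add: mult.commute)
  have "Re0 (hcnj (b + x * d) * (a + x * c) * hcnj c * d) =
     Re0 (hcnj b * a * hcnj c * d) + Re0 (hcnj (x * d) * a * hcnj c * d)
     + Re0 (hcnj b * (x * c) * hcnj c * d) + Re0 (hcnj (x * d) * (x * c) * hcnj c * d)"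
    by (simp add: algebra_simps del: hcnj_mult)
  with 1 2 3 4 show ?thesis
    unfolding ddet_def by (simp add: mat_mult_nth flip: defs) (simp add: algebra_simps)
qed

text \<open>As a property of the left factor alone, multiplicativity is closed under products, so
  that it need only be checked for elementary matrices.\<close>

definition ddet_mult_left :: "hamilton^2^2 \<Rightarrow> bool" where
  "ddet_mult_left A \<longleftrightarrow> (\<forall>B. ddet (A ** B) = ddet A * ddet B)"

lemma ddet_mult_left_mult:
  assumes "ddet_mult_left A" "ddet_mult_left B" shows "ddet_mult_left (A ** B)"
  using assms by (simp add: ddet_mult_left_def flip: matrix_mul_assoc)

lemma ddet_mat_1 [simp]: "ddet (mat 1) = 1"
  by (simp add: ddet_def)

lemma ddet_mult_left_swap: "ddet_mult_left (mat2 0 1 1 0)"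
  unfolding ddet_mult_left_def by (simp add: ddet_swap) (simp add: ddet_def)

lemma ddet_mult_left_diag: "ddet_mult_left (mat2 u 0 0 v)"
  unfolding ddet_mult_left_def by (simp add: ddet_diag) (simp add: ddet_def)

lemma ddet_mult_left_upper: "ddet_mult_left (mat2 1 x 0 1)"
  unfolding ddet_mult_left_def by (simp add: ddet_upper) (simp add: ddet_def)

lemma ddet_mult_left_lower: "ddet_mult_left (mat2 1 0 x 1)"
proof -
  have "mat2 1 0 x 1 = mat2 0 1 1 0 ** (mat2 1 x 0 1 ** mat2 0 1 1 0)"
    by (simp add: mat2_eq_iff mat_mult_nth)
  then show ?thesis
    by (metis ddet_mult_left_mult ddet_mult_left_swap ddet_mult_left_upper)
qed

text \<open>LDU factorization with pivot \<open>A$1$1\<close>; the second diagonal entry is the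
  Schur complement of the pivot.\<close>

lemma ddet_mult_left_nz: "ddet_mult_left A" if "A$1$1 \<noteq> 0"
proof -
  define a where "a = A$1$1"
  have "A = mat2 1 0 (A$2$1 * inverse a) 1 ** (mat2 a 0 0 (A$2$2 - A$2$1 * inverse a * A$1$2) **
    mat2 1 (inverse a * A$1$2) 0 1)"
    using that by (simp add: mat2_eq_iff mat_mult_nth mult.assoc flip: a_def)
      (simp add: right_inverse flip: mult.assoc)
  then show ?thesis
    by (metis ddet_mult_left_mult ddet_mult_left_lower ddet_mult_left_diag ddet_mult_left_upper)
qed

lemma ddet_mult: "ddet (A ** B) = ddet A * ddet B"
proof -
  \<comment> \<open>Exchanging rows or columns by \<open>?s\<close> moves a nonzero entry to the
    upper left corner; only the zero matrix has none.\<close>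
  let ?s = "mat2 0 1 1 0"
  have ss: "?s ** (?s ** A) = A" "(A ** ?s) ** ?s = A" for A
    by (simp_all add: mat2_eq_iff mat_mult_nth)
  have row: "ddet_mult_left A" if "A$2$1 \<noteq> 0" for A
  proof -
    have "ddet_mult_left (?s ** A)" using that by (intro ddet_mult_left_nz) (simp add: mat_mult_nth)
    then show ?thesis by (metis ss(1) ddet_mult_left_mult ddet_mult_left_swap)
  qed
  have col1: "ddet_mult_left A" if "A$1$1 \<noteq> 0 \<or> A$2$1 \<noteq> 0" for A
    using that row ddet_mult_left_nz by blast
  have col2: "ddet_mult_left A" if "A$1$2 \<noteq> 0 \<or> A$2$2 \<noteq> 0" for A
  proof -
    have "ddet_mult_left (A ** ?s)" using that by (intro col1) (simp add: mat_mult_nth)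
    then show ?thesis by (metis ss(2) ddet_mult_left_mult ddet_mult_left_swap)
  qed
  have "ddet_mult_left A"
  proof (cases "A = 0")
    case True
    then show ?thesis by (simp add: ddet_mult_left_def ddet_def mat_mult_nth)
  next
    case False
    then show ?thesis using col1[of A] col2[of A] by (auto simp: mat2_eq_iff)
  qed
  then show ?thesis by (simp add: ddet_mult_left_def)
qed

text \<open>Each diagonal entry contains a product and its conjugate, whose sum is twice a real
  part. Cyclic rotations of the product have the same real part, and each diagonal entry uses the
  rotation made of its own terms.\<close>

lemma adj2_mult_left: "adj2 A ** A = mat2 (of_real (ddet A)) 0 0 (of_real (ddet A))"
proof -
  define a b c d where "a = A$1$1" and "b = A$1$2" and "c = A$2$1" and "d = A$2$2"
  note defs = a_def b_def c_def d_def
  have r: "2 * Re0 (hcnj b * a * hcnj c * d) = 2 * Re0 (hcnj c * d * hcnj b * a)"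
    using Re0_commute[of "hcnj b * a" "hcnj c * d"] by (simp add: mult.assoc)
  have s: "of_real (2 * Re0 (hcnj c * d * hcnj b * a)) = 
    hcnj c * d * hcnj b * a + hcnj a * b * hcnj d * c" 
    unfolding of_real_Re0_times_2 by (simp add: mult.assoc)
  have s': "of_real (2 * Re0 (hcnj b * a * hcnj c * d)) = 
    hcnj b * a * hcnj c * d + hcnj d * c * hcnj a * b" 
    unfolding of_real_Re0_times_2 by (simp add: mult.assoc)
  have n: "of_real (norm x ^ 2) * hcnj y * y = of_real (norm x ^ 2 * norm y ^ 2)" 
    "of_real (norm x ^ 2) * hcnj y * z = of_real (norm x ^ 2) * (hcnj y * z)" 
    for x y z by (simp_all add: mult.assoc hcnj_mult_self flip: of_real_power)
  have 1: "(of_real (norm d ^ 2) * hcnj a - hcnj c * d * hcnj b) * a + (of_real (norm b ^ 2) * hcnj c - hcnj a * b * hcnj d) * c = of_real (ddet A)"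
    unfolding ddet_def defs[symmetric] of_real_diff of_real_add r s left_diff_distrib n by (simp add: algebra_simps)
  have 2: "(of_real (norm c ^ 2) * hcnj b - hcnj d * c * hcnj a) * b + (of_real (norm a ^ 2) * hcnj d - hcnj b * a * hcnj c) * d = of_real (ddet A)"
    unfolding ddet_def defs[symmetric] of_real_diff of_real_add s' left_diff_distrib n by (simp add: algebra_simps)
  have c: "x * y * hcnj z * z = of_real (norm z ^ 2) * (x * y)" "x * hcnj z * z = of_real (norm z ^ 2) * x"
    for x y z by (simp_all add: mult.assoc hcnj_mult_self of_real_commute flip: of_real_power)
  have 3: "(of_real (norm d ^ 2) * hcnj a - hcnj c * d * hcnj b) * b + (of_real (norm b ^ 2) * hcnj c - hcnj a * b * hcnj d) * d = 0"
    unfolding left_diff_distrib c by (simp add: mult.assoc hcnj_mult_self of_real_commute)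
  have 4: "(of_real (norm c ^ 2) * hcnj b - hcnj d * c * hcnj a) * a + (of_real (norm a ^ 2) * hcnj d - hcnj b * a * hcnj c) * c = 0"
    unfolding left_diff_distrib c by (simp add: mult.assoc hcnj_mult_self of_real_commute)
  from 1 2 3 4 show ?thesis
    by (simp only: mat2_eq_iff mat_mult_nth adj2_def mat2_nth defs)
qed

lemma adj2_mult_right: "A ** adj2 A = mat2 (of_real (ddet A)) 0 0 (of_real (ddet A))"
proof -
  define a b c d where "a = A$1$1" and "b = A$1$2" and "c = A$2$1" and "d = A$2$2"
  note defs = a_def b_def c_def d_def
  have r: "Re0 (hcnj b * a * hcnj c * d) = Re0 (a * hcnj c * d * hcnj b)"
    using Re0_commute[of "hcnj b" "a * hcnj c * d"] by (simp add: mult.assoc)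
  have r': "Re0 (hcnj b * a * hcnj c * d) = Re0 (d * hcnj b * a * hcnj c)"
    using Re0_commute[of "hcnj b * a * hcnj c" d] by (simp add: mult.assoc)
  have s: "of_real (2 * Re0 (a * hcnj c * d * hcnj b)) =
    a * hcnj c * d * hcnj b + b * hcnj d * c * hcnj a"
    unfolding of_real_Re0_times_2 by (simp add: mult.assoc)
  have s': "of_real (2 * Re0 (d * hcnj b * a * hcnj c)) =
    d * hcnj b * a * hcnj c + c * hcnj a * b * hcnj d"
    unfolding of_real_Re0_times_2 by (simp add: mult.assoc)
  have n: "y * (of_real (norm x ^ 2) * hcnj y) = of_real (norm x ^ 2 * norm y ^ 2)"
    "z * (of_real (norm x ^ 2) * hcnj y) = of_real (norm x ^ 2) * (z * hcnj y)"
    for x y z by (simp_all add: hcnj_mult_self of_real_left_commute flip: of_real_power)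
  have 1: "a * (of_real (norm d ^ 2) * hcnj a - hcnj c * d * hcnj b) + b * (of_real (norm c ^ 2) * hcnj b - hcnj d * c * hcnj a) = of_real (ddet A)"
    unfolding ddet_def defs[symmetric] of_real_diff of_real_add r s right_diff_distrib n by (simp add: algebra_simps)
  have 2: "c * (of_real (norm b ^ 2) * hcnj c - hcnj a * b * hcnj d) + d * (of_real (norm a ^ 2) * hcnj d - hcnj b * a * hcnj c) = of_real (ddet A)"
    unfolding ddet_def defs[symmetric] of_real_diff of_real_add r' s' right_diff_distrib n by (simp add: algebra_simps)
  have c: "x * (hcnj x * y * z) = of_real (norm x ^ 2) * (y * z)"
    for x y z by (simp add: mult.assoc hcnj_mult_self_left)
  have 3: "a * (of_real (norm b ^ 2) * hcnj c - hcnj a * b * hcnj d) + b * (of_real (norm a ^ 2) * hcnj d - hcnj b * a * hcnj c) = 0"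
    unfolding right_diff_distrib c n by simp
  have 4: "c * (of_real (norm d ^ 2) * hcnj a - hcnj c * d * hcnj b) + d * (of_real (norm c ^ 2) * hcnj b - hcnj d * c * hcnj a) = 0"
    unfolding right_diff_distrib c n by simp
  from 1 2 3 4 show ?thesis
    by (simp only: mat2_eq_iff mat_mult_nth adj2_def mat2_nth defs)
qed

lemma ddet_1_inverse:
  assumes "ddet A = 1" shows "adj2 A ** A = mat 1" "A ** adj2 A = mat 1" "ddet (adj2 A) = 1"
proof -
  show 1: "adj2 A ** A = mat 1" "A ** adj2 A = mat 1"
    using assms adj2_mult_left[of A] adj2_mult_right[of A] by (simp_all add: mat2_eq_iff)
  show "ddet (adj2 A) = 1" using arg_cong[OF 1(1), of ddet] assms by (simp add: ddet_mult)
qed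

text \<open>For the columns (p, q) and (r, s) the right-hand side is the reduced norm of q r - q p
  q^-1 s. Hence an approximant is the first column of a matrix with \<open>ddet\<close> equal to
  1.\<close>

lemma ddet_nz_col:
  assumes "c \<noteq> 0" shows "ddet (mat2 a b c d) = norm c ^ 2 * norm (b - a * inverse c * d) ^ 2"
proof -
  have ci: "inverse c = of_real (inverse (norm c ^ 2)) * hcnj c"
    by (simp add: inverse_hamilton_def of_real_def)
  have n: "norm c ^ 2 * norm (a * inverse c * d) ^ 2 = norm a ^ 2 * norm d ^ 2"
    unfolding norm_mult norm_inverse power_mult_distrib using assms by (simp add: field_simps)
  have "Re0 (hcnj b * - (a * inverse c * d)) = - inverse (norm c ^ 2) * Re0 (hcnj b * a * hcnj c * d)"
    unfolding ci by (simp add: mult.assoc of_real_left_commute flip: of_real_power of_real_inverse)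
  with assms have "norm c ^ 2 * Re0 (hcnj b * - (a * inverse c * d)) = - Re0 (hcnj b * a * hcnj c * d)"
    by simp
  note r = this
  have "norm (b - a * inverse c * d) ^ 2 =
      norm b ^ 2 + norm (a * inverse c * d) ^ 2 + 2 * Re0 (hcnj b * - (a * inverse c * d))"
    using norm_add_sq[of b "- (a * inverse c * d)"] by (simp only: norm_minus_cancel add_uminus_conv_diff)
  then have "norm c ^ 2 * norm (b - a * inverse c * d) ^ 2 =
      norm c ^ 2 * norm b ^ 2 + norm c ^ 2 * norm (a * inverse c * d) ^ 2
      + 2 * (norm c ^ 2 * Re0 (hcnj b * - (a * inverse c * d)))"
    by (simp only: distrib_left mult.left_commute[of _ 2])
  then show ?thesis unfolding n r by (simp add: ddet_def)
qed

lemma ddet_nonneg: "ddet A \<ge> 0"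
proof -
  have "Re0 (hcnj (A$1$2) * A$1$1 * hcnj (A$2$1) * A$2$2) \<le>
     norm (A$1$2) * norm (A$1$1) * norm (A$2$1) * norm (A$2$2)"
    by (rule order_trans[OF Re0_le_norm]) (simp add: norm_mult)
  moreover have "0 \<le> (norm (A$1$1) * norm (A$2$2) - norm (A$1$2) * norm (A$2$1)) ^ 2" by simp
  ultimately show ?thesis by (simp add: ddet_def power2_eq_square algebra_simps)
qed

lemma ddet_diff_le:
  "\<bar>ddet A - norm (A$1$1) ^ 2 * norm (A$2$2) ^ 2\<bar> \<le> (norm (A$1$2) * norm (A$2$1)) ^ 2 +
    2 * norm (A$1$1) * norm (A$2$2) * (norm (A$1$2) * norm (A$2$1))"
proof -
  define r where "r = Re0 (hcnj (A$1$2) * A$1$1 * hcnj (A$2$1) * A$2$2)"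
  have "\<bar>Re0 x\<bar> \<le> norm x" for x
    using Re0_le_norm[of x] Re0_le_norm[of "- x"] by simp
  from this[of "hcnj (A$1$2) * A$1$1 * hcnj (A$2$1) * A$2$2"]
  have "\<bar>r\<bar> \<le> norm (A$1$1) * norm (A$2$2) * (norm (A$1$2) * norm (A$2$1))"
    by (simp add: r_def norm_mult ac_simps)
  moreover have "\<bar>P - 2 * r\<bar> \<le> P + 2 * \<bar>r\<bar>" if "P \<ge> 0" for P using that by linarith
  from this[of "(norm (A$1$2) * norm (A$2$1)) ^ 2"]
  have "\<bar>ddet A - norm (A$1$1) ^ 2 * norm (A$2$2) ^ 2\<bar> \<le> (norm (A$1$2) * norm (A$2$1)) ^ 2 + 2 * \<bar>r\<bar>"
    by (simp add: ddet_def r_def power_mult_distrib)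
  ultimately show ?thesis by (simp add: mult.assoc)
qed

text \<open>If the lower entry of \<open>v\<close> is nonzero, the vanishing of \<open>ddet\<close>
  is the vanishing of a Schur complement. The scalar stands on the right because matrices act on the
  left, so that their action preserves proportionality.\<close>

lemma ddet_eq_0_imp_proportional:
  fixes v w :: "hamilton^2"
  assumes "ddet (mat2 (v$1) (w$1) (v$2) (w$2)) = 0" and "v \<noteq> 0"
  obtains l where "w$1 = v$1 * l" "w$2 = v$2 * l"
proof (cases "v$2 = 0")
  case True
  with assms have "v$1 \<noteq> 0" by (auto simp: vec2_eq_iff)
  moreover from this True assms have "w$2 = 0" by (auto simp: ddet_def)
  ultimately show ?thesis using True that[of "inverse (v$1) * w$1"] by (simp flip: mult.assoc)
next
  case False
  with assms have "w$1 = v$1 * inverse (v$2) * w$2" by (auto simp: ddet_nz_col)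
  with False show ?thesis using that[of "inverse (v$2) * w$2"] by (simp add: mult.assoc) (simp flip: mult.assoc)
qed

section \<open>Recurrence for orders in Hamilton's quaternions\<close>

definition flow :: "real \<Rightarrow> hamilton^2^2" where
  "flow t = mat2 (of_real (exp t)) 0 0 (of_real (exp (- t)))"

definition unip :: "hamilton \<Rightarrow> hamilton^2^2" where
  "unip x = mat2 1 (- x) 0 1"

definition mats :: "'a set \<Rightarrow> ('a^2^2) set" where
  "mats S = {A. \<forall>i j. A $ i $ j \<in> S}"

lemma mats_iff: "A \<in> mats S \<longleftrightarrow> A$1$1 \<in> S \<and> A$1$2 \<in> S \<and> A$2$1 \<in> S \<and> A$2$2 \<in> S"
  by (simp add: mats_def forall_2)

lemma ddet_flow [simp]: "ddet (flow t) = 1"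
  by (simp add: ddet_def flow_def flip: power_mult_distrib exp_add)

lemma ddet_unip [simp]: "ddet (unip x) = 1"
  by (simp add: ddet_def unip_def)

lemma flow_unip_nth:
  "(flow t ** unip x *v v) $ 1 = of_real (exp t) * (v $ 1 - x * v $ 2)"
  "(flow t ** unip x *v v) $ 2 = of_real (exp (- t)) * v $ 2"
  by (simp_all add: flow_def unip_def mat_vec_mult_nth mat_mult_nth algebra_simps)

lemma mat_mult_mat2_cols:
  "A ** mat2 a b c d = mat2 ((A *v vector [a, c]) $ 1) ((A *v vector [b, d]) $ 1)
     ((A *v vector [a, c]) $ 2) ((A *v vector [b, d]) $ 2)"
  by (simp add: mat2_eq_iff mat_mult_nth mat_vec_mult_nth)

lemma ddet_le:
  assumes "\<And>i j. norm (A $ i $ j) \<le> C" shows "ddet A \<le> 4 * C ^ 4"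
proof -
  have C: "C \<ge> 0" using assms[of 1 1] norm_ge_zero order_trans by blast
  have p: "norm (A$i$j) * norm (A$k$l) \<le> C ^ 2" for i j k l
    unfolding power2_eq_square by (intro mult_mono assms C norm_ge_zero)
  have q: "(norm (A$i$j) * norm (A$k$l)) * (norm (A$i'$j') * norm (A$k'$l')) \<le> C ^ 2 * C ^ 2"
    for i j k l i' j' k' l'
    by (intro mult_mono p) auto
  have "ddet A \<le> norm (A$1$1) ^ 2 * norm (A$2$2) ^ 2 + (norm (A$1$2) * norm (A$2$1)) ^ 2 +
    2 * norm (A$1$1) * norm (A$2$2) * (norm (A$1$2) * norm (A$2$1))"
    using ddet_diff_le[of A] by linarith
  then show ?thesis
    using q[of 1 1 2 2 1 1 2 2] q[of 1 2 2 1 1 2 2 1] q[of 1 1 2 2 1 2 2 1]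
    by (simp add: power2_eq_square power4_eq_xxxx algebra_simps)
qed

text \<open>Integrality of the norm is the arithmetic input here: it makes nonzero elements have
  norm at least 1, closes \<open>R\<close> under conjugation and makes determinants
  integers.\<close>

locale hamilton_order =
  fixes R J :: "hamilton set"
  assumes one_R: "1 \<in> R"
    and diff_R: "x \<in> R \<Longrightarrow> y \<in> R \<Longrightarrow> x - y \<in> R"
    and mult_R: "x \<in> R \<Longrightarrow> y \<in> R \<Longrightarrow> x * y \<in> R"
    and norm_sq_R: "x \<in> R \<Longrightarrow> norm x ^ 2 \<in> \<int>"
    and span_R: "span R = UNIV"
    and ideal_J: "two_sided_ideal R J"
    and J_nonzero: "J \<noteq> {0}"
begin

section \<open>Arithmetic of the order\<close>

lemma zero_R: "0 \<in> R" using diff_R[OF one_R one_R] by simp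

lemma minus_R: "x \<in> R \<Longrightarrow> - x \<in> R" using diff_R[OF zero_R] by fastforce

lemma add_R: "x \<in> R \<Longrightarrow> y \<in> R \<Longrightarrow> x + y \<in> R" using diff_R[of x "- y"] minus_R by simp

lemma of_nat_R: "of_nat n \<in> R" by (induction n) (auto intro: zero_R one_R add_R)

lemma of_int_R: "of_int n \<in> R" by (cases n rule: int_cases2) (auto intro: of_nat_R minus_R)

lemma Ints_R: "r \<in> \<int> \<Longrightarrow> of_real r \<in> R" by (auto elim!: Ints_cases intro: of_int_R)

lemma sum_R: "(\<And>i. i \<in> S \<Longrightarrow> f i \<in> R) \<Longrightarrow> sum f S \<in> R"
  by (induction S rule: infinite_finite_induct) (auto intro: zero_R add_R)

lemma J_R: "x \<in> J \<Longrightarrow> x \<in> R"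
  and zero_J: "0 \<in> J"
  and diff_J: "x \<in> J \<Longrightarrow> y \<in> J \<Longrightarrow> x - y \<in> J"
  and mult_J_left: "a \<in> R \<Longrightarrow> x \<in> J \<Longrightarrow> a * x \<in> J"
  and mult_J_right: "x \<in> J \<Longrightarrow> a \<in> R \<Longrightarrow> x * a \<in> J"
  using ideal_J by (auto simp: two_sided_ideal_def)

lemma minus_J: "x \<in> J \<Longrightarrow> - x \<in> J" using diff_J[OF zero_J] by fastforce

lemma add_J: "x \<in> J \<Longrightarrow> y \<in> J \<Longrightarrow> x + y \<in> J" using diff_J[of x "- y"] minus_J by simp

lemma trace_R: "x \<in> R \<Longrightarrow> 2 * Re0 x \<in> \<int>"
proof -
  assume "x \<in> R"
  then have "norm (x + 1) ^ 2 - norm x ^ 2 - 1 \<in> \<int>"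
    by (intro Ints_diff norm_sq_R add_R one_R) auto
  then show ?thesis by (simp add: norm_add_sq)
qed

lemma hcnj_R: "x \<in> R \<Longrightarrow> hcnj x \<in> R"
  unfolding hcnj_conv by (intro diff_R Ints_R trace_R)

lemma norm_ge_1: "x \<in> R \<Longrightarrow> x \<noteq> 0 \<Longrightarrow> norm x \<ge> 1"
proof -
  assume x: "x \<in> R" "x \<noteq> 0"
  then have "norm x ^ 2 > 0" by simp
  moreover obtain n where "norm x ^ 2 = of_int n" using norm_sq_R[OF x(1)] by (auto elim!: Ints_cases)
  ultimately have "norm x ^ 2 \<ge> 1" by simp
  then show ?thesis by (metis norm_ge_zero one_power2 power2_le_imp_le)
qed

lemma finite_R_ball: "finite {x \<in> R. norm x \<le> C}"
proof (rule ccontr)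
  assume inf: "infinite {x \<in> R. norm x \<le> C}"
  have "bounded {x \<in> R. norm x \<le> C}" by (auto simp: bounded_iff)
  from bounded_infinite_imp_islimpt[OF subset_refl this inf]
  obtain z where "z islimpt {x \<in> R. norm x \<le> C}" .
  moreover have "\<not> z islimpt {x \<in> R. norm x \<le> C}"
  proof (rule discrete_imp_not_islimpt[of 1])
    fix x y assume "x \<in> {x \<in> R. norm x \<le> C}" "y \<in> {x \<in> R. norm x \<le> C}" "dist y x < 1"
    then show "y = x" using norm_ge_1[of "y - x"] diff_R[of y x] by (auto simp: dist_norm)
  qed simp
  ultimately show False by blast
qed

lemma ddet_Ints: "A \<in> mats R \<Longrightarrow> ddet A \<in> \<int>"
  unfolding ddet_def mats_iff
  by (intro Ints_diff Ints_add Ints_mult trace_R norm_sq_R mult_R hcnj_R) auto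

lemma adj2_R: "A \<in> mats R \<Longrightarrow> adj2 A \<in> mats R"
  unfolding mats_iff adj2_def mat2_nth
  by (intro conjI diff_R mult_R hcnj_R Ints_R norm_sq_R) auto

lemma mat_mult_R: "A \<in> mats R \<Longrightarrow> B \<in> mats R \<Longrightarrow> A ** B \<in> mats R"
  unfolding mats_iff by (auto simp: mat_mult_nth intro!: add_R mult_R)

text \<open>For the image of an order this is the image of the rational algebra
  (\<open>rationals_eq\<close>). Integer denominators suffice for fractions, since p q^-1 is p times
  the conjugate of q, divided by an integer.\<close>

definition rationals :: "hamilton set" where
  "rationals = {x. \<exists>n::int. n \<noteq> 0 \<and> of_int n * x \<in> R}"

lemma fraction_in_rationals:
  assumes "p \<in> R" "q \<in> R" "q \<noteq> 0" shows "p * inverse q \<in> rationals"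
proof -
  obtain n where n: "norm q ^ 2 = of_int n" using norm_sq_R[OF assms(2)] by (auto elim!: Ints_cases)
  have "n \<noteq> 0" using n assms(3) by auto
  moreover have "of_int n * (p * inverse q) = p * hcnj q"
  proof -
    have "of_int n = hcnj q * q" unfolding hcnj_mult_self n by simp
    moreover have "of_int n * (p * inverse q) = p * (of_int n * inverse q)"
      by (metis mult.assoc of_real_commute of_real_of_int_eq)
    ultimately show ?thesis using assms(3) by (metis mult.assoc mult.right_neutral right_inverse)
  qed
  ultimately show ?thesis unfolding rationals_def using mult_R[OF assms(1) hcnj_R[OF assms(2)]] by auto
qed

lemma irrational_diff_nonzero:
  fixes v :: "hamilton^2"
  assumes "x \<notin> rationals" "v$1 \<in> R" "v$2 \<in> R" "v \<noteq> 0"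
  shows "v$1 - x * v$2 \<noteq> 0"
proof
  assume 0: "v$1 - x * v$2 = 0"
  then have "v$2 \<noteq> 0" using assms(4) by (auto simp: vec2_eq_iff)
  then have "x = v$1 * inverse (v$2)" using 0 by (simp add: mult.assoc)
  then show False using fraction_in_rationals assms \<open>v$2 \<noteq> 0\<close> by blast
qed

section \<open>The congruence group and its action on primitive columns\<close>

definition cong_group :: "(hamilton^2^2) set" where
  "cong_group = {A \<in> mats R. ddet A = 1 \<and> A - mat 1 \<in> mats J}"

text \<open>These are the approximants in the form given by \<open>ddet_nz_col\<close>. Unlike
  there, the lower entry may be 0, as in the column (1, 0); this does not affect limits in which
  that entry tends to infinity.\<close>

definition primitive :: "(hamilton^2) set" where
  "primitive = {v. v$1 \<in> R \<and> v$2 \<in> J \<and> (\<exists>r\<in>R. \<exists>s\<in>R. ddet (mat2 (v$1) r (v$2) s) = 1)}"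

lemma cong_group_entries:
  assumes "A \<in> cong_group"
  shows "A \<in> mats R" "ddet A = 1" "A$1$1 - 1 \<in> J" "A$1$2 \<in> J" "A$2$1 \<in> J" "A$2$2 - 1 \<in> J"
  using assms by (auto simp: cong_group_def mats_iff)

lemma cong_groupI:
  assumes "ddet A = 1" "A$1$1 - 1 \<in> J" "A$1$2 \<in> J" "A$2$1 \<in> J" "A$2$2 - 1 \<in> J"
  shows "A \<in> cong_group"
proof -
  have "A$1$1 = (A$1$1 - 1) + 1" "A$2$2 = (A$2$2 - 1) + 1" by simp_all
  then have "A \<in> mats R" unfolding mats_iff using J_R add_R one_R assms by metis
  with assms show ?thesis by (simp add: cong_group_def mats_iff)
qed

lemma cong_group_mult:
  assumes "A \<in> cong_group" "B \<in> cong_group" shows "A ** B \<in> cong_group"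
proof (rule cong_groupI)
  note A = cong_group_entries[OF assms(1)]
  note B = cong_group_entries[OF assms(2)]
  note R = A(1)[unfolded mats_iff] B(1)[unfolded mats_iff]
  show "ddet (A ** B) = 1" by (simp add: ddet_mult A B)
  have "(A ** B)$1$1 - 1 = (A$1$1 - 1) * B$1$1 + (B$1$1 - 1) + A$1$2 * B$2$1"
    "(A ** B)$2$2 - 1 = A$2$1 * B$1$2 + ((A$2$2 - 1) * B$2$2 + (B$2$2 - 1))"
    by (simp_all add: mat_mult_nth algebra_simps)
  then show "(A ** B)$1$1 - 1 \<in> J" "(A ** B)$2$2 - 1 \<in> J"
    using A B R by (metis add_J mult_J_right mult_J_left)+
  show "(A ** B)$1$2 \<in> J" "(A ** B)$2$1 \<in> J"
    unfolding mat_mult_nth using A B R by (blast intro: add_J mult_J_right mult_J_left)+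
qed

lemma cong_group_adj2:
  assumes "A \<in> cong_group" shows "adj2 A \<in> cong_group"
proof (rule cong_groupI)
  note A = cong_group_entries[OF assms]
  have B: "adj2 A \<in> mats R" using A adj2_R by blast
  note R = A(1)[unfolded mats_iff] B[unfolded mats_iff]
  note inv = ddet_1_inverse[OF A(2)]
  show "ddet (adj2 A) = 1" by (rule inv)
  \<comment> \<open>With B = \<open>adj2 A\<close> and A B = 1, the difference B - 1 equals - (A -
    1) B, whose entries lie in the ideal because those of A - 1 do.\<close>
  have "adj2 A$i$j - (mat 1 :: hamilton^2^2)$i$j = adj2 A$i$j - (A ** adj2 A)$i$j" for i j
    by (simp add: inv)
  from this[of 1 1] this[of 1 2] this[of 2 1] this[of 2 2] have
    "adj2 A$1$1 - 1 = - ((A$1$1 - 1) * adj2 A$1$1 + A$1$2 * adj2 A$2$1)"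
    "adj2 A$1$2 = - ((A$1$1 - 1) * adj2 A$1$2 + A$1$2 * adj2 A$2$2)"
    "adj2 A$2$1 = - (A$2$1 * adj2 A$1$1 + (A$2$2 - 1) * adj2 A$2$1)"
    "adj2 A$2$2 - 1 = - (A$2$1 * adj2 A$1$2 + (A$2$2 - 1) * adj2 A$2$2)"
    by (simp_all add: mat_mult_nth algebra_simps)
  moreover have "- ((A$1$1 - 1) * adj2 A$1$1 + A$1$2 * adj2 A$2$1) \<in> J"
    "- ((A$1$1 - 1) * adj2 A$1$2 + A$1$2 * adj2 A$2$2) \<in> J"
    "- (A$2$1 * adj2 A$1$1 + (A$2$2 - 1) * adj2 A$2$1) \<in> J"
    "- (A$2$1 * adj2 A$1$2 + (A$2$2 - 1) * adj2 A$2$2) \<in> J"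
    using A R by (blast intro: minus_J add_J mult_J_right)+
  ultimately show "adj2 A$1$1 - 1 \<in> J" "adj2 A$1$2 \<in> J" "adj2 A$2$1 \<in> J" "adj2 A$2$2 - 1 \<in> J"
    by (simp_all only:)
qed

lemma cong_group_primitive:
  assumes "A \<in> cong_group" "v \<in> primitive" shows "A *v v \<in> primitive"
proof -
  note A = cong_group_entries[OF assms(1)]
  from assms(2) obtain r s where v: "v$1 \<in> R" "v$2 \<in> J" and rs: "r \<in> R" "s \<in> R"
    and d: "ddet (mat2 (v$1) r (v$2) s) = 1"
    by (auto simp: primitive_def)
  have v2: "v$2 \<in> R" using v J_R by blast
  let ?B = "A ** mat2 (v$1) r (v$2) s"
  have "ddet ?B = 1" by (simp add: ddet_mult A d)
  moreover have "?B = mat2 ((A *v v)$1) (?B$1$2) ((A *v v)$2) (?B$2$2)"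
    by (simp add: mat2_eq_iff mat_mult_nth mat_vec_mult_nth)
  moreover have "?B \<in> mats R"
    using A(1) v v2 rs by (intro mat_mult_R) (auto simp: mats_iff)
  moreover have "(A *v v)$2 \<in> J"
    unfolding mat_vec_mult_nth using A v by (intro add_J mult_J_right[of "A$2$1"] mult_J_left) (auto simp: mats_iff)
  moreover have "(A *v v)$1 \<in> R"
    unfolding mat_vec_mult_nth using A(1) v v2 by (auto intro!: add_R mult_R simp: mats_iff)
  ultimately show ?thesis unfolding primitive_def mats_iff
    by (intro CollectI conjI bexI[of _ "?B$1$2"] bexI[of _ "?B$2$2"]) simp_all
qed

section \<open>Dirichlet's box principle and short columns\<close>

lemma obtain_basis:
  obtains B where "B \<subseteq> R" "finite B" "independent B" "span B = UNIV" "B \<noteq> {}"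
proof -
  obtain B where B: "B \<subseteq> R" "independent B" "R \<subseteq> span B" by (rule maximal_independent_subset)
  have s: "span B = UNIV" using span_R B(3) by (metis span_minimal subspace_span top.extremum_uniqueI)
  have "B \<noteq> {}"
  proof
    assume "B = {}"
    with s have "(1::hamilton) \<in> {0}" by (metis UNIV_I span_empty)
    then show False by simp
  qed
  then show ?thesis using that[of B] B s independent_imp_finite by blast
qed

lemma R_cobounded: obtains C where "\<And>y. \<exists>p\<in>R. norm (y - p) \<le> C"
proof -
  obtain B where B: "B \<subseteq> R" "finite B" "independent B" "span B = UNIV" by (rule obtain_basis)
  have "\<exists>p\<in>R. norm (y - p) \<le> (\<Sum>b\<in>B. norm b)" for y
  proof (intro bexI)
    let ?c = "representation B y"
    have y: "(\<Sum>b\<in>B. ?c b *\<^sub>R b) = y" using B by (intro sum_representation_eq) auto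
    have "y - (\<Sum>b\<in>B. of_int \<lfloor>?c b\<rfloor> *\<^sub>R b) = (\<Sum>b\<in>B. frac (?c b) *\<^sub>R b)"
      by (subst y[symmetric]) (simp add: sum_subtractf frac_def scaleR_diff_left)
    also have "norm \<dots> \<le> (\<Sum>b\<in>B. norm (frac (?c b) *\<^sub>R b))" by (rule norm_sum)
    also have "\<dots> \<le> (\<Sum>b\<in>B. norm b)"
      by (intro sum_mono) (simp add: mult_left_le_one_le less_imp_le[OF frac_lt_1])
    finally show "norm (y - (\<Sum>b\<in>B. of_int \<lfloor>?c b\<rfloor> *\<^sub>R b)) \<le> (\<Sum>b\<in>B. norm b)" .
    have "of_int n *\<^sub>R b = of_int n * b" for n and b :: hamilton
      by (simp add: scaleR_conv_of_real)
    then show "(\<Sum>b\<in>B. of_int \<lfloor>?c b\<rfloor> *\<^sub>R b) \<in> R"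
      using B by (auto intro!: sum_R mult_R of_int_R)
  qed
  then show ?thesis by (rule that)
qed

text \<open>The sizes m and 1 / m are those that \<open>flow t\<close> with \<open>exp t\<close>
  near \<open>m\<close> turns into bounded ones. The constant comes from the norms of a basis inside
  \<open>R\<close>, so it is uniform in \<open>x\<close> and \<open>m\<close>.\<close>

lemma dirichlet:
  obtains C where "C \<ge> 1" "\<And>x (m::nat). m \<ge> 1 \<Longrightarrow> \<exists>p\<in>R. \<exists>q\<in>R. q \<noteq> 0 \<and> norm q \<le> C * real m \<and>
    norm (p - x * q) \<le> C / real m"
proof -
  obtain B where B: "B \<subseteq> R" "finite B" "independent B" "span B = UNIV" "B \<noteq> {}"
    by (rule obtain_basis)
  define C where "C = max 1 (\<Sum>b\<in>B. norm b)"
  have "\<exists>p\<in>R. \<exists>q\<in>R. q \<noteq> 0 \<and> norm q \<le> C * real m \<and> norm (p - x * q) \<le> C / real m"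
    if m: "m \<ge> 1" for x and m :: nat
  proof -
    define A where "A = (\<Pi>\<^sub>E b\<in>B. {0..m})"
    define Q where "Q n = (\<Sum>b\<in>B. real (n b) *\<^sub>R b)" for n :: "hamilton \<Rightarrow> nat"
    define Y where "Y n = representation B (x * Q n)" for n
    \<comment> \<open>The coordinates of \<open>x * Q n\<close> modulo 1 are sorted into boxes of
      side \<open>1 / m\<close>: each coordinate has \<open>m\<close> boxes, whereas each
      coefficient takes \<open>m + 1\<close> values.\<close>
    define f where "f n = (\<lambda>b\<in>B. nat \<lfloor>real m * frac (Y n b)\<rfloor>)" for n
    have Y: "(\<Sum>b\<in>B. Y n b *\<^sub>R b) = x * Q n" for n
      unfolding Y_def using B by (intro sum_representation_eq) auto
    have "f n \<in> (\<Pi>\<^sub>E b\<in>B. {..<m})" for n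
    proof -
      have "real m * frac (Y n b) < real m" for b using m frac_lt_1 by simp
      then have "nat \<lfloor>real m * frac (Y n b)\<rfloor> < m" for b
        by (metis floor_less_iff nat_less_iff of_int_of_nat_eq frac_ge_0 mult_nonneg_nonneg
            of_nat_0_le_iff zero_le_floor)
      then show ?thesis by (auto simp: f_def)
    qed
    then have "card (f ` A) \<le> card (\<Pi>\<^sub>E b\<in>B. {..<m})"
      using B by (intro card_mono finite_PiE) auto
    also have "\<dots> < card A"
      using B by (simp add: A_def card_PiE card_gt_0_iff power_strict_mono)
    finally have "\<not> inj_on f A" by (rule pigeonhole)
    then obtain n n' where n: "n \<in> A" "n' \<in> A" "n \<noteq> n'" "f n = f n'" by (auto simp: inj_on_def)
    define q where "q = (\<Sum>b\<in>B. (real (n b) - real (n' b)) *\<^sub>R b)"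
    define p where "p = (\<Sum>b\<in>B. of_int (\<lfloor>Y n b\<rfloor> - \<lfloor>Y n' b\<rfloor>) *\<^sub>R b)"
    have q: "q = Q n - Q n'" by (simp add: q_def Q_def scaleR_diff_left sum_subtractf)
    have "q \<noteq> 0"
    proof
      assume "q = 0"
      then have "real (n b) - real (n' b) = 0" if "b \<in> B" for b
        using independentD[OF B(3,2) subset_refl, of "\<lambda>b. real (n b) - real (n' b)" b] that
        unfolding q_def by simp
      then have "n = n'" using n(1,2) by (intro PiE_ext[of n B _ n']) (auto simp: A_def)
      with n(3) show False by simp
    qed
    moreover have "norm q \<le> C * real m"
    proof -
      have "norm q \<le> (\<Sum>b\<in>B. norm ((real (n b) - real (n' b)) *\<^sub>R b))"
        unfolding q_def by (rule norm_sum)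
      also have "\<dots> \<le> (\<Sum>b\<in>B. real m * norm b)"
      proof (rule sum_mono)
        fix b assume "b \<in> B"
        then have "n b \<le> m" "n' b \<le> m" using n by (auto simp: A_def PiE_iff)
        then have "\<bar>real (n b) - real (n' b)\<bar> \<le> real m" by linarith
        then show "norm ((real (n b) - real (n' b)) *\<^sub>R b) \<le> real m * norm b"
          by (simp add: mult_right_mono)
      qed
      also have "\<dots> = (\<Sum>b\<in>B. norm b) * real m" by (simp add: sum_distrib_left mult.commute)
      also have "\<dots> \<le> C * real m" unfolding C_def by (intro mult_right_mono) auto
      finally show ?thesis .
    qed
    moreover have "norm (p - x * q) \<le> C / real m"
    proof -
      have "x * q - p = (\<Sum>b\<in>B. Y n b *\<^sub>R b) - (\<Sum>b\<in>B. Y n' b *\<^sub>R b) - p"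
        unfolding q right_diff_distrib Y ..
      also have "\<dots> = (\<Sum>b\<in>B. (frac (Y n b) - frac (Y n' b)) *\<^sub>R b)"
        unfolding p_def by (simp add: sum_subtractf sum.distrib frac_def algebra_simps)
      finally have "norm (p - x * q) = norm (\<Sum>b\<in>B. (frac (Y n b) - frac (Y n' b)) *\<^sub>R b)"
        by (metis norm_minus_commute)
      also have "\<dots> \<le> (\<Sum>b\<in>B. norm ((frac (Y n b) - frac (Y n' b)) *\<^sub>R b))" by (rule norm_sum)
      also have "\<dots> \<le> (\<Sum>b\<in>B. (1 / real m) * norm b)"
      proof (rule sum_mono)
        fix b assume b: "b \<in> B"
        let ?r = "real m * frac (Y n b)" and ?s = "real m * frac (Y n' b)"
        have "nat \<lfloor>?r\<rfloor> = nat \<lfloor>?s\<rfloor>" using fun_cong[OF n(4), of b] b by (simp add: f_def)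
        then have "\<lfloor>?r\<rfloor> = \<lfloor>?s\<rfloor>" by (subst (asm) eq_nat_nat_iff) auto
        then have "\<bar>?r - ?s\<bar> \<le> 1" by linarith
        then have "real m * \<bar>frac (Y n b) - frac (Y n' b)\<bar> \<le> 1"
          by (simp add: abs_mult flip: right_diff_distrib)
        then have "\<bar>frac (Y n b) - frac (Y n' b)\<bar> \<le> 1 / real m" using m by (simp add: field_simps)
        then show "norm ((frac (Y n b) - frac (Y n' b)) *\<^sub>R b) \<le> (1 / real m) * norm b"
          unfolding norm_scaleR by (rule mult_right_mono) simp
      qed
      also have "\<dots> = (\<Sum>b\<in>B. norm b) / real m" by (simp add: sum_divide_distrib)
      also have "\<dots> \<le> C / real m" unfolding C_def by (intro divide_right_mono) auto
      finally show ?thesis .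
    qed
    moreover have "of_int k *\<^sub>R b = of_int k * b" for k and b :: hamilton
      by (simp add: scaleR_conv_of_real)
    then have "p \<in> R" unfolding p_def using B by (auto intro!: sum_R mult_R of_int_R simp del: of_int_diff)
    moreover have "real k *\<^sub>R b = of_nat k * b" for k and b :: hamilton
      by (simp add: scaleR_conv_of_real)
    then have "Q k \<in> R" for k unfolding Q_def using B by (auto intro!: sum_R mult_R of_nat_R)
    then have "q \<in> R" unfolding q by (intro diff_R)
    ultimately show ?thesis by blast
  qed
  then show ?thesis by (intro that[of C]) (auto simp: C_def)
qed

lemma dirichlet_flow:
  obtains C where "C \<ge> 1"
    "\<And>x t. t \<ge> 0 \<Longrightarrow> \<exists>v. v$1 \<in> R \<and> v$2 \<in> R \<and> v \<noteq> 0 \<and> (\<forall>i. norm ((flow t ** unip x *v v) $ i) \<le> C)"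
proof -
  obtain C where C: "C \<ge> 1" "\<And>x (m::nat). m \<ge> 1 \<Longrightarrow> \<exists>p\<in>R. \<exists>q\<in>R. q \<noteq> 0 \<and> norm q \<le> C * real m \<and>
    norm (p - x * q) \<le> C / real m" using dirichlet by blast
  have "\<exists>v. v$1 \<in> R \<and> v$2 \<in> R \<and> v \<noteq> 0 \<and> (\<forall>i. norm ((flow t ** unip x *v v) $ i) \<le> 2 * C)"
    if t: "t \<ge> 0" for t x
  proof -
    \<comment> \<open>Since \<open>exp t\<close> is at least 1, rounding up at most doubles it; this
      is the factor 2 in the bound.\<close>
    define m where "m = nat \<lceil>exp t\<rceil>"
    have e: "exp t \<ge> 1" using t by simp
    then have m: "m \<ge> 1" "exp t \<le> real m" "real m \<le> 2 * exp t" unfolding m_def by linarith+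
    from C(2)[OF m(1)] obtain p q where pq: "p \<in> R" "q \<in> R" "q \<noteq> 0" "norm q \<le> C * real m"
      "norm (p - x * q) \<le> C / real m" by blast
    define v :: "hamilton^2" where "v = vector [p, q]"
    have v: "v$1 = p" "v$2 = q" by (simp_all add: v_def)
    have "exp t * norm (p - x * q) \<le> real m * (C / real m)"
      using pq(5) m C(1) by (intro mult_mono) auto
    then have 1: "exp t * norm (p - x * q) \<le> C" using m by simp
    have "norm q \<le> C * (2 * exp t)" using pq(4) m(3) C(1) by (meson mult_left_mono order_trans zero_le_one)
    then have 2: "exp (- t) * norm q \<le> 2 * C" by (simp add: exp_minus field_simps)
    have "norm ((flow t ** unip x *v v) $ i) \<le> 2 * C" for i
      using exhaust_2[of i] 1 2 C(1) by (auto simp: flow_unip_nth norm_mult v)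
    moreover have "v \<noteq> 0" using pq(3) by (auto simp: vec2_eq_iff v)
    ultimately show ?thesis using pq v by metis
  qed
  then show ?thesis by (rule that[rotated]) (use C in auto)
qed

text \<open>If the short vectors at consecutive integer times were always dependent, they would all be
  multiples of one vector, whose image under the flow grows exponentially because \<open>x\<close> is irrational.\<close>

lemma independent_bounded_columns:
  obtains C where "C \<ge> 1" "\<And>x T. x \<notin> rationals \<Longrightarrow>
    \<exists>t\<ge>T. \<exists>M\<in>mats R. ddet M \<noteq> 0 \<and> (\<forall>i j. norm ((flow t ** unip x ** M) $ i $ j) \<le> C)"
proof -
  obtain C where C: "C \<ge> 1" "\<And>x t. t \<ge> 0 \<Longrightarrow> \<exists>v. v$1 \<in> R \<and> v$2 \<in> R \<and> v \<noteq> 0 \<and>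
    (\<forall>i. norm ((flow t ** unip x *v v) $ i) \<le> C)" using dirichlet_flow by blast
  have "\<exists>t\<ge>T. \<exists>M\<in>mats R. ddet M \<noteq> 0 \<and> (\<forall>i j. norm ((flow t ** unip x ** M) $ i $ j) \<le> exp 1 * C)"
    if x: "x \<notin> rationals" for x T
  proof -
    define T' where "T' = max 0 T"
    have "\<exists>v. v$1 \<in> R \<and> v$2 \<in> R \<and> v \<noteq> 0 \<and> (\<forall>i. norm ((flow (T' + real k) ** unip x *v v) $ i) \<le> C)" for k :: nat
      by (rule C(2)) (auto simp: T'_def)
    then obtain v where v: "\<And>k. v k$1 \<in> R" "\<And>k. v k$2 \<in> R" "\<And>k. v k \<noteq> 0"
      and b: "\<And>k i. norm ((flow (T' + real k) ** unip x *v v k) $ i) \<le> C"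
      by metis
    define D where "D k = mat2 (v k$1) (v (Suc k)$1) (v k$2) (v (Suc k)$2)" for k
    have "\<exists>k. ddet (D k) \<noteq> 0"
    proof (rule ccontr)
      assume "\<nexists>k. ddet (D k) \<noteq> 0"
      then have d: "ddet (D k) = 0" for k by blast
      have l: "\<exists>l. v k$1 = v 0$1 * l \<and> v k$2 = v 0$2 * l" for k
      proof (induction k)
        case 0
        show ?case by (rule exI[of _ 1]) simp
      next
        case (Suc k)
        then obtain l where "v k$1 = v 0$1 * l \<and> v k$2 = v 0$2 * l" by blast
        moreover from ddet_eq_0_imp_proportional[OF d[unfolded D_def] v(3)[of k]]
        obtain l' where "v (Suc k)$1 = v k$1 * l'" "v (Suc k)$2 = v k$2 * l'" by blast
        ultimately show ?case by (intro exI[of _ "l * l'"]) (simp add: mult.assoc)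
      qed
      define z where "z = v 0$1 - x * v 0$2"
      have z: "norm z > 0"
        unfolding z_def using irrational_diff_nonzero[OF x, of "v 0"] v[of 0] by simp
      define K where "K = norm (v 0$1) + norm (v 0$2)"
      have "exp (real k) * norm z \<le> C * K" for k :: nat
      proof -
        obtain l where l: "v k$1 = v 0$1 * l" "v k$2 = v 0$2 * l" using l by blast
        \<comment> \<open>Discreteness enters here: a nonzero entry of \<open>v k\<close> has norm
          at least 1, so \<open>l\<close> is bounded below, whereas the bounded first entry of the
          flowed column forces \<open>l\<close> to decay exponentially in \<open>k\<close>.\<close>
        have "1 \<le> norm (v k$1) + norm (v k$2)"
          using norm_ge_1[OF v(1)[of k]] norm_ge_1[OF v(2)[of k]] v(3)[of k]
            norm_ge_zero[of "v k$1"] norm_ge_zero[of "v k$2"]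
          by (cases "v k$1 = 0"; cases "v k$2 = 0") (auto simp: vec2_eq_iff)
        then have 1: "1 \<le> K * norm l" by (simp add: l K_def norm_mult distrib_right)
        have "v k$1 - x * v k$2 = z * l" by (simp add: l z_def algebra_simps)
        then have "exp (T' + real k) * (norm z * norm l) \<le> C"
          using b[of k 1] by (simp add: flow_unip_nth norm_mult)
        moreover have "exp (real k) * (norm z * norm l) \<le> exp (T' + real k) * (norm z * norm l)"
          by (intro mult_right_mono) (auto simp: T'_def)
        ultimately have 2: "exp (real k) * (norm z * norm l) \<le> C" by linarith
        have K: "K \<ge> 0" by (simp add: K_def)
        have "exp (real k) * norm z \<le> exp (real k) * norm z * (K * norm l)"
          using mult_left_mono[OF 1, of "exp (real k) * norm z"] by simp
        also have "\<dots> = exp (real k) * (norm z * norm l) * K" by simp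
        also have "\<dots> \<le> C * K" using 2 K by (rule mult_right_mono)
        finally show ?thesis .
      qed
      moreover have "exp (real k) \<ge> real k" for k :: nat
        using exp_ge_add_one_self[of "real k"] by linarith
      ultimately have k: "real k * norm z \<le> C * K" for k :: nat
        by (meson mult_right_mono norm_ge_zero order_trans)
      obtain k :: nat where "C * K < real k * norm z" using z reals_Archimedean3 by blast
      with k[of k] show False by simp
    qed
    then obtain k where k: "ddet (D k) \<noteq> 0" by blast
    \<comment> \<open>Two consecutive short columns are to be measured at the same time. Going back
      by one unit of time enlarges the second entry of \<open>v (Suc k)\<close> by the factor
      \<open>exp 1\<close>, which is the loss in the bound.\<close>
    have e: "C \<le> exp 1 * C" using mult_right_mono[of 1 "exp 1" C] C(1) by simp
    have 0: "norm ((flow (T' + real k) ** unip x *v v k) $ i) \<le> exp 1 * C" for i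
      using b[of k i] e by (rule order_trans)
    have 1: "exp (T' + real k) * norm (v (Suc k)$1 - x * v (Suc k)$2) \<le> exp 1 * C"
    proof -
      have "exp (T' + real k) * norm (v (Suc k)$1 - x * v (Suc k)$2) \<le>
        exp (T' + real (Suc k)) * norm (v (Suc k)$1 - x * v (Suc k)$2)"
        by (intro mult_right_mono) auto
      also have "\<dots> \<le> C" using b[of "Suc k" 1] by (simp add: flow_unip_nth norm_mult)
      also note e
      finally show ?thesis .
    qed
    have 2: "exp (- (T' + real k)) * norm (v (Suc k)$2) \<le> exp 1 * C"
    proof -
      have "exp (- (T' + real k)) = exp 1 * exp (- (T' + real (Suc k)))"
        by (simp flip: exp_add)
      then show ?thesis using b[of "Suc k" 2] by (simp add: flow_unip_nth norm_mult mult.assoc)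
    qed
    have [simp]: "(vector [v k$1, v k$2] :: hamilton^2) = v k" for k by (simp add: vec2_eq_iff)
    have "norm ((flow (T' + real k) ** unip x *v v (Suc k)) $ i) \<le> exp 1 * C" for i
      using exhaust_2[of i] 1 2 by (auto simp: flow_unip_nth norm_mult)
    then have "norm ((flow (T' + real k) ** unip x ** D k) $ i $ j) \<le> exp 1 * C" for i j
      using exhaust_2[of i] exhaust_2[of j] 0 by (auto simp: D_def mat_mult_mat2_cols)
    moreover have "D k \<in> mats R" using v by (simp add: D_def mats_iff)
    moreover have "T' + real k \<ge> T" by (simp add: T'_def)
    ultimately show ?thesis using k by blast
  qed
  moreover have "exp 1 * C \<ge> 1" using C(1) mult_mono[of 1 "exp 1" 1 C] by simp
  ultimately show ?thesis using that by blast
qed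

section \<open>Finitely many cosets and uniform recurrence\<close>

lemma finite_residues:
  fixes L :: int
  assumes "L \<noteq> 0"
  obtains F where "finite F" "\<forall>x\<in>R. \<exists>r\<in>F. \<exists>y\<in>R. x = r + of_int L * y"
proof -
  obtain C where C: "\<And>y. \<exists>p\<in>R. norm (y - p) \<le> C" by (rule R_cobounded) blast
  let ?F = "{x \<in> R. norm x \<le> \<bar>of_int L\<bar> * C}"
  have "\<exists>r\<in>?F. \<exists>y\<in>R. x = r + of_int L * y" if x: "x \<in> R" for x
  proof -
    obtain p where p: "p \<in> R" "norm (inverse (of_int L) * x - p) \<le> C" using C by blast
    have "of_int L * (inverse (of_int L) * x - p) = x - of_int L * p"
      using assms by (simp add: right_diff_distrib flip: mult.assoc)
    then have "norm (x - of_int L * p) = \<bar>of_int L\<bar> * norm (inverse (of_int L) * x - p)"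
      by (metis norm_mult norm_of_int)
    then have "norm (x - of_int L * p) \<le> \<bar>of_int L\<bar> * C" using p(2) by (simp add: mult_left_mono)
    moreover have "x - of_int L * p \<in> R" using x p by (intro diff_R mult_R of_int_R)
    ultimately show ?thesis using p(1) by (intro bexI[of _ "x - of_int L * p"] bexI[of _ p]) auto
  qed
  then show ?thesis using that[OF finite_R_ball] by blast
qed

lemma positive_int_in_J: obtains m :: nat where "m > 0" "of_nat m \<in> J"
proof -
  obtain j where j: "j \<in> J" "j \<noteq> 0" using J_nonzero zero_J by blast
  have "norm j ^ 2 \<in> \<int>" by (intro norm_sq_R J_R j)
  then have "norm j ^ 2 \<in> \<nat>" by (simp add: Nats_altdef2)
  then obtain m where m: "norm j ^ 2 = of_nat m" by (auto elim!: Nats_cases)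
  have "hcnj j * j \<in> J" using j by (intro mult_J_left hcnj_R J_R)
  then have "of_nat m \<in> J" unfolding hcnj_mult_self m by simp
  moreover have "m > 0" using m j by (metis gr0I of_nat_0 power2_eq_square mult_eq_0_iff norm_eq_zero)
  ultimately show ?thesis using that by blast
qed

text \<open>Two integral matrices with the same determinant \<open>n\<close> and the same residues modulo a multiple
  of \<open>n m\<close>, where \<open>m \<in> J\<close>, differ by an element of the congruence group. Hence only
  finitely many cosets occur, and no reduction theory is needed.\<close>

lemma finite_cosets:
  fixes n0 :: nat
  obtains S where "finite S" "\<And>M. M \<in> mats R \<Longrightarrow> ddet M \<noteq> 0 \<Longrightarrow> ddet M \<le> real n0 \<Longrightarrow>
    \<exists>N\<in>S. M ** N \<in> cong_group"
proof -
  obtain m :: nat where m: "m > 0" "of_nat m \<in> J" by (rule positive_int_in_J)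
  \<comment> \<open>The factorial makes \<open>L\<close> divisible by \<open>m * k\<close> for every
    determinant \<open>k\<close> up to \<open>n0\<close> at once.\<close>
  define L :: int where "L = int (m * fact n0)"
  have "L \<noteq> 0" using m by (simp add: L_def)
  obtain F where F: "finite F" "\<forall>x\<in>R. \<exists>r\<in>F. \<exists>y\<in>R. x = r + of_int L * y"
    by (rule finite_residues[OF \<open>L \<noteq> 0\<close>])
  define res where "res x = (SOME r. r \<in> F \<and> (\<exists>y\<in>R. x = r + of_int L * y))" for x
  have res: "res x \<in> F \<and> (\<exists>y\<in>R. x = res x + of_int L * y)" if "x \<in> R" for x
  proof -
    have "\<exists>r. r \<in> F \<and> (\<exists>y\<in>R. x = r + of_int L * y)" using F(2) that by blast
    then show ?thesis unfolding res_def by (rule someI_ex)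
  qed
  have res_eq: "\<exists>y\<in>R. x - x' = of_int L * y" if x: "x \<in> R" "x' \<in> R" "res x = res x'" for x x'
  proof -
    from res[OF x(1)] res[OF x(2)] x(3) obtain y y' where
      y: "y \<in> R" "y' \<in> R" and e: "x = res x' + of_int L * y" "x' = res x' + of_int L * y'" by metis
    have "x - x' = of_int L * (y - y')" by (subst e(1), subst e(2)) (simp add: algebra_simps)
    then show ?thesis using y diff_R by blast
  qed
  define MM where "MM = {M \<in> mats R. ddet M \<noteq> 0 \<and> ddet M \<le> real n0}"
  define key where "key M = (ddet M, res (M$1$1), res (M$1$2), res (M$2$1), res (M$2$2))" for M
  have nat_ddet: "\<exists>k\<in>{1..n0}. ddet M = real k" if "M \<in> MM" for M
  proof -
    have "ddet M \<in> \<nat>" using that ddet_Ints[of M] ddet_nonneg[of M] by (simp add: MM_def Nats_altdef2)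
    then obtain k where "ddet M = real k" by (auto elim!: Nats_cases)
    then show ?thesis using that by (auto simp: MM_def)
  qed
  have "key ` MM \<subseteq> (real ` {1..n0}) \<times> F \<times> F \<times> F \<times> F"
  proof safe
    fix a b c d e M assume M: "M \<in> MM" and k: "(a, b, c, d, e) = key M"
    have "M \<in> mats R" using M by (simp add: MM_def)
    then show "b \<in> F" "c \<in> F" "d \<in> F" "e \<in> F" using k res by (auto simp: key_def mats_iff)
    show "a \<in> real ` {1..n0}" using nat_ddet[OF M] k by (auto simp: key_def)
  qed
  then have "finite (key ` MM)" by (rule finite_subset) (use F(1) in simp)
  \<comment> \<open>\<open>S\<close> holds one matrix for each determinant and residue class that
    occurs.\<close>
  then obtain S where S: "S \<subseteq> MM" "finite S" "key ` MM = key ` S"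
    by (metis finite_subset_image subset_refl)
  define inv where "inv M = mat2 (of_real (1 / ddet M)) 0 0 (of_real (1 / ddet M)) ** adj2 M" for M
  have "\<exists>N\<in>inv ` S. M ** N \<in> cong_group" if M: "M \<in> MM" for M
  proof -
    obtain M0 where M0: "M0 \<in> S" "key M = key M0" using M S by blast
    then have M0': "M0 \<in> MM" using S by blast
    have R: "M \<in> mats R" "M0 \<in> mats R" using M M0' by (auto simp: MM_def)
    have d: "ddet M0 = ddet M" using M0 by (simp add: key_def)
    obtain k where k: "k \<in> {1..n0}" "ddet M = real k" using nat_ddet[OF M] by blast
    have inv: "M0 ** inv M0 = mat 1"
    proof -
      have one: "of_real (1 / ddet M) * of_real (ddet M) = (1::hamilton)"
        unfolding of_real_mult[symmetric] using k by simp
      have "M0 ** inv M0 = mat2 (of_real (1 / ddet M0)) 0 0 (of_real (1 / ddet M0)) ** (M0 ** adj2 M0)"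
        unfolding inv_def by (simp add: mat2_eq_iff mat_mult_nth distrib_left of_real_left_commute
            flip: of_real_commute del: of_real_divide)
      also have "\<dots> = mat 1"
        unfolding adj2_mult_right d using one by (simp add: mat2_eq_iff mat_mult_nth)
      finally show ?thesis .
    qed
    have "\<exists>y\<in>R. M$i$j - M0$i$j = of_int L * y" for i j
      using M0(2) R exhaust_2[of i] exhaust_2[of j] by (auto simp: key_def mats_def intro!: res_eq)
    then obtain Y where Y: "\<And>i j. Y i j \<in> R" "\<And>i j. M$i$j - M0$i$j = of_int L * Y i j" by metis
    have "k dvd fact n0" using k by (intro dvd_fact) auto
    then obtain q where q: "fact n0 = k * q" by blast
    \<comment> \<open>The difference from the identity is (M - M0) times the inverse of M0, that is,
      L times an integral matrix divided by k. As k divides \<open>fact n0\<close>, the factor m of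
      L survives, and m lies in the ideal.\<close>
    have J: "(M ** inv M0)$i$j - (mat 1 :: hamilton^2^2)$i$j \<in> J" for i j
    proof -
      have L: "of_int L * y * (of_real (1 / ddet M0) * z) = of_nat m * (of_nat q * (y * z))" for y z :: hamilton
      proof -
        have "of_int L * y * (of_real (1 / ddet M0) * z) = (of_int L * of_real (1 / ddet M0)) * (y * z)"
          by (simp only: mult.assoc of_real_left_commute)
        also have "of_int L * of_real (1 / ddet M0) = (of_real (of_int L * (1 / ddet M0)) :: hamilton)"
          by (simp only: of_real_mult of_real_of_int_eq)
        also have "of_int L * (1 / ddet M0) = real (m * q)"
          using k by (simp add: L_def d q)
        finally show ?thesis by (simp add: mult.assoc)
      qed
      have "(M ** inv M0)$i$j - (mat 1 :: hamilton^2^2)$i$j = (M ** inv M0)$i$j - (M0 ** inv M0)$i$j"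
        by (simp add: inv)
      also have "\<dots> = (M$i$1 - M0$i$1) * inv M0$1$j + (M$i$2 - M0$i$2) * inv M0$2$j"
        by (simp add: mat_mult_nth algebra_simps)
      also have "inv M0$1$j = of_real (1 / ddet M0) * adj2 M0$1$j"
        by (simp add: inv_def mat_mult_nth)
      also have "inv M0$2$j = of_real (1 / ddet M0) * adj2 M0$2$j"
        by (simp add: inv_def mat_mult_nth)
      finally have "(M ** inv M0)$i$j - (mat 1 :: hamilton^2^2)$i$j =
        of_nat m * (of_nat q * (Y i 1 * adj2 M0$1$j)) + of_nat m * (of_nat q * (Y i 2 * adj2 M0$2$j))"
        unfolding Y(2) L .
      moreover have "adj2 M0$i$j \<in> R" for i j using adj2_R[OF R(2)] by (simp add: mats_def)
      ultimately show ?thesis using m Y(1)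
        by (simp only:) (intro add_J mult_J_right[of "of_nat m"] mult_R of_nat_R)
    qed
    have "ddet (M ** inv M0) = 1"
      using arg_cong[OF inv, of ddet] by (simp add: ddet_mult d)
    then have "M ** inv M0 \<in> cong_group"
      using J[of 1 1] J[of 1 2] J[of 2 1] J[of 2 2] by (intro cong_groupI) simp_all
    then show ?thesis using M0(1) by blast
  qed
  moreover have "finite (inv ` S)" using S by simp
  ultimately show ?thesis using that[of "inv ` S"] by (auto simp: MM_def)
qed

text \<open>The flow and the unipotent matrix preserve \<open>ddet\<close>, so bounded columns bound
  \<open>ddet M\<close>. One of finitely many correcting matrices then takes \<open>M\<close> into
  the congruence group and costs only a constant factor. All constants are chosen before
  \<open>x\<close>.\<close>

theorem recurrence:
  obtains C where "C \<ge> 1" "\<And>x T. x \<notin> rationals \<Longrightarrow>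
    \<exists>t\<ge>T. \<exists>g\<in>cong_group. \<forall>i j. norm ((flow t ** unip x ** g) $ i $ j) \<le> C"
proof -
  obtain C where C: "C \<ge> 1" "\<And>x T. x \<notin> rationals \<Longrightarrow>
    \<exists>t\<ge>T. \<exists>M\<in>mats R. ddet M \<noteq> 0 \<and> (\<forall>i j. norm ((flow t ** unip x ** M) $ i $ j) \<le> C)"
    using independent_bounded_columns by blast
  obtain S where S: "finite S" "\<And>M. M \<in> mats R \<Longrightarrow> ddet M \<noteq> 0 \<Longrightarrow> ddet M \<le> real (nat \<lceil>4 * C ^ 4\<rceil>) \<Longrightarrow>
    \<exists>N\<in>S. M ** N \<in> cong_group" using finite_cosets by blast
  have "finite (\<Union>N\<in>S. range (\<lambda>(i, j). norm (N $ i $ j)))" using S(1) by simp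
  then have "bdd_above (\<Union>N\<in>S. range (\<lambda>(i, j). norm (N $ i $ j)))" by (rule bdd_above_finite)
  then obtain K where K: "\<And>N i j. N \<in> S \<Longrightarrow> norm (N $ i $ j) \<le> K" by (force simp: bdd_above_def)
  define K' where "K' = max 1 K"
  have "\<exists>t\<ge>T. \<exists>g\<in>cong_group. \<forall>i j. norm ((flow t ** unip x ** g) $ i $ j) \<le> C * K' + C * K'"
    if x: "x \<notin> rationals" for x T
  proof -
    from C(2)[OF x, of T] obtain t M where t: "t \<ge> T" and M: "M \<in> mats R" "ddet M \<noteq> 0"
      and b: "\<And>i j. norm ((flow t ** unip x ** M) $ i $ j) \<le> C" by blast
    have "ddet M = ddet (flow t ** unip x ** M)" by (simp add: ddet_mult)
    also have "\<dots> \<le> 4 * C ^ 4" by (rule ddet_le) (rule b)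
    finally have "ddet M \<le> real (nat \<lceil>4 * C ^ 4\<rceil>)" by linarith
    with S(2) M obtain N where N: "N \<in> S" "M ** N \<in> cong_group" by blast
    have "norm ((flow t ** unip x ** (M ** N)) $ i $ j) \<le> C * K' + C * K'" for i j
    proof -
      have p: "norm ((flow t ** unip x ** M) $ i $ k * N $ k $ j) \<le> C * K'" for k
        unfolding norm_mult using b[of i k] K[OF N(1), of k j] C(1) by (intro mult_mono) (auto simp: K'_def)
      have "(flow t ** unip x ** (M ** N)) $ i $ j = (flow t ** unip x ** M ** N) $ i $ j"
        by (simp add: matrix_mul_assoc)
      also have "norm \<dots> \<le> C * K' + C * K'"
        unfolding mat_mult_nth[of "flow t ** unip x ** M"] using p[of 1] p[of 2] by (rule norm_triangle_mono)
      finally show ?thesis .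
    qed
    with t N(2) show ?thesis by blast
  qed
  moreover have "1 \<le> C * K'" using C(1) mult_mono[of 1 C 1 K'] by (simp add: K'_def)
  then have "1 \<le> C * K' + C * K'" by linarith
  ultimately show ?thesis using that by blast
qed

end

section \<open>Shadowing\<close>

definition near_1 :: "real \<Rightarrow> hamilton^2^2 \<Rightarrow> bool" where
  "near_1 e A \<longleftrightarrow> norm (A$1$1 - 1) \<le> e \<and> norm (A$1$2) \<le> e \<and> norm (A$2$1) \<le> e \<and> norm (A$2$2 - 1) \<le> e"

text \<open>A row whose first entry dominates is multiplied by a matrix near the identity: the
  dominant entry moves by a small relative amount, and the other one gains at most a small multiple
  of it.\<close>

lemma near_1_row:
  assumes "near_1 e A" "norm b \<le> norm a"
  shows "norm (a * A$1$1 + b * A$2$1 - a) \<le> 2 * e * norm a"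
    and "norm (a * A$1$2 + b * A$2$2) \<le> e * norm a + (1 + e) * norm b"
proof -
  note A = assms(1)[unfolded near_1_def]
  have e: "e \<ge> 0" using A norm_ge_zero order_trans by blast
  have "a * A$1$1 + b * A$2$1 - a = a * (A$1$1 - 1) + b * A$2$1" by (simp add: algebra_simps)
  also have "norm \<dots> \<le> norm a * e + norm a * e"
    by (rule norm_triangle_mono; unfold norm_mult; rule mult_mono) (use A assms(2) e in auto)
  finally show "norm (a * A$1$1 + b * A$2$1 - a) \<le> 2 * e * norm a" by (simp add: algebra_simps)
  have "a * A$1$2 + b * A$2$2 = a * A$1$2 + b + b * (A$2$2 - 1)" by (simp add: algebra_simps)
  also have "norm \<dots> \<le> norm a * e + norm b + norm b * e"
    by (intro norm_triangle_mono order_refl; unfold norm_mult; rule mult_mono) (use A e in auto)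
  finally show "norm (a * A$1$2 + b * A$2$2) \<le> e * norm a + (1 + e) * norm b"
    by (simp add: algebra_simps)
qed

lemma near_1_row':
  assumes "near_1 e A" "norm b \<le> norm a"
  shows "norm (a * A$2$1 + b * A$1$1) \<le> e * norm a + (1 + e) * norm b"
    and "norm (a * A$2$2 + b * A$1$2 - a) \<le> 2 * e * norm a"
proof -
  \<comment> \<open>Exchanging both indices interchanges the roles of the two entries of the
    row.\<close>
  define A' where "A' = mat2 (A$2$2) (A$2$1) (A$1$2) (A$1$1)"
  have "near_1 e A'" using assms(1) by (auto simp: near_1_def A'_def)
  from near_1_row[OF this assms(2)]
  show "norm (a * A$2$1 + b * A$1$1) \<le> e * norm a + (1 + e) * norm b"
    "norm (a * A$2$2 + b * A$1$2 - a) \<le> 2 * e * norm a" by (simp_all add: A'_def)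
qed

lemma norm_between:
  fixes a a' :: "'a::real_normed_vector"
  assumes "norm (a' - a) \<le> d"
  shows "norm a' \<le> norm a + d" "norm a - d \<le> norm a'"
  using assms norm_triangle_ineq2[of a' a] norm_triangle_ineq2[of a a'] norm_minus_commute[of a a']
  by linarith+

text \<open>The induction keeps \<open>u n\<close> between \<open>1/2 + (1/2) ^ (n + 1)\<close> and
  \<open>2 - (1/2) ^ n\<close>; these margins absorb all later jumps. The maximum covers both uses,
  in which the jump is measured relative to the next value (backward recursion) or to the present
  one (forward recursion).\<close>

lemma slow_drift:
  fixes u :: "nat \<Rightarrow> real"
  assumes "u 0 = 1" "\<And>n. u (Suc n) \<le> u n + (1/2) ^ (n + 4) * max (u n) (u (Suc n))"
    "\<And>n. u n - (1/2) ^ (n + 4) * max (u n) (u (Suc n)) \<le> u (Suc n)" "\<And>n. u n \<ge> 0"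
  shows "1/2 \<le> u n" "u n \<le> 2"
proof -
  have "u n \<le> 2 - (1/2) ^ n \<and> 1/2 + (1/2) ^ (n + 1) \<le> u n" for n
  proof (induction n)
    case 0
    show ?case using assms(1) by simp
  next
    case (Suc n)
    define e :: real where "e = (1/2) ^ n"
    have e: "0 < e" "e \<le> 1" by (auto simp: e_def power_le_one)
    have p: "(1/2) ^ (n + 4) = e / 16" "(1/2) ^ Suc n = e / 2" "(1/2) ^ (n + 1) = e / 2"
      "(1/2) ^ (Suc n + 1) = e / 4" by (simp_all add: e_def power_add power_divide)
    define v where "v = u (Suc n)"
    have 1: "v \<le> u n + e / 16 * max (u n) v" "u n - e / 16 * max (u n) v \<le> v"
      using assms(2,3)[of n] unfolding p v_def by simp_all
    have IH: "u n \<le> 2 - e" "1/2 + e / 2 \<le> u n" using Suc unfolding p by (auto simp: e_def)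
    have v0: "v \<ge> 0" using assms(4) by (simp add: v_def)
    have v2: "v \<le> 2 - e / 2"
    proof (rule ccontr)
      assume a: "\<not> v \<le> 2 - e / 2"
      then have "max (u n) v = v" using IH e by linarith
      then have b: "v * (1 - e / 16) \<le> 2 - e" using 1(1) IH(1) by (simp add: algebra_simps)
      have "(2 - e / 2) * (1 - e / 16) \<le> v * (1 - e / 16)" using a e by (intro mult_right_mono) auto
      also note b
      finally have "(2 - e / 2) * (1 - e / 16) \<le> 2 - e" .
      moreover have "(2 - e / 2) * (1 - e / 16) = 2 - e / 2 - e / 8 + e * e / 32" by (simp add: algebra_simps)
      moreover have "e * e / 32 > 0" using e by simp
      ultimately show False using e by linarith
    qed
    have "e * max (u n) v \<le> e * 2" using v2 IH e by (intro mult_left_mono) auto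
    then have "1/2 + e / 4 \<le> v" using 1(2) IH e by linarith
    with v2 show ?case unfolding p v_def by simp
  qed
  from this[of n] show "1/2 \<le> u n" "u n \<le> 2"
    by (smt (verit) zero_le_power half_gt_zero_iff)+
qed

lemma exp_neg_le: "0 \<le> x \<Longrightarrow> exp (- x) \<le> 1 / (1 + x)" for x :: real
  using exp_ge_add_one_self[of x] by (simp add: exp_minus field_simps)

text \<open>\<open>E n\<close> is the jump from the end of piece \<open>n\<close> to the start of
  the next piece, and \<open>F n\<close> its inverse; the forward recursion uses \<open>E\<close>,
  the backward one \<open>F\<close>. The jumps are summable, and the lengths \<open>tau n\<close>
  tend to infinity.\<close>

locale pseudo_orbit =
  fixes tau :: "nat \<Rightarrow> real" and E F :: "nat \<Rightarrow> hamilton^2^2"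
  assumes tau: "\<And>n. tau n \<ge> real n + 8"
    and EF: "\<And>n. E n ** F n = mat 1" and FE: "\<And>n. F n ** E n = mat 1"
    and E: "\<And>n. near_1 ((1/2) ^ (n + 5)) (E n)" and F: "\<And>n. near_1 ((1/2) ^ (n + 5)) (F n)"
begin

text \<open>Conjugation by \<open>flow (tau n)\<close> multiplies the lower left entry by this
  factor and the upper right entry by its inverse.\<close>

definition contr :: "nat \<Rightarrow> real" where "contr n = exp (- (2 * tau n))"

lemma contr: "0 < contr n" "contr n \<le> 1 / (real n + 16)" "contr n \<le> 1 / 16"
proof -
  show "0 < contr n" by (simp add: contr_def)
  have "contr n \<le> 1 / (1 + 2 * tau n)" unfolding contr_def using tau[of n] by (intro exp_neg_le) simp
  also have "\<dots> \<le> 1 / (real n + 16)" using tau[of n] by (intro divide_left_mono) auto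
  finally show "contr n \<le> 1 / (real n + 16)" .
  also have "\<dots> \<le> 1 / 16" by (intro divide_left_mono) auto
  finally show "contr n \<le> 1 / 16" .
qed

lemma err: "(0::real) < (1/2) ^ (n + 5)" "(1/2) ^ (n + 5) \<le> (1 / 32 :: real)"
  "2 * (1/2) ^ (n + 5) = (1/2::real) ^ (n + 4)"
proof -
  have "(1/2::real) ^ n \<le> 1" by (rule power_le_one) auto
  then show "(1/2) ^ (n + 5) \<le> (1 / 32 :: real)" by (simp add: power_add power_divide)
qed (simp_all add: power_add power_divide)

text \<open>Multiplying the row (1, k) on the right by \<open>transfer n\<close> gives the state at
  time \<open>n\<close> of the upper row that starts as (1, k).\<close>

primrec transfer :: "nat \<Rightarrow> hamilton^2^2" where
  "transfer 0 = mat 1"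
| "transfer (Suc n) = transfer n ** mat2 1 0 0 (of_real (inverse (contr n))) ** E n"

primrec transfer_inv :: "nat \<Rightarrow> hamilton^2^2" where
  "transfer_inv 0 = mat 1"
| "transfer_inv (Suc n) = F n ** mat2 1 0 0 (of_real (contr n)) ** transfer_inv n"

lemma transfer_inv: "transfer_inv n ** transfer n = mat 1"
proof (induction n)
  case (Suc n)
  let ?d = "mat2 1 0 0 (of_real (contr n))" and ?d' = "mat2 1 0 0 (of_real (inverse (contr n)))"
  have d: "?d ** ?d' = mat 1"
    using contr(1)[of n] by (simp add: mat2_eq_iff mat_mult_nth flip: of_real_mult del: of_real_inverse)
  have "transfer_inv (Suc n) ** transfer (Suc n) =
    F n ** (?d ** ((transfer_inv n ** transfer n) ** ?d')) ** E n"
    by (simp add: matrix_mul_assoc)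
  also have "\<dots> = mat 1" unfolding Suc by (simp add: d FE del: of_real_inverse)
  finally show ?case .
qed simp

text \<open>Backwards in time the cone of rows with dominant first entry is mapped into itself:
  \<open>F n\<close> nearly preserves the row, and then \<open>contr n\<close> shrinks its second
  entry.\<close>

lemma cone_back:
  assumes "norm b' \<le> norm a'" "a = a' * F n$1$1 + b' * F n$2$1"
    "of_real (inverse (contr n)) * b = a' * F n$1$2 + b' * F n$2$2"
  shows "norm b \<le> norm a" "a' \<noteq> 0 \<Longrightarrow> a \<noteq> 0"
proof -
  define e :: real where "e = (1/2) ^ (n + 5)"
  have e: "0 < e" "e \<le> 1/32" using err[of n] by (auto simp: e_def)
  note r = near_1_row[OF F[of n, folded e_def] assms(1), folded assms(2,3)]
  have "norm a \<ge> norm a' - 2 * e * norm a'" by (rule norm_between(2)[OF r(1)])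
  moreover have "2 * e * norm a' \<le> 1/16 * norm a'" using e by (intro mult_right_mono) auto
  ultimately have a: "norm a \<ge> 15/16 * norm a'" by simp
  then show "a' \<noteq> 0 \<Longrightarrow> a \<noteq> 0" by auto
  have "inverse (contr n) * norm b \<le> e * norm a' + (1 + e) * norm b'"
    using r(2) contr(1)[of n] by (simp add: norm_mult norm_inverse)
  also have "\<dots> \<le> 1/32 * norm a' + (1 + 1/32) * norm a'"
    using e assms(1) by (intro add_mono mult_mono) auto
  also have "\<dots> \<le> 2 * norm a'" by simp
  finally have "inverse (contr n) * norm b \<le> 2 * norm a'" .
  then have "norm b \<le> contr n * (2 * norm a')" using contr(1)[of n] by (simp add: field_simps)
  also have "\<dots> \<le> 1/16 * (2 * norm a')" using contr[of n] by (intro mult_right_mono) auto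
  finally show "norm b \<le> norm a" using a norm_ge_zero[of a'] by linarith
qed

text \<open>The forward iteration expands \<open>b\<close>, so the initial value is found by pulling back from time \<open>N\<close>
  and letting \<open>N\<close> tend to infinity.\<close>

lemma unstable_row:
  obtains a b :: "nat \<Rightarrow> hamilton" where "a 0 = 1"
    "\<forall>n. a (Suc n) = a n * E n$1$1 + of_real (inverse (contr n)) * b n * E n$2$1"
    "\<forall>n. b (Suc n) = a n * E n$1$2 + of_real (inverse (contr n)) * b n * E n$2$2"
    "\<forall>n. norm (b n) \<le> norm (a n)"
proof -
  define a where "a k n = transfer n$1$1 + k * transfer n$2$1" for k n
  define b where "b k n = transfer n$1$2 + k * transfer n$2$2" for k n
  have rec: "a k (Suc n) = a k n * E n$1$1 + of_real (inverse (contr n)) * b k n * E n$2$1"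
    "b k (Suc n) = a k n * E n$1$2 + of_real (inverse (contr n)) * b k n * E n$2$2" for k n
    unfolding a_def b_def
    by (simp_all add: mat_mult_nth distrib_left distrib_right mult.assoc of_real_left_commute
        flip: of_real_commute del: of_real_inverse)
  have "\<exists>k. norm k \<le> 1 \<and> (\<forall>n\<le>N. norm (b k n) \<le> norm (a k n))" for N
  proof -
    \<comment> \<open>The row (u n, v n) obeys the recursion and equals (1, 0) at time
      \<open>N\<close>. Followed back from there it stays in the cone, and division by
      \<open>u 0\<close> on the left normalizes its start to (1, k).\<close>
    define u where "u n = (transfer_inv N ** transfer n)$1$1" for n
    define v where "v n = (transfer_inv N ** transfer n)$1$2" for n
    have uv: "u n = u (Suc n) * F n$1$1 + v (Suc n) * F n$2$1"
      "of_real (inverse (contr n)) * v n = u (Suc n) * F n$1$2 + v (Suc n) * F n$2$2" for n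
    proof -
      have "(transfer_inv N ** transfer (Suc n)) ** F n =
        transfer_inv N ** transfer n ** mat2 1 0 0 (of_real (inverse (contr n)))"
        by (simp add: EF flip: matrix_mul_assoc)
      from arg_cong[OF this, of "\<lambda>A. A$1$1"] arg_cong[OF this, of "\<lambda>A. A$1$2"]
      show "u n = u (Suc n) * F n$1$1 + v (Suc n) * F n$2$1"
      "of_real (inverse (contr n)) * v n = u (Suc n) * F n$1$2 + v (Suc n) * F n$2$2"
        unfolding u_def v_def mat_mult_nth[of _ "F n"]
        by (simp_all add: mat_mult_nth[of _ "mat2 1 0 0 z" for z] of_real_commute del: of_real_inverse transfer.simps)
    qed
    have "norm (v n) \<le> norm (u n) \<and> u n \<noteq> 0" if "n \<le> N" for n
      using that
    proof (induction rule: inc_induct)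
      case base
      show ?case by (simp add: u_def v_def transfer_inv)
    next
      case (step n)
      then show ?case using cone_back[OF _ uv] by blast
    qed
    note cone = this
    define k where "k = inverse (u 0) * v 0"
    have u0: "u 0 \<noteq> 0" using cone by blast
    have "u 0 * (x + inverse (u 0) * v 0 * y) = u 0 * x + v 0 * y" for x y
      using u0 by (simp add: distrib_left flip: mult.assoc)
    then have uv': "u n = u 0 * a k n" "v n = u 0 * b k n" for n
      unfolding a_def b_def k_def by (simp_all add: u_def v_def mat_mult_nth)
    have "norm (b k n) \<le> norm (a k n)" if "n \<le> N" for n
      using cone[OF that] u0 unfolding uv'[of n] norm_mult by simp
    moreover have "norm k \<le> 1"
      unfolding k_def norm_mult norm_inverse using cone[of 0] u0 by (simp add: field_simps)
    ultimately show ?thesis by blast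
  qed
  then obtain k where k: "\<And>N. norm (k N) \<le> 1" "\<And>N n. n \<le> N \<Longrightarrow> norm (b (k N) n) \<le> norm (a (k N) n)"
    by metis
  \<comment> \<open>The initial value \<open>k N\<close> works only up to time \<open>N\<close>. For
    fixed \<open>n\<close> the cone condition is closed in the initial value and holds for all late
    \<open>N\<close>, so a limit point works for all times.\<close>
  have "bounded (range k)" using k(1) by (auto simp: bounded_iff)
  from bounded_imp_convergent_subsequence[OF this] obtain l r where
    r: "strict_mono r" "(k \<circ> r) \<longlonglongrightarrow> l" by blast
  have cone: "norm (b l n) \<le> norm (a l n)" for n
  proof (rule LIMSEQ_le)
    show "(\<lambda>N. norm (b (k (r N)) n)) \<longlonglongrightarrow> norm (b l n)" "(\<lambda>N. norm (a (k (r N)) n)) \<longlonglongrightarrow> norm (a l n)"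
      unfolding a_def b_def using r(2)[unfolded o_def] by (auto intro!: tendsto_intros)
    show "\<exists>N. \<forall>m\<ge>N. norm (b (k (r m)) n) \<le> norm (a (k (r m)) n)"
      using k(2) seq_suble[OF r(1)] order_trans by blast
  qed
  show ?thesis by (rule that[of "a l" "b l"]) (use rec cone in \<open>auto simp: a_def\<close>)
qed

lemma contr_tendsto: "contr \<longlonglongrightarrow> 0"
proof (rule tendsto_sandwich[of "\<lambda>_. 0" _ _ "\<lambda>n. 1 / (real n + 16)"])
  show "(\<lambda>n. 1 / (real n + 16)) \<longlonglongrightarrow> 0" by real_asymp
qed (auto intro!: always_eventually less_imp_le contr(1) contr(2))

text \<open>The sequences are the entries of correction matrices with rows (a n, b n) and (c n, d
  n); one step is conjugation by \<open>flow (tau n)\<close> followed by right multiplication with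
  \<open>E n\<close>. Within a piece the upper right entry is largest at the end, so the expanded
  \<open>b n\<close>, and not just \<open>b n\<close> itself, has to tend to 0.\<close>

theorem shadowing:
  obtains a b c d :: "nat \<Rightarrow> hamilton" where "a 0 = 1" "c 0 = 0" "d 0 = 1"
    "\<forall>n. a (Suc n) = a n * E n$1$1 + of_real (inverse (contr n)) * b n * E n$2$1"
    "\<forall>n. b (Suc n) = a n * E n$1$2 + of_real (inverse (contr n)) * b n * E n$2$2"
    "\<forall>n. c (Suc n) = of_real (contr n) * c n * E n$1$1 + d n * E n$2$1"
    "\<forall>n. d (Suc n) = of_real (contr n) * c n * E n$1$2 + d n * E n$2$2"
    "\<forall>n. 1/2 \<le> norm (a n)" "\<forall>n. norm (a n) \<le> 2" "\<forall>n. 1/2 \<le> norm (d n)" "\<forall>n. norm (d n) \<le> 2"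
    "(\<lambda>n. inverse (contr n) * norm (b n)) \<longlonglongrightarrow> 0" "(\<lambda>n. norm (c n)) \<longlonglongrightarrow> 0"
proof -
  obtain a b :: "nat \<Rightarrow> hamilton" where ab: "a 0 = 1"
     "\<forall>n. a (Suc n) = a n * E n$1$1 + of_real (inverse (contr n)) * b n * E n$2$1"
     "\<forall>n. b (Suc n) = a n * E n$1$2 + of_real (inverse (contr n)) * b n * E n$2$2"
     "\<forall>n. norm (b n) \<le> norm (a n)" by (rule unstable_row)
  note a0 = ab(1) and a = ab(2)[rule_format] and b = ab(3)[rule_format] and cone = ab(4)[rule_format]
  have backward: "a n = a (Suc n) * F n$1$1 + b (Suc n) * F n$2$1"
    "of_real (inverse (contr n)) * b n = a (Suc n) * F n$1$2 + b (Suc n) * F n$2$2" for n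
  proof -
    let ?m = "mat2 (a n) (of_real (inverse (contr n)) * b n) 0 0"
    have "?m = ?m ** (E n ** F n)" by (simp add: EF)
    also have "\<dots> = mat2 (a (Suc n)) (b (Suc n)) 0 0 ** F n"
      unfolding matrix_mul_assoc by (rule arg_cong[of _ _ "\<lambda>A. A ** F n"])
        (simp add: mat2_eq_iff mat_mult_nth a b)
    finally have eq: "?m = mat2 (a (Suc n)) (b (Suc n)) 0 0 ** F n" .
    show "a n = a (Suc n) * F n$1$1 + b (Suc n) * F n$2$1"
      "of_real (inverse (contr n)) * b n = a (Suc n) * F n$1$2 + b (Suc n) * F n$2$2"
      using arg_cong[OF eq, of "\<lambda>A. A$1$1"] arg_cong[OF eq, of "\<lambda>A. A$1$2"]
      by (simp_all only: mat_mult_nth mat2_nth)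
  qed
  have d1: "norm (a n - a (Suc n)) \<le> (1/2) ^ (n + 4) * norm (a (Suc n))" for n
    using near_1_row(1)[OF F[of n] cone[of "Suc n"]] unfolding backward(1)[of n, symmetric] err(3) .
  have m: "(1/2) ^ (n + 4) * x \<le> (1/2) ^ (n + 4) * max y x"
    "(1/2) ^ (n + 4) * x \<le> (1/2) ^ (n + 4) * max x y" for x y :: real and n by simp_all
  have a_bd: "1/2 \<le> norm (a n)" "norm (a n) \<le> 2" for n
  proof -
    have "norm (a (Suc n)) \<le> norm (a n) + (1/2) ^ (n + 4) * max (norm (a n)) (norm (a (Suc n)))"
      "norm (a n) - (1/2) ^ (n + 4) * max (norm (a n)) (norm (a (Suc n))) \<le> norm (a (Suc n))" for n
      using norm_between[OF d1[of n]] m(1)[of n "norm (a (Suc n))" "norm (a n)"] by linarith+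
    from slow_drift[of "\<lambda>n. norm (a n)", OF _ this] a0
    show "1/2 \<le> norm (a n)" "norm (a n) \<le> 2" by simp_all
  qed
  have b': "inverse (contr n) * norm (b n) \<le> (1/2) ^ (n + 4) + 2 * norm (b (Suc n))" for n
  proof -
    have "inverse (contr n) * norm (b n) = norm (of_real (inverse (contr n)) * b n)"
      using contr(1)[of n] by (simp add: norm_mult norm_inverse)
    also have "\<dots> \<le> (1/2) ^ (n + 5) * norm (a (Suc n)) + (1 + (1/2) ^ (n + 5)) * norm (b (Suc n))"
      unfolding backward(2)[of n] by (rule near_1_row(2)[OF F cone])
    also have "\<dots> \<le> (1/2) ^ (n + 5) * 2 + 2 * norm (b (Suc n))"
      using a_bd[of "Suc n"] err[of n] by (intro add_mono mult_mono) auto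
    finally show ?thesis using err(3)[of n] by simp
  qed
  have b_le: "norm (b n) \<le> 5 * contr n" for n
  proof -
    have "norm (b (Suc n)) \<le> 2" using cone[of "Suc n"] a_bd[of "Suc n"] by linarith
    moreover have "(1/2::real) ^ (n + 4) \<le> 1" by (rule power_le_one) auto
    ultimately have "inverse (contr n) * norm (b n) \<le> 5" using b'[of n] by linarith
    then show ?thesis using contr(1)[of n] by (simp add: field_simps)
  qed
  have half: "(\<lambda>n. (1/2::real) ^ (n + 4)) \<longlonglongrightarrow> 0" by real_asymp
  \<comment> \<open>Bounding \<open>b (Suc n)\<close> by \<open>contr (Suc n)\<close> before taking
    one step back leaves only terms that tend to 0.\<close>
  have b0: "(\<lambda>n. inverse (contr n) * norm (b n)) \<longlonglongrightarrow> 0"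
  proof (rule tendsto_sandwich[of "\<lambda>_. 0" _ _ "\<lambda>n. (1/2) ^ (n + 4) + 2 * (5 * contr (Suc n))"])
    have "(\<lambda>n. (1/2) ^ (n + 4) + 2 * (5 * contr (Suc n))) \<longlonglongrightarrow> 0 + 2 * (5 * 0)"
      by (intro tendsto_intros half contr_tendsto[THEN LIMSEQ_Suc])
    then show "(\<lambda>n. (1/2) ^ (n + 4) + 2 * (5 * contr (Suc n))) \<longlonglongrightarrow> 0" by simp
    have "inverse (contr n) * norm (b n) \<le> (1/2) ^ (n + 4) + 2 * (5 * contr (Suc n))" for n
      using b'[of n] b_le[of "Suc n"] by linarith
    then show "\<forall>\<^sub>F n in sequentially. inverse (contr n) * norm (b n) \<le> (1/2) ^ (n + 4) + 2 * (5 * contr (Suc n))"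
      by simp
    have "0 \<le> inverse (contr n) * norm (b n)" for n using contr(1)[of n] by simp
    then show "\<forall>\<^sub>F n in sequentially. 0 \<le> inverse (contr n) * norm (b n)" by simp
  qed auto
  \<comment> \<open>The lower row is run forwards: its small entry is contracted before every jump,
    so the cone condition persists from the start (0, 1).\<close>
  define cd where "cd = rec_nat (0, 1) (\<lambda>n (c, d).
    (of_real (contr n) * c * E n$1$1 + d * E n$2$1, of_real (contr n) * c * E n$1$2 + d * E n$2$2))"
  define c where "c n = fst (cd n)" for n
  define d where "d n = snd (cd n)" for n
  have c0: "c 0 = 0" "d 0 = 1" by (simp_all add: c_def d_def cd_def)
  have c: "c (Suc n) = of_real (contr n) * c n * E n$1$1 + d n * E n$2$1"
    "d (Suc n) = of_real (contr n) * c n * E n$1$2 + d n * E n$2$2" for n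
    by (simp_all add: c_def d_def cd_def split_beta)
  have cc: "norm (of_real (contr n) * c n) \<le> norm (d n)" if "norm (c n) \<le> norm (d n)" for n
  proof -
    have "contr n * norm (c n) \<le> 1 * norm (d n)" using contr[of n] that by (intro mult_mono) auto
    then show ?thesis using contr(1)[of n] by (simp add: norm_mult)
  qed
  have c_step: "norm (c (Suc n)) \<le> (1/2) ^ (n + 5) * norm (d n) + (1 + (1/2) ^ (n + 5)) * (contr n * norm (c n))"
    "norm (d (Suc n) - d n) \<le> (1/2) ^ (n + 4) * norm (d n)" if "norm (c n) \<le> norm (d n)" for n
    using near_1_row'[OF E cc[OF that]] contr(1)[of n] unfolding c err(3) by (simp_all add: norm_mult add.commute)
  have cone': "norm (c n) \<le> norm (d n)" for n
  proof (induction n)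
    case (Suc n)
    have "norm (c (Suc n)) \<le> 1/32 * norm (d n) + 2 * (1/16 * norm (d n))"
      using Suc err[of n] contr[of n]
      by (intro order_trans[OF c_step(1)[OF Suc]] add_mono mult_mono mult_nonneg_nonneg) auto
    moreover have "norm (d n) - (1/2) ^ (n + 4) * norm (d n) \<le> norm (d (Suc n))"
      by (rule norm_between(2)[OF c_step(2)[OF Suc]])
    moreover have "(1/2::real) ^ (n + 4) * norm (d n) \<le> 1/16 * norm (d n)"
      using err[of n] by (intro mult_right_mono) auto
    ultimately show ?case using norm_ge_zero[of "d n"] by linarith
  qed (simp add: c0)
  have d_bd: "1/2 \<le> norm (d n)" "norm (d n) \<le> 2" for n
  proof -
    have "norm (d (Suc n)) \<le> norm (d n) + (1/2) ^ (n + 4) * max (norm (d n)) (norm (d (Suc n)))"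
      "norm (d n) - (1/2) ^ (n + 4) * max (norm (d n)) (norm (d (Suc n))) \<le> norm (d (Suc n))" for n
      using norm_between[OF c_step(2)[OF cone', of n]] m(2)[of n "norm (d n)" "norm (d (Suc n))"] by linarith+
    from slow_drift[of "\<lambda>n. norm (d n)", OF _ this] c0
    show "1/2 \<le> norm (d n)" "norm (d n) \<le> 2" by simp_all
  qed
  have c1: "norm (c (Suc n)) \<le> (1/2) ^ (n + 4) + 4 * contr n" for n
  proof -
    have "norm (c n) \<le> 2" using cone'[of n] d_bd[of n] by linarith
    then have "norm (c (Suc n)) \<le> (1/2) ^ (n + 5) * 2 + 2 * (contr n * 2)"
      using d_bd[of n] err[of n] contr[of n]
      by (intro order_trans[OF c_step(1)[OF cone']] add_mono mult_mono mult_nonneg_nonneg) auto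
    then show ?thesis using err(3)[of n] by simp
  qed
  have "(\<lambda>n. norm (c (Suc n))) \<longlonglongrightarrow> 0"
  proof (rule tendsto_sandwich[of "\<lambda>_. 0" _ _ "\<lambda>n. (1/2) ^ (n + 4) + 4 * contr n"])
    have "(\<lambda>n. (1/2) ^ (n + 4) + 4 * contr n) \<longlonglongrightarrow> 0 + 4 * 0"
      by (intro tendsto_intros half contr_tendsto)
    then show "(\<lambda>n. (1/2) ^ (n + 4) + 4 * contr n) \<longlonglongrightarrow> 0" by simp
  qed (use c1 in auto)
  then have "(\<lambda>n. norm (c n)) \<longlonglongrightarrow> 0" by (rule LIMSEQ_imp_Suc)
  with a0 c0 a b c a_bd d_bd b0 show ?thesis by (intro that[of a c d b]) auto
qed

end

section \<open>Lagrange values\<close>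

definition norm_prod :: "hamilton^2 \<Rightarrow> real" where
  "norm_prod v = norm (v$1) * norm (v$2)"

lemma norm_prod_nonneg: "norm_prod v \<ge> 0"
  by (simp add: norm_prod_def)

lemma flow_vec_nth [simp]:
  "(flow s *v v) $ 1 = of_real (exp s) * v $ 1" "(flow s *v v) $ 2 = of_real (exp (- s)) * v $ 2"
  by (simp_all add: flow_def mat_vec_mult_nth)

lemma norm_prod_flow [simp]: "norm_prod (flow s *v v) = norm_prod v"
  by (simp add: norm_prod_def norm_mult) (simp add: exp_minus)

lemma flow_add: "flow s ** flow t = flow (s + t)"
  by (simp add: flow_def mat2_eq_iff mat_mult_nth flip: of_real_mult exp_add)

lemma flow_0 [simp]: "flow 0 = mat 1"
  by (simp add: flow_def mat2_eq_iff)

lemma flow_cancel [simp]: "flow s ** flow (- s) = mat 1" "flow (- s) ** flow s = mat 1"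
  by (simp_all add: flow_add)

lemma flow_conj:
  "flow s ** mat2 a b c d ** flow (- s) =
    mat2 a (of_real (exp (2 * s)) * b) (of_real (exp (- (2 * s))) * c) d"
proof -
  have e: "of_real (exp u) * z * of_real (exp v) = of_real (exp (u + v)) * (z::hamilton)" for u v z
    by (metis exp_add mult.assoc of_real_commute of_real_mult)
  show ?thesis by (simp add: flow_def mat2_eq_iff mat_mult_nth e)
qed

text \<open>The solution \<open>s\<close> of
  \<open>exp s * norm (v$1) = exp (- s) * norm (v$2)\<close>. At this time a column with small
  product is seen in a small ball.\<close>

definition balance_time :: "hamilton^2 \<Rightarrow> real" where
  "balance_time v = ln (norm (v$2) / norm (v$1)) / 2"

lemma balance_time:
  assumes "v$1 \<noteq> 0" "v$2 \<noteq> 0"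
  shows "norm ((flow (balance_time v) *v v) $ i) = sqrt (norm_prod v)"
proof -
  let ?s = "balance_time v"
  have p: "norm (v$1) > 0" "norm (v$2) > 0" using assms by auto
  have e: "exp ?s ^ 2 = norm (v$2) / norm (v$1)"
    using p by (simp add: balance_time_def exp_double[symmetric])
  have e': "exp (- ?s) ^ 2 = norm (v$1) / norm (v$2)"
    using e by (simp add: exp_minus power_inverse)
  have "(exp ?s * norm (v$1)) ^ 2 = norm_prod v" "(exp (- ?s) * norm (v$2)) ^ 2 = norm_prod v"
    unfolding power_mult_distrib e e' using p by (simp_all add: norm_prod_def power2_eq_square)
  then have "exp ?s * norm (v$1) = sqrt (norm_prod v)" "exp (- ?s) * norm (v$2) = sqrt (norm_prod v)"
    by (metis real_sqrt_unique mult_nonneg_nonneg exp_ge_zero norm_ge_zero)+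
  then show ?thesis using exhaust_2[of i] by (auto simp: norm_mult)
qed

text \<open>A bounded product and a large second entry force a small first entry, which takes long
  to catch up. This turns a large height into a late time.\<close>

lemma balance_time_ge:
  assumes "v$1 \<noteq> 0" "norm_prod v \<le> K ^ 2" "K > 0" "norm (v$2) \<ge> K * exp s"
  shows "balance_time v \<ge> s"
proof -
  have p: "norm (v$1) > 0" "norm (v$2) > 0"
    using assms(1) less_le_trans[OF mult_pos_pos[OF assms(3) exp_gt_zero] assms(4)] by auto
  have "exp (2 * s) * norm (v$1) * norm (v$2) \<le> exp (2 * s) * K ^ 2"
    using assms(2) by (simp add: norm_prod_def mult.assoc)
  also have "\<dots> = (K * exp s) ^ 2" by (simp add: power_mult_distrib exp_double)
  also have "\<dots> \<le> norm (v$2) ^ 2" using assms(3,4) by (intro power_mono) auto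
  finally have "exp (2 * s) * norm (v$1) \<le> norm (v$2)" using p by (simp add: power2_eq_square)
  then have "exp (2 * s) \<le> norm (v$2) / norm (v$1)" using p by (simp add: field_simps)
  then have "2 * s \<le> ln (norm (v$2) / norm (v$1))" using p by (simp add: ln_ge_iff)
  then show ?thesis by (simp add: balance_time_def)
qed

text \<open>Off the diagonal \<open>Y\<close> contributes at most 1/8 of the other entry, which
  yields the factors 3 and 4; the latter is the 4 in the radius \<open>W\<close> of
  \<open>glue_segments\<close>. In the third claim the diagonal defect, the two mixed terms and the
  product of the two errors give 1 + 2 + 2 + 1/8, rounded up to 6.\<close>

lemma almost_diagonal:
  fixes w :: "hamilton^2"
  assumes "1/2 \<le> norm (Y$1$1)" "norm (Y$1$1) \<le> 2" "1/2 \<le> norm (Y$2$2)" "norm (Y$2$2) \<le> 2"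
    and "norm (Y$1$2) \<le> e" "norm (Y$2$1) \<le> e" "e \<le> 1/8"
  shows "(\<And>i. norm (w $ i) \<le> m) \<Longrightarrow> norm ((Y *v w) $ i) \<le> 3 * m"
    and "(\<And>i. norm ((Y *v w) $ i) \<le> m) \<Longrightarrow> norm (w $ i) \<le> 4 * m"
    and "(\<And>i. norm (w $ i) \<le> m) \<Longrightarrow> \<bar>norm (Y$1$1) * norm (Y$2$2) - 1\<bar> \<le> e \<Longrightarrow>
      \<bar>norm_prod (Y *v w) - norm_prod w\<bar> \<le> 6 * e * m ^ 2"
proof -
  define a d p q z1 z2 where "a = norm (Y$1$1)" and "d = norm (Y$2$2)" and "p = norm (w$1)"
    and "q = norm (w$2)" and "z1 = norm ((Y *v w)$1)" and "z2 = norm ((Y *v w)$2)"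
  note defs = a_def d_def p_def q_def z1_def z2_def
  have e: "e \<ge> 0" using assms(5) norm_ge_zero order_trans by blast
  have nn: "p \<ge> 0" "q \<ge> 0" "z1 \<ge> 0" "z2 \<ge> 0" by (simp_all add: defs)
  have ad: "1/2 \<le> a" "a \<le> 2" "1/2 \<le> d" "d \<le> 2" using assms by (simp_all add: defs)
  have n1: "norm ((Y *v w)$1 - Y$1$1 * w$1) \<le> e * q" "norm ((Y *v w)$2 - Y$2$2 * w$2) \<le> e * p"
    using mult_right_mono[OF assms(5), of q] mult_right_mono[OF assms(6), of p]
    by (simp_all add: mat_vec_mult_nth defs norm_mult)
  have z: "z1 \<le> a * p + e * q" "a * p - e * q \<le> z1" "z2 \<le> d * q + e * p" "d * q - e * p \<le> z2"
    using norm_between[OF n1(1)] norm_between[OF n1(2)] by (simp_all add: defs norm_mult)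
  show "norm ((Y *v w) $ i) \<le> 3 * m" if "\<And>i. norm (w $ i) \<le> m"
  proof -
    have pq: "p \<le> m" "q \<le> m" using that by (simp_all add: defs)
    have "a * p \<le> 2 * m" "e * q \<le> 1/8 * m" "d * q \<le> 2 * m" "e * p \<le> 1/8 * m"
      by (rule mult_mono; use pq ad nn e assms(7) in linarith)+
    then have "z1 \<le> 3 * m" "z2 \<le> 3 * m" using z pq nn by linarith+
    then show ?thesis using exhaust_2[of i] by (auto simp: defs)
  qed
  show "norm (w $ i) \<le> 4 * m" if "\<And>i. norm ((Y *v w) $ i) \<le> m"
  proof -
    have zm: "z1 \<le> m" "z2 \<le> m" using that by (simp_all add: defs)
    have "1/2 * p \<le> a * p" "1/2 * q \<le> d * q" "e * q \<le> 1/8 * q" "e * p \<le> 1/8 * p"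
      by (rule mult_right_mono; use ad nn e assms(7) in linarith)+
    then have "p \<le> 4 * m" "q \<le> 4 * m" using z zm nn by linarith+
    then show ?thesis using exhaust_2[of i] by (auto simp: defs)
  qed
  show "\<bar>norm_prod (Y *v w) - norm_prod w\<bar> \<le> 6 * e * m ^ 2"
    if "\<And>i. norm (w $ i) \<le> m" "\<bar>norm (Y$1$1) * norm (Y$2$2) - 1\<bar> \<le> e"
  proof -
    have pq: "p \<le> m" "q \<le> m" using that by (simp_all add: defs)
    have m: "m \<ge> 0" using pq nn by linarith
    define x y where "x = z1 - a * p" and "y = z2 - d * q"
    have xy: "\<bar>x\<bar> \<le> e * m" "\<bar>y\<bar> \<le> e * m"
    proof -
      have "e * q \<le> e * m" "e * p \<le> e * m" using pq e by (auto intro: mult_left_mono)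
      then show "\<bar>x\<bar> \<le> e * m" "\<bar>y\<bar> \<le> e * m" using z unfolding x_def y_def by linarith+
    qed
    have "z1 * z2 - p * q = (a * d - 1) * (p * q) + x * (d * q) + y * (a * p) + x * y"
      by (simp add: x_def y_def algebra_simps)
    also have "\<bar>\<dots>\<bar> \<le> \<bar>a * d - 1\<bar> * (p * q) + \<bar>x\<bar> * (d * q) + \<bar>y\<bar> * (a * p) + \<bar>x\<bar> * \<bar>y\<bar>"
      using nn ad by (intro order_trans[OF abs_triangle_ineq] add_mono) (auto simp: abs_mult)
    also have "\<dots> \<le> e * (m * m) + (e * m) * (2 * m) + (e * m) * (2 * m) + (e * m) * (1/8 * m)"
    proof (intro add_mono mult_mono)
      show "\<bar>a * d - 1\<bar> \<le> e" using that(2) by (simp add: defs)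
      show "\<bar>y\<bar> \<le> 1/8 * m" using xy(2) mult_right_mono[OF assms(7) m] by linarith
    qed (use pq xy e m nn ad in auto)
    also have "\<dots> \<le> 6 * e * m ^ 2"
      using mult_nonneg_nonneg[OF e mult_nonneg_nonneg[OF m m]] by (simp add: power2_eq_square algebra_simps)
    finally show ?thesis by (simp add: norm_prod_def defs)
  qed
qed

lemma adj2_entry_le:
  assumes "\<And>i j. norm (A $ i $ j) \<le> B" shows "norm (adj2 A $ i $ j) \<le> 2 * B ^ 3"
proof -
  have B: "B \<ge> 0" using assms[of 1 1] norm_ge_zero order_trans by blast
  have t: "norm (of_real (norm (A$i$j) ^ 2) * hcnj (A$k$l) - hcnj (A$a$b) * A$c$d * hcnj (A$e$f)) \<le> 2 * B ^ 3"
    for i j k l a b c d e f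
  proof -
    have 1: "norm (A$i$j) ^ 2 * norm (A$k$l) \<le> B ^ 2 * B"
      by (intro mult_mono power_mono assms) auto
    have "norm (A$a$b) * norm (A$c$d) * norm (A$e$f) \<le> B * B * B"
      by (intro mult_mono assms) (auto simp: B)
    with 1 show ?thesis
      by (intro order_trans[OF norm_triangle_ineq4]) (simp add: norm_mult norm_power power2_eq_square power3_eq_cube)
  qed
  show ?thesis
    using exhaust_2[of i] exhaust_2[of j] by (elim disjE) (simp_all only: adj2_def mat2_nth t)
qed

text \<open>The difference from the identity is (P' - P) times the inverse of P, and the entries of
  that inverse are cubic in those of P.\<close>

lemma near_1_quotient:
  assumes "ddet P = 1" "\<And>i j. norm ((P' - P) $ i $ j) \<le> e" "\<And>i j. norm (P $ i $ j) \<le> B"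
  shows "near_1 (4 * B ^ 3 * e) (P' ** adj2 P)"
proof -
  have B: "norm (P $ i $ j) \<le> B" for i j by (rule assms)
  have e: "e \<ge> 0" using assms(2)[of 1 1] norm_ge_zero order_trans by blast
  have "norm ((P' ** adj2 P) $ i $ j - (mat 1 :: hamilton^2^2) $ i $ j) \<le> 4 * B ^ 3 * e" for i j
  proof -
    have "(P' ** adj2 P) $ i $ j - (mat 1 :: hamilton^2^2) $ i $ j = (P' ** adj2 P) $ i $ j - (P ** adj2 P) $ i $ j"
      by (simp add: ddet_1_inverse[OF assms(1)])
    also have "\<dots> = (P' - P) $ i $ 1 * adj2 P $ 1 $ j + (P' - P) $ i $ 2 * adj2 P $ 2 $ j"
      by (simp add: mat_mult_nth algebra_simps)
    also have "norm \<dots> \<le> e * (2 * B ^ 3) + e * (2 * B ^ 3)"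
      by (intro norm_triangle_mono; unfold norm_mult; intro mult_mono assms(2) adj2_entry_le B norm_ge_zero e)
    finally show ?thesis by (simp add: algebra_simps)
  qed
  from this[of 1 1] this[of 1 2] this[of 2 1] this[of 2 2] show ?thesis
    by (simp add: near_1_def)
qed

lemma norm_le_entries:
  fixes A :: "hamilton^2^2"
  assumes "\<And>i j. norm (A $ i $ j) \<le> C" shows "norm A \<le> 4 * C"
proof -
  have "norm A \<le> (\<Sum>i\<in>UNIV. norm (A $ i))" unfolding norm_vec_def by (rule L2_set_le_sum) simp
  also have "\<dots> \<le> (\<Sum>i\<in>UNIV. \<Sum>j\<in>UNIV. norm (A $ i $ j))"
    unfolding norm_vec_def by (intro sum_mono L2_set_le_sum) simp
  also have "\<dots> \<le> 4 * C" using assms[of 1 1] assms[of 1 2] assms[of 2 1] assms[of 2 2] by (simp add: sum_2)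
  finally show ?thesis .
qed

lemma norm_entry_le: "norm (A $ i $ j) \<le> norm A" for A :: "hamilton^2^2"
  by (rule order_trans[OF Finite_Cartesian_Product.norm_nth_le Finite_Cartesian_Product.norm_nth_le])

section \<open>Orbit segments and their gluing\<close>

context hamilton_order
begin

text \<open>The lower limit of \<open>norm_prod\<close> over primitive columns of height tending to
  infinity, unfolded into its two conditions for a real value \<open>c\<close>.\<close>

definition lagrange_value :: "hamilton \<Rightarrow> real \<Rightarrow> bool" where
  "lagrange_value x c \<longleftrightarrow>
     (\<forall>e>0. \<exists>X. \<forall>v\<in>primitive. norm (v$2) \<ge> X \<longrightarrow> c - e \<le> norm_prod (unip x *v v)) \<and>
     (\<forall>e>0. \<forall>X. \<exists>v\<in>primitive. norm (v$2) \<ge> X \<and> norm_prod (unip x *v v) \<le> c + e)"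

lemma primitive_R: "v \<in> primitive \<Longrightarrow> v$1 \<in> R \<and> v$2 \<in> R \<and> v \<noteq> 0"
  by (auto simp: primitive_def ddet_def intro: J_R)

lemma unip_vec_nth [simp]: "(unip x *v v) $ 1 = v$1 - x * v$2" "(unip x *v v) $ 2 = v$2"
  by (simp_all add: unip_def mat_vec_mult_nth)

text \<open>Only finitely many columns of height below \<open>X\<close> can satisfy the bound at a
  nonnegative time. For irrational \<open>x\<close> their first entries after \<open>unip x\<close>
  are nonzero, so the flow pushes all of them beyond \<open>K\<close> after a fixed time. This turns
  a late time into a large height, conversely to \<open>balance_time_ge\<close>.\<close>

lemma large_denominator:
  assumes "x \<notin> rationals"
  obtains t0 where "\<forall>t\<ge>t0. \<forall>v. v$1 \<in> R \<longrightarrow> v$2 \<in> R \<longrightarrow> v \<noteq> 0 \<longrightarrow>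
    norm ((flow t *v (unip x *v v)) $ 1) \<le> K \<longrightarrow> norm (v$2) \<ge> X"
proof -
  define D where "D = {v :: hamilton^2. v$1 \<in> R \<and> v$2 \<in> R \<and> v \<noteq> 0 \<and> norm (v$1) \<le> K + norm x * X \<and> norm (v$2) \<le> X}"
  have "D \<subseteq> (\<lambda>(p, q). vector [p, q]) ` ({p \<in> R. norm p \<le> K + norm x * X} \<times> {q \<in> R. norm q \<le> X})"
  proof
    fix v :: "hamilton^2" assume "v \<in> D"
    moreover have "v = vector [v$1, v$2]" by (simp add: vec2_eq_iff)
    ultimately show "v \<in> (\<lambda>(p, q). vector [p, q]) ` ({p \<in> R. norm p \<le> K + norm x * X} \<times> {q \<in> R. norm q \<le> X})"
      by (intro image_eqI[of _ _ "(v$1, v$2)"]) (auto simp: D_def)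
  qed
  then have fin: "finite D" by (rule finite_subset) (intro finite_imageI finite_cartesian_product finite_R_ball)
  \<comment> \<open>The inserted 1 keeps the minimum meaningful and positive when \<open>D\<close>
    is empty.\<close>
  define \<mu> where "\<mu> = Min (insert 1 ((\<lambda>v. norm (v$1 - x * v$2)) ` D))"
  have \<mu>: "\<mu> > 0" using fin irrational_diff_nonzero[OF assms] by (auto simp: \<mu>_def D_def)
  have \<mu>_le: "\<mu> \<le> norm (v$1 - x * v$2)" if "v \<in> D" for v using fin that by (auto simp: \<mu>_def)
  define t0 where "t0 = max 0 (\<bar>K\<bar> / \<mu>)"
  show ?thesis
  proof (rule that[of t0], intro allI impI)
    fix t v assume t: "t0 \<le> t" and v: "v$1 \<in> R" "v$2 \<in> R" "v \<noteq> 0"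
      and K: "norm ((flow t *v (unip x *v v)) $ 1) \<le> K"
    have t': "0 \<le> t" "\<bar>K\<bar> / \<mu> \<le> t" using t by (auto simp: t0_def)
    show "norm (v$2) \<ge> X"
    proof (rule ccontr)
      assume X: "\<not> norm (v$2) \<ge> X"
      have K': "exp t * norm (v$1 - x * v$2) \<le> K" using K by (simp add: norm_mult)
      have "1 * norm (v$1 - x * v$2) \<le> exp t * norm (v$1 - x * v$2)"
        using t' by (intro mult_right_mono) auto
      then have "norm (v$1 - x * v$2) \<le> K" using K' by linarith
      moreover have "norm (v$1) \<le> norm (v$1 - x * v$2) + norm (x * v$2)"
        by (metis diff_add_cancel norm_triangle_ineq)
      moreover have "norm (x * v$2) \<le> norm x * X" using X by (simp add: norm_mult mult_left_mono)
      ultimately have "v \<in> D" using v X by (auto simp: D_def)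
      then have "exp t * \<mu> \<le> exp t * norm (v$1 - x * v$2)" by (simp add: \<mu>_le)
      then have "exp t * \<mu> \<le> K" using K' by linarith
      moreover have "t + 1 \<le> exp t" using exp_ge_add_one_self[of t] by linarith
      then have "(t + 1) * \<mu> \<le> exp t * \<mu>" using \<mu> by (intro mult_right_mono) auto
      moreover have "\<bar>K\<bar> \<le> t * \<mu>" using t'(2) \<mu> by (simp add: field_simps)
      ultimately show False using \<mu> by (simp add: algebra_simps)
    qed
  qed
qed

text \<open>A piece of orbit of length \<open>tau \<ge> T\<close> that starts and ends \<open>e\<close>-close to \<open>Q\<close>, and along which
  the smallest product met (at height at most \<open>W\<close>) is \<open>c\<close> up to \<open>e\<close>.\<close>

definition segment :: "real \<Rightarrow> real \<Rightarrow> hamilton^2^2 \<Rightarrow> real \<Rightarrow> real \<Rightarrow>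
    hamilton \<Rightarrow> real \<Rightarrow> hamilton^2^2 \<Rightarrow> hamilton^2^2 \<Rightarrow> real \<Rightarrow> bool" where
  "segment c W Q e T x t h g tau \<longleftrightarrow>
     0 \<le> t \<and> T \<le> tau \<and> h \<in> cong_group \<and> g \<in> cong_group \<and>
     (\<forall>i j. norm ((flow t ** unip x ** h - Q) $ i $ j) \<le> e) \<and>
     (\<forall>i j. norm ((flow tau ** (flow t ** unip x ** h) ** g - Q) $ i $ j) \<le> e) \<and>
     (\<forall>v\<in>primitive. \<forall>s\<in>{0..tau}. (\<forall>i. norm ((flow s ** (flow t ** unip x ** h) *v v) $ i) \<le> W) \<longrightarrow>
        c - e \<le> norm_prod (flow t ** unip x ** h *v v)) \<and>
     (\<exists>v\<in>primitive. \<exists>s\<in>{0..tau}. (\<forall>i. norm ((flow s ** (flow t ** unip x ** h) *v v) $ i) \<le> W) \<and>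
        norm_prod (flow t ** unip x ** h *v v) \<le> c + e)"

text \<open>Let \<open>P n\<close> and \<open>P' n\<close> be the matrices at the two ends of
  segment \<open>n\<close>. The corrections \<open>Y n\<close> from \<open>shadowing\<close> are
  made so that the flow over time \<open>tau n\<close> takes \<open>Y n ** P n\<close>, up to the
  group element \<open>g n\<close>, to \<open>Y (Suc n) ** P (Suc n)\<close>. Hence all of these lie
  on one orbit modulo the group, that of \<open>y\<close>, which stays near the given
  segments.\<close>

lemma glue_segments:
  assumes W: "W \<ge> 4 * sqrt (c + 1)" and c: "c \<ge> 0"
    and seg: "\<And>e T. e > 0 \<Longrightarrow> \<exists>x t h g tau. segment c W Q e T x t h g tau"
  shows "\<exists>y. y \<notin> rationals \<and> lagrange_value y c"
proof -
  have W0: "W > 0" using W c by (smt (verit) real_sqrt_gt_zero)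
  have "finite (range (\<lambda>(i, j). norm (Q $ i $ j)))" by simp
  then have "bdd_above (range (\<lambda>(i, j). norm (Q $ i $ j)))" by (rule bdd_above_finite)
  then obtain B0 where B0: "\<And>i j. norm (Q $ i $ j) \<le> B0" by (force simp: bdd_above_def)
  define B where "B = max 1 (B0 + 1)"
  \<comment> \<open>Consecutive ends differ by at most \<open>2 * \<epsilon> n\<close>, and
    \<open>near_1_quotient\<close> multiplies this by \<open>4 * B ^ 3\<close>; the result is
    exactly the jump size that \<open>pseudo_orbit\<close> admits.\<close>
  define \<epsilon> :: "nat \<Rightarrow> real" where "\<epsilon> n = (1/2) ^ (n + 5) / (8 * B ^ 3)" for n
  have B1: "B \<ge> 1" by (simp add: B_def)
  have \<epsilon>: "\<epsilon> n > 0" "\<epsilon> n \<le> 1" "\<epsilon> (Suc n) \<le> \<epsilon> n" for n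
  proof -
    show "\<epsilon> n > 0" using B1 by (simp add: \<epsilon>_def)
    have "(1/2::real) ^ (n + 5) \<le> 1" by (rule power_le_one) auto
    moreover have "1 \<le> 8 * B ^ 3" using one_le_power[OF B1, of 3] by linarith
    ultimately have "(1/2) ^ (n + 5) \<le> 8 * B ^ 3" by linarith
    then show "\<epsilon> n \<le> 1" using B1 by (simp add: \<epsilon>_def divide_le_eq)
    have "(1/2::real) ^ (Suc n + 5) \<le> (1/2) ^ (n + 5)" by (rule power_decreasing) auto
    then show "\<epsilon> (Suc n) \<le> \<epsilon> n" unfolding \<epsilon>_def using B1 by (intro divide_right_mono) auto
  qed
  have \<epsilon>_lim: "\<epsilon> \<longlonglongrightarrow> 0"
  proof -
    have "(\<lambda>n. (1/2::real) ^ (n + 5)) \<longlonglongrightarrow> 0" by real_asymp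
    then show ?thesis unfolding \<epsilon>_def by (rule tendsto_divide_zero)
  qed
  have "\<forall>n. \<exists>x t h g tau. segment c W Q (\<epsilon> n) (real n + 8) x t h g tau"
    using seg \<epsilon> by blast
  then obtain x t h g tau where s: "\<And>n. segment c W Q (\<epsilon> n) (real n + 8) (x n) (t n) (h n) (g n) (tau n)"
    by metis
  define P where "P n = flow (t n) ** unip (x n) ** h n" for n
  define P' where "P' n = flow (tau n) ** P n ** g n" for n
  note s' = s[unfolded segment_def, folded P_def, folded P'_def]
  have hg: "h n \<in> cong_group" "g n \<in> cong_group" and t0: "0 \<le> t n" and tau: "real n + 8 \<le> tau n" for n
    using s'[of n] by auto
  have PQ: "norm ((P n - Q) $ i $ j) \<le> \<epsilon> n" "norm ((P' n - Q) $ i $ j) \<le> \<epsilon> n" for n i j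
    using s'[of n] by auto
  have lower: "c - \<epsilon> n \<le> norm_prod (P n *v v)"
    if "v \<in> primitive" "s \<in> {0..tau n}" "\<And>i. norm ((flow s ** P n *v v) $ i) \<le> W" for n v s
    using s'[of n] that by blast
  have "\<exists>v s. v \<in> primitive \<and> s \<in> {0..tau n} \<and> (\<forall>i. norm ((flow s ** P n *v v) $ i) \<le> W) \<and>
        norm_prod (P n *v v) \<le> c + \<epsilon> n" for n using s'[of n] by blast
  then obtain v0 s0 where upper: "\<And>n. v0 n \<in> primitive" "\<And>n. s0 n \<in> {0..tau n}"
    "\<And>n i. norm ((flow (s0 n) ** P n *v v0 n) $ i) \<le> W" "\<And>n. norm_prod (P n *v v0 n) \<le> c + \<epsilon> n"
    by metis
  have dP: "ddet (P n) = 1" "ddet (P' n) = 1" for n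
    using cong_group_entries(2)[OF hg(1)] cong_group_entries(2)[OF hg(2)]
    by (simp_all add: P_def P'_def ddet_mult)
  have PB: "norm (P n $ i $ j) \<le> B" "norm (P' n $ i $ j) \<le> B" for n i j
  proof -
    have "B0 + 1 \<le> B" by (simp add: B_def)
    then show "norm (P n $ i $ j) \<le> B" "norm (P' n $ i $ j) \<le> B"
      using norm_between(1)[OF PQ(1)[of n i j, unfolded vector_minus_component]]
        norm_between(1)[OF PQ(2)[of n i j, unfolded vector_minus_component]]
        \<epsilon>(2)[of n] B0[of i j] by linarith+
  qed
  define E where "E n = P' n ** adj2 (P (Suc n))" for n
  define F where "F n = P (Suc n) ** adj2 (P' n)" for n
  have near: "norm ((P' n - P (Suc n)) $ i $ j) \<le> 2 * \<epsilon> n" "norm ((P (Suc n) - P' n) $ i $ j) \<le> 2 * \<epsilon> n" for n i j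
  proof -
    have "norm ((P' n - P (Suc n)) $ i $ j) \<le> norm ((P' n - Q) $ i $ j) + norm ((P (Suc n) - Q) $ i $ j)"
      using norm_triangle_ineq4[of "(P' n - Q) $ i $ j" "(P (Suc n) - Q) $ i $ j"] by simp
    then show "norm ((P' n - P (Suc n)) $ i $ j) \<le> 2 * \<epsilon> n"
      using PQ(2)[of n i j] PQ(1)[of "Suc n" i j] \<epsilon>(3)[of n] by linarith
    then show "norm ((P (Suc n) - P' n) $ i $ j) \<le> 2 * \<epsilon> n" by (simp add: norm_minus_commute)
  qed
  have e5: "4 * B ^ 3 * (2 * \<epsilon> n) = (1/2) ^ (n + 5)" for n using B1 by (simp add: \<epsilon>_def)
  interpret pseudo_orbit tau E F
  proof
    show "real n + 8 \<le> tau n" for n by (rule tau)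
    show "E n ** F n = mat 1" "F n ** E n = mat 1" for n
    proof -
      have "E n ** F n = P' n ** (adj2 (P (Suc n)) ** P (Suc n)) ** adj2 (P' n)"
        "F n ** E n = P (Suc n) ** (adj2 (P' n) ** P' n) ** adj2 (P (Suc n))"
        by (simp_all add: E_def F_def matrix_mul_assoc)
      then show "E n ** F n = mat 1" "F n ** E n = mat 1" by (simp_all add: ddet_1_inverse dP)
    qed
    show "near_1 ((1/2) ^ (n + 5)) (E n)" "near_1 ((1/2) ^ (n + 5)) (F n)" for n
      unfolding E_def F_def e5[symmetric] by (intro near_1_quotient dP near PB)+
  qed
  obtain a b c' d where abcd: "a 0 = 1" "c' 0 = 0" "d 0 = 1"
    "\<forall>n. a (Suc n) = a n * E n$1$1 + of_real (inverse (contr n)) * b n * E n$2$1"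
    "\<forall>n. b (Suc n) = a n * E n$1$2 + of_real (inverse (contr n)) * b n * E n$2$2"
    "\<forall>n. c' (Suc n) = of_real (contr n) * c' n * E n$1$1 + d n * E n$2$1"
    "\<forall>n. d (Suc n) = of_real (contr n) * c' n * E n$1$2 + d n * E n$2$2"
    "\<forall>n. 1/2 \<le> norm (a n)" "\<forall>n. norm (a n) \<le> 2" "\<forall>n. 1/2 \<le> norm (d n)" "\<forall>n. norm (d n) \<le> 2"
    "(\<lambda>n. inverse (contr n) * norm (b n)) \<longlonglongrightarrow> 0" "(\<lambda>n. norm (c' n)) \<longlonglongrightarrow> 0"
    by (rule shadowing)
  define Y where "Y n = mat2 (a n) (b n) (c' n) (d n)" for n
  have Y_conj: "flow s ** Y n ** flow (- s) =
    mat2 (a n) (of_real (exp (2 * s)) * b n) (of_real (exp (- (2 * s))) * c' n) (d n)" for s n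
    unfolding Y_def by (rule flow_conj)
  have contr_exp: "exp (2 * tau n) = inverse (contr n)" "exp (- (2 * tau n)) = contr n" for n
    by (simp_all add: contr_def exp_minus)
  have Y_Suc: "Y (Suc n) = flow (tau n) ** Y n ** flow (- tau n) ** E n" for n
    unfolding Y_conj contr_exp using abcd(4-7) by (simp add: mat2_eq_iff mat_mult_nth Y_def)
  \<comment> \<open>\<open>Y 0\<close> is unipotent with upper right entry \<open>b 0\<close>. Moved
    to the right past \<open>flow (t 0)\<close>, this entry shrinks by
    \<open>exp (- (2 * t 0))\<close> and merges with \<open>unip (x 0)\<close>.\<close>
  define y where "y = x 0 - of_real (exp (- (2 * t 0))) * b 0"
  \<comment> \<open>\<open>G n\<close> collects the group elements used so far, and
    \<open>S n\<close> is the time at which the orbit of \<open>y\<close> enters piece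
    \<open>n\<close>.\<close>
  define G where "G = rec_nat (h 0) (\<lambda>n G. G ** g n)"
  define S where "S = rec_nat (t 0) (\<lambda>n S. S + tau n)"
  have G: "G 0 = h 0" "\<And>n. G (Suc n) = G n ** g n" by (simp_all add: G_def)
  have S: "S 0 = t 0" "\<And>n. S (Suc n) = S n + tau n" by (simp_all add: S_def)
  have G_grp: "G n \<in> cong_group" for n by (induction n) (auto simp: G hg intro: cong_group_mult)
  have G_inv: "G n ** adj2 (G n) = mat 1" "adj2 (G n) ** G n = mat 1" for n
    using ddet_1_inverse[OF cong_group_entries(2)[OF G_grp]] by auto
  have S_ge: "S n \<ge> real n" for n
  proof (induction n)
    case 0 then show ?case using t0 by (simp add: S)
  next
    case (Suc n) then show ?case using tau[of n] by (simp add: S)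
  qed
  have orbit: "flow (S n) ** unip y ** G n = Y n ** P n" for n
  proof (induction n)
    case 0
    have "of_real (exp (t 0)) * (of_real (exp (- (2 * t 0))) * z) = of_real (exp (- t 0)) * (z::hamilton)" for z
    proof -
      have "of_real (exp (t 0)) * (of_real (exp (- (2 * t 0))) * z) = of_real (exp (t 0) * exp (- (2 * t 0))) * z"
        by (simp only: of_real_mult mult.assoc)
      then show ?thesis by (simp flip: exp_add)
    qed
    then have "flow (t 0) ** unip y = Y 0 ** (flow (t 0) ** unip (x 0))"
      using abcd(1-3) by (simp add: mat2_eq_iff mat_mult_nth Y_def flow_def unip_def y_def right_diff_distrib of_real_commute)
    then show ?case by (simp add: G S P_def matrix_mul_assoc)
  next
    case (Suc n)
    have "flow (S (Suc n)) ** unip y ** G (Suc n) = flow (tau n) ** (flow (S n) ** unip y ** G n) ** g n"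
      by (simp add: S G add.commute[of "S n"] matrix_mul_assoc flip: flow_add)
    also have "\<dots> = flow (tau n) ** Y n ** (flow (- tau n) ** flow (tau n)) ** P n ** g n"
      unfolding Suc flow_cancel by (simp add: matrix_mul_assoc)
    also have "\<dots> = flow (tau n) ** Y n ** flow (- tau n) ** P' n ** (adj2 (P (Suc n)) ** P (Suc n))"
      by (simp only: P'_def matrix_mul_assoc ddet_1_inverse(1)[OF dP(1)] matrix_mul_rid)
    also have "\<dots> = Y (Suc n) ** P (Suc n)"
      by (simp add: Y_Suc E_def matrix_mul_assoc)
    finally show ?case .
  qed
  define Ys where "Ys n s = flow s ** Y n ** flow (- s)" for n s
  have orbit_s: "flow (S n + s) *v (unip y *v v) = Ys n s *v (flow s ** P n *v (adj2 (G n) *v v))" for n s v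
  proof -
    have "flow (S n + s) ** unip y = flow s ** (flow (S n) ** unip y ** G n) ** adj2 (G n)"
      by (simp add: add.commute[of "S n"] G_inv flip: flow_add matrix_mul_assoc)
    also have "\<dots> = flow s ** Y n ** (flow (- s) ** flow s) ** P n ** adj2 (G n)"
      unfolding orbit flow_cancel by (simp add: matrix_mul_assoc)
    also have "\<dots> = Ys n s ** (flow s ** P n ** adj2 (G n))" by (simp only: Ys_def matrix_mul_assoc)
    finally show ?thesis by (simp add: matrix_vector_mul_assoc)
  qed
  \<comment> \<open>One bound for the whole piece: the upper right entry is largest at its end, the
    lower left one at its beginning, and the diagonal is constant.\<close>
  define \<eta> where "\<eta> n = max (max (inverse (contr n) * norm (b n)) (norm (c' n))) \<bar>norm (a n) * norm (d n) - 1\<bar>" for n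
  have \<eta>_bd: "norm (Ys n s $ 1 $ 2) \<le> \<eta> n" "norm (Ys n s $ 2 $ 1) \<le> \<eta> n"
    "\<bar>norm (Ys n s $ 1 $ 1) * norm (Ys n s $ 2 $ 2) - 1\<bar> \<le> \<eta> n" if "s \<in> {0..tau n}" for n s
  proof -
    have "exp (2 * s) * norm (b n) \<le> inverse (contr n) * norm (b n)"
      unfolding contr_exp(1)[symmetric] using that by (intro mult_right_mono) auto
    then show "norm (Ys n s $ 1 $ 2) \<le> \<eta> n" by (simp add: Ys_def Y_conj norm_mult \<eta>_def)
    have "exp (- (2 * s)) * norm (c' n) \<le> 1 * norm (c' n)" using that by (intro mult_right_mono) auto
    then show "norm (Ys n s $ 2 $ 1) \<le> \<eta> n" by (simp add: Ys_def Y_conj norm_mult \<eta>_def)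
    show "\<bar>norm (Ys n s $ 1 $ 1) * norm (Ys n s $ 2 $ 2) - 1\<bar> \<le> \<eta> n" by (simp add: Ys_def Y_conj \<eta>_def)
  qed
  have Ys_bd: "1/2 \<le> norm (Ys n s $ 1 $ 1)" "norm (Ys n s $ 1 $ 1) \<le> 2" "1/2 \<le> norm (Ys n s $ 2 $ 2)"
    "norm (Ys n s $ 2 $ 2) \<le> 2" for n s using abcd(8-11) by (simp_all add: Ys_def Y_conj)
  \<comment> \<open>Only the product of the diagonal norms has to tend to 1, as
    \<open>norm_prod\<close> sees nothing else. Its square differs from
    \<open>ddet (Y n) = 1\<close> by at most \<open>r n\<close>, and |u - 1| is at most |u^2 - 1|
    for nonnegative u.\<close>
  have "(\<lambda>n. norm (a n) * norm (d n) - 1) \<longlonglongrightarrow> 0"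
  proof -
    define r where "r n = (inverse (contr n) * norm (b n) * norm (c' n)) ^ 2 +
      2 * 2 * 2 * (inverse (contr n) * norm (b n) * norm (c' n))" for n
    have dY: "ddet (Y n) = 1" for n
      using arg_cong[OF orbit[of n], of ddet] cong_group_entries(2)[OF G_grp] by (simp add: ddet_mult dP)
    have le_r: "\<bar>norm (a n) * norm (d n) - 1\<bar> \<le> r n" for n
    proof -
      define u where "u = norm (a n) * norm (d n)"
      have u: "u \<ge> 0" by (simp add: u_def)
      have le: "norm (b n) * norm (c' n) \<le> inverse (contr n) * norm (b n) * norm (c' n)"
      proof -
        have "1 \<le> inverse (contr n)" using contr[of n] by (intro one_le_inverse) auto
        then show ?thesis by (intro mult_right_mono) (auto simp: mult_le_cancel_right1)
      qed
      have "\<bar>ddet (Y n) - norm (a n) ^ 2 * norm (d n) ^ 2\<bar> \<le> (norm (b n) * norm (c' n)) ^ 2 +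
        2 * norm (a n) * norm (d n) * (norm (b n) * norm (c' n))"
        using ddet_diff_le[of "Y n"] by (simp add: Y_def)
      also have "\<dots> \<le> r n"
        unfolding r_def
      proof (intro add_mono power_mono mult_mono[OF _ le])
        show "2 * norm (a n) * norm (d n) \<le> 2 * 2 * 2"
          using abcd(9,11) by (intro mult_mono) auto
      qed (use le in auto)
      finally have "\<bar>1 - u ^ 2\<bar> \<le> r n" by (simp add: dY u_def power_mult_distrib)
      moreover have "\<bar>u - 1\<bar> * 1 \<le> \<bar>u - 1\<bar> * (u + 1)" using u by (intro mult_left_mono) auto
      moreover have "\<bar>u - 1\<bar> * (u + 1) = \<bar>(u - 1) * (u + 1)\<bar>" using u by (simp add: abs_mult)
      moreover have "(u - 1) * (u + 1) = - (1 - u ^ 2)" by (simp add: algebra_simps power2_eq_square)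
      ultimately show ?thesis unfolding u_def[symmetric] by simp
    qed
    have "r \<longlonglongrightarrow> (0 * 0) ^ 2 + 2 * 2 * 2 * (0 * 0)"
      unfolding r_def
      by (intro tendsto_add tendsto_power tendsto_mult[OF tendsto_const] tendsto_mult[OF abcd(12,13)])
    then have r0: "r \<longlonglongrightarrow> 0" by simp
    show ?thesis by (rule Lim_null_comparison[OF _ r0]) (simp add: le_r)
  qed
  then have "(\<lambda>n. \<bar>norm (a n) * norm (d n) - 1\<bar>) \<longlonglongrightarrow> 0" by (rule tendsto_rabs_zero)
  then have "\<eta> \<longlonglongrightarrow> max (max 0 0) 0"
    unfolding \<eta>_def using abcd(12,13) by (intro tendsto_max)
  then have \<eta>_lim: "\<eta> \<longlonglongrightarrow> 0" by simp
  \<comment> \<open>Otherwise some integral column \<open>v = (n * y, n)\<close> has first entry 0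
    after \<open>unip y\<close>, so the flow shrinks it to 0. Undoing the bounded matrices of a late
    piece gives an integral column \<open>u\<close> with entries of norm below 1, so
    \<open>u\<close> and with it \<open>v\<close> vanish.\<close>
  have y: "y \<notin> rationals"
  proof
    assume "y \<in> rationals"
    then obtain n :: int where n: "n \<noteq> 0" "of_int n * y \<in> R" by (auto simp: rationals_def)
    define v :: "hamilton^2" where "v = vector [of_int n * y, of_int n]"
    have ny: "of_int n * y = y * of_int n" using of_real_commute[of "of_int n" y] by simp
    have "(\<lambda>k. 2 * (2 * B ^ 3 * (4 * (exp (- S k) * \<bar>of_int n\<bar>)))) \<longlonglongrightarrow> 2 * (2 * B ^ 3 * (4 * (0 * \<bar>of_int n\<bar>)))"
    proof (intro tendsto_intros)
      have "filterlim S at_top sequentially"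
        by (rule filterlim_at_top_mono[OF filterlim_real_sequentially]) (simp add: S_ge)
      then show "(\<lambda>k. exp (- S k)) \<longlonglongrightarrow> 0"
        by (intro filterlim_compose[OF exp_at_bot] filterlim_compose[OF filterlim_uminus_at_bot_at_top])
    qed
    then have "\<forall>\<^sub>F k in sequentially. 2 * (2 * B ^ 3 * (4 * (exp (- S k) * \<bar>of_int n\<bar>))) < 1"
      by (rule order_tendstoD) simp
    moreover have "\<forall>\<^sub>F k in sequentially. \<eta> k < 1/8" by (rule order_tendstoD[OF \<eta>_lim]) simp
    ultimately have "\<forall>\<^sub>F k in sequentially. 2 * (2 * B ^ 3 * (4 * (exp (- S k) * \<bar>of_int n\<bar>))) < 1 \<and> \<eta> k < 1/8"
      by (rule eventually_conj)
    then obtain k where k: "2 * (2 * B ^ 3 * (4 * (exp (- S k) * \<bar>of_int n\<bar>))) < 1" "\<eta> k < 1/8"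
      by (auto simp: eventually_sequentially)
    define u where "u = adj2 (G k) *v v"
    define w where "w = P k *v u"
    have tk: "0 \<in> {0..tau k}" using tau[of k] by simp
    have "flow (S k) *v (unip y *v v) = Ys k 0 *v w" using orbit_s[of k 0 v] by (simp add: w_def u_def)
    moreover have "norm ((flow (S k) *v (unip y *v v)) $ i) \<le> exp (- S k) * \<bar>of_int n\<bar>" for i
      using exhaust_2[of i] by (auto simp: v_def ny norm_mult)
    ultimately have "norm (w $ i) \<le> 4 * (exp (- S k) * \<bar>of_int n\<bar>)" for i
      by (intro almost_diagonal(2)[of "Ys k 0" "\<eta> k"] Ys_bd \<eta>_bd tk) (use k in auto)
    note w = this
    have "u = adj2 (P k) *v w" by (simp add: w_def matrix_vector_mul_assoc ddet_1_inverse dP)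
    moreover have "norm ((adj2 (P k) *v w) $ i) \<le> 2 * (2 * B ^ 3 * (4 * (exp (- S k) * \<bar>of_int n\<bar>)))" for i
    proof -
      have "norm (adj2 (P k) $ i $ j * w $ j) \<le> 2 * B ^ 3 * (4 * (exp (- S k) * \<bar>of_int n\<bar>))" for j
        unfolding norm_mult using B1 by (intro mult_mono adj2_entry_le PB w) auto
      from norm_triangle_mono[OF this[of 1] this[of 2]] show ?thesis
        unfolding mat_vec_mult_nth mult_2 .
    qed
    ultimately have "norm (u $ i) < 1" for i using k(1) by (metis order.strict_trans1)
    moreover have "u $ i \<in> R" for i
    proof -
      have "adj2 (G k) \<in> mats R" using cong_group_entries(1)[OF cong_group_adj2[OF G_grp]] .
      then show ?thesis using n(2) of_int_R unfolding u_def mat_vec_mult_nth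
        by (intro add_R mult_R) (auto simp: mats_def v_def)
    qed
    ultimately have "u $ i = 0" for i using norm_ge_1[of "u $ i"] by (meson not_less)
    then have "u = 0" by (simp add: vec_eq_iff)
    moreover have "v = G k *v u" by (simp add: u_def matrix_vector_mul_assoc G_inv)
    ultimately have "v = 0" by simp
    then have "v $ 2 = 0" by simp
    then show False using n(1) by (simp add: v_def)
  qed
  have close: "\<forall>\<^sub>F n in sequentially. \<epsilon> n + 6 * \<eta> n * W ^ 2 < e \<and> \<eta> n < 1/8" if "e > 0" for e
  proof (intro eventually_conj)
    have "(\<lambda>n. \<epsilon> n + 6 * \<eta> n * W ^ 2) \<longlonglongrightarrow> 0 + 6 * 0 * W ^ 2"
      by (intro tendsto_intros \<epsilon>_lim \<eta>_lim)
    then show "\<forall>\<^sub>F n in sequentially. \<epsilon> n + 6 * \<eta> n * W ^ 2 < e"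
      by (rule order_tendstoD) (use that in simp)
    show "\<forall>\<^sub>F n in sequentially. \<eta> n < 1/8" by (rule order_tendstoD[OF \<eta>_lim]) simp
  qed
  have "lagrange_value y c"
    unfolding lagrange_value_def
  proof (intro conjI allI impI)
    fix e :: real assume "e > 0"
    then obtain N where N: "\<And>n. n \<ge> N \<Longrightarrow> \<epsilon> n + 6 * \<eta> n * W ^ 2 < e \<and> \<eta> n < 1/8"
      using close unfolding eventually_sequentially by blast
    \<comment> \<open>\<open>K\<close> is the balanced norm for the product c + 1; larger products
      satisfy the lower bound trivially. Height at least \<open>K * exp (S N)\<close> puts the
      balance time after \<open>S N\<close>, in a piece of index at least \<open>N\<close>, where
      the errors are small.\<close>
    define K where "K = sqrt (c + 1)"
    have K: "K > 0" "K ^ 2 = c + 1" using c by (simp_all add: K_def)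
    show "\<exists>X. \<forall>v\<in>primitive. norm (v$2) \<ge> X \<longrightarrow> c - e \<le> norm_prod (unip y *v v)"
    proof (intro exI[of _ "K * exp (S N)"] ballI impI)
      fix v assume v: "v \<in> primitive" and X: "K * exp (S N) \<le> norm (v$2)"
      show "c - e \<le> norm_prod (unip y *v v)"
      proof (cases "norm_prod (unip y *v v) \<le> c + 1")
        case True
        define z where "z = unip y *v v"
        have z1: "z$1 \<noteq> 0" using irrational_diff_nonzero[OF y] primitive_R[OF v] by (simp add: z_def)
        have z2: "z$2 \<noteq> 0" using less_le_trans[OF mult_pos_pos[OF K(1) exp_gt_zero] X] by (auto simp: z_def)
        define st where "st = balance_time z"
        have st: "st \<ge> S N" unfolding st_def
          by (rule balance_time_ge[of _ K]) (use z1 True K X in \<open>simp_all add: z_def\<close>)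
        \<comment> \<open>The piece during which the column is balanced:
          \<open>S n \<le> st < S (Suc n)\<close>.\<close>
        define n where "n = (LEAST n. st < S (Suc n))"
        have "\<exists>n. st < S (Suc n)"
        proof -
          obtain n where "st < real n" using reals_Archimedean2 by blast
          then show ?thesis using S_ge[of "Suc n"] by (intro exI[of _ n]) simp
        qed
        then have n1: "st < S (Suc n)" unfolding n_def by (rule LeastI_ex)
        have S_mono: "S m \<le> S (Suc m)" for m using tau[of m] by (simp add: S)
        have n2: "n \<ge> N"
        proof (rule ccontr)
          assume "\<not> n \<ge> N"
          then have "S (Suc n) \<le> S N" using lift_Suc_mono_le[of S, OF S_mono] by simp
          then show False using n1 st by simp
        qed
        have n3: "S n \<le> st"
        proof (cases "n = N")
          case False
          then obtain m where m: "n = Suc m" using n2 by (cases n) auto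
          then have "\<not> st < S (Suc m)" using not_less_Least[of m "\<lambda>n. st < S (Suc n)"] n_def by auto
          then show ?thesis by (simp add: m)
        qed (use st in simp)
        define s where "s = st - S n"
        have s: "s \<in> {0..tau n}" using n1 n3 by (simp add: s_def S)
        define v' where "v' = adj2 (G n) *v v"
        have v': "v' \<in> primitive"
          unfolding v'_def using v by (intro cong_group_primitive cong_group_adj2 G_grp)
        define w where "w = flow s ** P n *v v'"
        have zw: "flow st *v z = Ys n s *v w"
          using orbit_s[of n s v] by (simp add: z_def w_def v'_def s_def)
        have sq: "sqrt (norm_prod z) \<le> K" unfolding K_def using True by (simp add: z_def)
        have "norm ((Ys n s *v w) $ i) \<le> K" for i
          unfolding zw[symmetric] st_def balance_time[OF z1 z2] by (rule sq)
        then have "norm (w $ i) \<le> 4 * K" for i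
          by (intro almost_diagonal(2)[of "Ys n s" "\<eta> n"] Ys_bd \<eta>_bd s) (use N[OF n2] in auto)
        \<comment> \<open>This is where the factor 4 in \<open>W\<close> is spent: the balanced
          column of \<open>y\<close>, seen from the original segment, still lies in the ball that
          the lower bound of the segment covers.\<close>
        then have w: "norm (w $ i) \<le> W" for i using W unfolding K_def by (meson order_trans)
        have "c - \<epsilon> n \<le> norm_prod (P n *v v')" by (rule lower[OF v' s]) (use w w_def in auto)
        also have "\<dots> = norm_prod w" by (simp add: w_def flip: matrix_vector_mul_assoc)
        also have "\<dots> \<le> norm_prod (Ys n s *v w) + 6 * \<eta> n * W ^ 2"
          using almost_diagonal(3)[of "Ys n s" "\<eta> n" w W, OF Ys_bd \<eta>_bd(1,2)[OF s] _ w \<eta>_bd(3)[OF s]] N[OF n2]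
          by linarith
        also have "norm_prod (Ys n s *v w) = norm_prod z" by (simp flip: zw)
        finally show ?thesis using N[OF n2] by (simp add: z_def)
      qed (use \<open>e > 0\<close> in simp)
    qed
  next
    fix e X :: real assume "e > 0"
    then obtain N where N: "\<And>n. n \<ge> N \<Longrightarrow> \<epsilon> n + 6 * \<eta> n * W ^ 2 < e \<and> \<eta> n < 1/8"
      using close unfolding eventually_sequentially by blast
    \<comment> \<open>The columns that nearly attain \<open>c\<close> on the segments are
      transported to the orbit of \<open>y\<close>. They meet the ball of radius
      \<open>3 * W\<close> at late times, so their heights are unbounded.\<close>
    obtain t1 where t1: "\<forall>t\<ge>t1. \<forall>v. v$1 \<in> R \<longrightarrow> v$2 \<in> R \<longrightarrow> v \<noteq> 0 \<longrightarrow>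
      norm ((flow t *v (unip y *v v)) $ 1) \<le> 3 * W \<longrightarrow> norm (v$2) \<ge> X"
      by (rule large_denominator[OF y])
    obtain N' :: nat where N': "t1 \<le> real N'" using real_arch_simple by blast
    define n where "n = max N N'"
    have n: "n \<ge> N" "real n \<ge> t1" using N' by (auto simp: n_def)
    define v where "v = G n *v v0 n"
    have v: "v \<in> primitive" unfolding v_def by (intro cong_group_primitive G_grp upper)
    define w where "w = flow (s0 n) ** P n *v v0 n"
    have w: "norm (w $ i) \<le> W" for i unfolding w_def by (rule upper)
    have zw: "flow (S n + s0 n) *v (unip y *v v) = Ys n (s0 n) *v w"
      using orbit_s[of n "s0 n" v] by (simp add: v_def w_def matrix_vector_mul_assoc[of "adj2 (G n)"] G_inv)
    have "norm ((Ys n (s0 n) *v w) $ 1) \<le> 3 * W"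
      by (rule almost_diagonal(1)[of "Ys n (s0 n)" "\<eta> n"]) (use Ys_bd \<eta>_bd upper(2) N[OF n(1)] w in auto)
    moreover have "S n + s0 n \<ge> t1" using S_ge[of n] upper(2)[of n] n(2) by simp
    ultimately have "norm (v$2) \<ge> X" using t1 primitive_R[OF v] unfolding zw[symmetric] by blast
    moreover have "norm_prod (unip y *v v) \<le> c + e"
    proof -
      have "norm_prod (unip y *v v) = norm_prod (Ys n (s0 n) *v w)" by (simp flip: zw)
      also have "\<dots> \<le> norm_prod w + 6 * \<eta> n * W ^ 2"
        using almost_diagonal(3)[of "Ys n (s0 n)" "\<eta> n" w W, OF Ys_bd \<eta>_bd(1,2)[OF upper(2)] _ w \<eta>_bd(3)[OF upper(2)]]
          N[OF n(1)] by linarith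
      also have "norm_prod w = norm_prod (P n *v v0 n)" by (simp add: w_def flip: matrix_vector_mul_assoc)
      also have "\<dots> \<le> c + \<epsilon> n" by (rule upper)
      finally show ?thesis using N[OF n(1)] by linarith
    qed
    ultimately show "\<exists>v\<in>primitive. norm (v$2) \<ge> X \<and> norm_prod (unip y *v v) \<le> c + e" using v by blast
  qed
  with y show ?thesis by blast
qed

section \<open>Recurrent points and closedness of the set of values\<close>

definition recurrent_point :: "hamilton \<Rightarrow> hamilton^2^2 \<Rightarrow> bool" where
  "recurrent_point x Q \<longleftrightarrow> (\<forall>e>0. \<forall>T. \<exists>t\<ge>T. \<exists>h\<in>cong_group. \<forall>i j. norm ((flow t ** unip x ** h - Q) $ i $ j) \<le> e)"

text \<open>A limit point of the returns to the compact set of \<open>recurrence\<close>. The bound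
  is uniform in \<open>x\<close>, so that recurrent points of different \<open>x\<close> have a
  common limit point.\<close>

lemma recurrent_points_exist:
  obtains C where "\<And>x. x \<notin> rationals \<Longrightarrow> \<exists>Q. norm Q \<le> C \<and> recurrent_point x Q"
proof -
  obtain C where C: "C \<ge> 1" "\<And>x T. x \<notin> rationals \<Longrightarrow>
    \<exists>t\<ge>T. \<exists>g\<in>cong_group. \<forall>i j. norm ((flow t ** unip x ** g) $ i $ j) \<le> C"
    using recurrence by blast
  have "\<exists>Q. norm Q \<le> 4 * C \<and> recurrent_point x Q" if x: "x \<notin> rationals" for x
  proof -
    have "\<forall>k. \<exists>t g. real k \<le> t \<and> g \<in> cong_group \<and> (\<forall>i j. norm ((flow t ** unip x ** g) $ i $ j) \<le> C)"
      using C(2)[OF x] by blast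
    then obtain t g where tg: "\<And>k. real k \<le> t k" "\<And>k. g k \<in> cong_group"
      "\<And>k i j. norm ((flow (t k) ** unip x ** g k) $ i $ j) \<le> C" by metis
    define A where "A k = flow (t k) ** unip x ** g k" for k :: nat
    have A: "norm (A k) \<le> 4 * C" for k unfolding A_def by (rule norm_le_entries) (rule tg)
    then have "bounded (range A)" by (auto simp: bounded_iff)
    from bounded_imp_convergent_subsequence[OF this] obtain Q r where
      r: "strict_mono r" "(A \<circ> r) \<longlonglongrightarrow> Q" by blast
    have "norm Q \<le> 4 * C" by (rule Lim_bounded[OF tendsto_norm[OF r(2)]]) (use A in auto)
    moreover have "recurrent_point x Q"
      unfolding recurrent_point_def
    proof (intro allI impI)
      fix e T :: real assume "e > 0"
      then obtain N where N: "\<And>n. n \<ge> N \<Longrightarrow> norm (A (r n) - Q) < e"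
        using LIMSEQ_D[OF r(2)] by (auto simp: o_def)
      obtain N' :: nat where N': "T \<le> real N'" using real_arch_simple by blast
      define n where "n = max N N'"
      have "T \<le> t (r n)" using N' seq_suble[OF r(1), of n] tg(1)[of "r n"] by (simp add: n_def)
      moreover have "norm ((A (r n) - Q) $ i $ j) \<le> e" for i j
        using N[of n] norm_entry_le[of "A (r n) - Q" i j] by (simp add: n_def)
      ultimately show "\<exists>t\<ge>T. \<exists>h\<in>cong_group. \<forall>i j. norm ((flow t ** unip x ** h - Q) $ i $ j) \<le> e"
        using tg(2) unfolding A_def by blast
    qed
    ultimately show ?thesis by blast
  qed
  then show ?thesis using that by blast
qed

lemma lagrange_value_nonneg: "lagrange_value x c \<Longrightarrow> c \<ge> 0"
proof (rule ccontr)
  assume l: "lagrange_value x c" and c: "\<not> c \<ge> 0"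
  then obtain v where "norm_prod (unip x *v v) \<le> c + - c / 2"
    unfolding lagrange_value_def by (metis half_gt_zero neg_0_less_iff_less not_le minus_divide_left)
  then show False using c norm_prod_nonneg[of "unip x *v v"] by (simp add: field_simps)
qed

text \<open>The order of choices matters: first a return time \<open>t\<close> so late that columns
  met in the ball of radius \<open>W\<close> have height at least the threshold \<open>X\<close> of
  the lower bound; then a column \<open>v0\<close> so high that it is balanced after
  \<open>t\<close>; then a return time \<open>t'\<close> after \<open>t + T\<close> and after that
  balance time. Half of \<open>e\<close> is spent on replacing \<open>c0\<close> by \<open>c\<close>
  and \<open>Q0\<close> by \<open>Q\<close>.\<close>

lemma segment_exists:
  assumes x: "x \<notin> rationals" and l: "lagrange_value x c0" and Q0: "recurrent_point x Q0"
    and e: "0 < e" "e \<le> 1" and c: "\<bar>c0 - c\<bar> \<le> e / 2" and Q: "norm (Q0 - Q) \<le> e / 2"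
    and W: "W \<ge> sqrt (c + 1)" and "c \<ge> 0"
  shows "\<exists>t h g tau. segment c W Q e T x t h g tau"
proof -
  have e2: "e / 2 > 0" using e by simp
  obtain X where X: "\<And>v. v \<in> primitive \<Longrightarrow> norm (v$2) \<ge> X \<Longrightarrow> c0 - e / 2 \<le> norm_prod (unip x *v v)"
    using l e2 unfolding lagrange_value_def by blast
  obtain t0 where t0: "\<forall>t\<ge>t0. \<forall>v. v$1 \<in> R \<longrightarrow> v$2 \<in> R \<longrightarrow> v \<noteq> 0 \<longrightarrow>
    norm ((flow t *v (unip x *v v)) $ 1) \<le> W \<longrightarrow> norm (v$2) \<ge> X"
    by (rule large_denominator[OF x])
  obtain t h where t: "t \<ge> max 0 t0" and h: "h \<in> cong_group"
    and P: "\<And>i j. norm ((flow t ** unip x ** h - Q0) $ i $ j) \<le> e / 2"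
    using Q0 e2 unfolding recurrent_point_def by meson
  define K where "K = sqrt (c + 1)"
  have K: "K > 0" "K ^ 2 = c + 1" using \<open>c \<ge> 0\<close> by (simp_all add: K_def)
  obtain v0 where v0: "v0 \<in> primitive" "norm (v0$2) \<ge> K * exp t" "norm_prod (unip x *v v0) \<le> c0 + e / 2"
    using l e2 unfolding lagrange_value_def by blast
  define z where "z = unip x *v v0"
  have z1: "z$1 \<noteq> 0" using irrational_diff_nonzero[OF x] primitive_R[OF v0(1)] by (simp add: z_def)
  have z2: "z$2 \<noteq> 0" using less_le_trans[OF mult_pos_pos[OF K(1) exp_gt_zero] v0(2)] by (auto simp: z_def)
  have zc: "norm_prod z \<le> c + e" using v0(3) c unfolding z_def by linarith
  define st where "st = balance_time z"
  have st: "st \<ge> t" unfolding st_def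
    by (rule balance_time_ge[of _ K]) (use z1 K v0 zc e in \<open>simp_all add: z_def\<close>)
  obtain t' h' where t': "t' \<ge> max (t + T) st" and h': "h' \<in> cong_group"
    and P': "\<And>i j. norm ((flow t' ** unip x ** h' - Q0) $ i $ j) \<le> e / 2"
    using Q0 e2 unfolding recurrent_point_def by meson
  have h_inv: "h ** adj2 h = mat 1" "adj2 h ** h = mat 1"
    using ddet_1_inverse[OF cong_group_entries(2)[OF h]] by auto
  define g where "g = adj2 h ** h'"
  define tau where "tau = t' - t"
  have triangle: "norm ((A - Q) $ i $ j) \<le> e" if "norm ((A - Q0) $ i $ j) \<le> e / 2" for A i j
  proof -
    have "norm ((A - Q) $ i $ j) \<le> norm ((A - Q0) $ i $ j) + norm ((Q0 - Q) $ i $ j)"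
      using norm_triangle_ineq[of "(A - Q0) $ i $ j" "(Q0 - Q) $ i $ j"] by simp
    then show ?thesis using that norm_entry_le[of "Q0 - Q" i j] Q by linarith
  qed
  have end_eq: "flow tau ** (flow t ** unip x ** h) ** g = flow t' ** unip x ** h'"
  proof -
    have "flow tau ** (flow t ** unip x ** h) ** g = flow tau ** flow t ** unip x ** (h ** adj2 h) ** h'"
      by (simp add: g_def matrix_mul_assoc)
    then show ?thesis by (simp add: h_inv flow_add tau_def)
  qed
  have np: "norm_prod (flow t ** unip x ** h *v v) = norm_prod (unip x *v (h *v v))" for v
    by (simp flip: matrix_vector_mul_assoc)
  have fl: "flow s ** (flow t ** unip x ** h) *v v = flow (s + t) *v (unip x *v (h *v v))" for s v
    by (simp add: matrix_vector_mul_assoc matrix_mul_assoc flow_add)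
  have "segment c W Q e T x t h g tau"
    unfolding segment_def
  proof (intro conjI ballI allI impI)
    show "0 \<le> t" "T \<le> tau" using t t' by (simp_all add: tau_def)
    show "h \<in> cong_group" "g \<in> cong_group" unfolding g_def by (intro h h' cong_group_mult cong_group_adj2)+
    show "norm ((flow t ** unip x ** h - Q) $ i $ j) \<le> e" for i j by (rule triangle[OF P])
    show "norm ((flow tau ** (flow t ** unip x ** h) ** g - Q) $ i $ j) \<le> e" for i j
      unfolding end_eq by (rule triangle[OF P'])
  next
    fix v s assume v: "v \<in> primitive" and s: "s \<in> {0..tau}"
      and b: "\<forall>i. norm ((flow s ** (flow t ** unip x ** h) *v v) $ i) \<le> W"
    have hv: "h *v v \<in> primitive" by (intro cong_group_primitive h v)
    have "norm ((h *v v)$2) \<ge> X"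
    proof -
      have "s + t \<ge> t0" using s t by simp
      then show ?thesis using t0 primitive_R[OF hv] b[unfolded fl] by blast
    qed
    from X[OF hv this] show "c - e \<le> norm_prod (flow t ** unip x ** h *v v)"
      unfolding np using c by linarith
  next
    define v where "v = adj2 h *v v0"
    have hv: "h *v v = v0" by (simp add: v_def matrix_vector_mul_assoc h_inv)
    have sq: "sqrt (norm_prod z) \<le> W"
      by (rule order_trans[OF _ W]) (use zc e in simp)
    show "\<exists>v\<in>primitive. \<exists>s\<in>{0..tau}. (\<forall>i. norm ((flow s ** (flow t ** unip x ** h) *v v) $ i) \<le> W) \<and>
        norm_prod (flow t ** unip x ** h *v v) \<le> c + e"
    proof (intro bexI[of _ v] bexI[of _ "st - t"] conjI allI)
      show "norm ((flow (st - t) ** (flow t ** unip x ** h) *v v) $ i) \<le> W" for i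
        unfolding fl hv using balance_time[OF z1 z2, of i] sq by (simp add: st_def z_def)
      show "norm_prod (flow t ** unip x ** h *v v) \<le> c + e" unfolding np hv using zc by (simp add: z_def)
      show "st - t \<in> {0..tau}" using st t' by (simp add: tau_def)
      show "v \<in> primitive" unfolding v_def by (intro cong_group_primitive cong_group_adj2 h v0)
    qed
  qed
  then show ?thesis by blast
qed

text \<open>Gluing needs segments that all start and end near one matrix, hence the limit
  \<open>Q'\<close> of recurrent points of the \<open>x n\<close>. For each \<open>e\<close> and
  \<open>T\<close> a single late index supplies a segment.\<close>

theorem lagrange_values_closed:
  assumes x: "\<And>n. x n \<notin> rationals" and l: "\<And>n. lagrange_value (x n) (c n)" and lim: "c \<longlonglongrightarrow> c'"
  shows "\<exists>y. y \<notin> rationals \<and> lagrange_value y c'"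
proof -
  obtain C where "\<And>x. x \<notin> rationals \<Longrightarrow> \<exists>Q. norm Q \<le> C \<and> recurrent_point x Q"
    using recurrent_points_exist by blast
  then have "\<forall>n. \<exists>Q. norm Q \<le> C \<and> recurrent_point (x n) Q" using x by blast
  then obtain Q where Q: "\<And>n. norm (Q n) \<le> C" "\<And>n. recurrent_point (x n) (Q n)" by metis
  have "bounded (range Q)" using Q(1) by (auto simp: bounded_iff)
  from bounded_imp_convergent_subsequence[OF this] obtain Q' r where
    r: "strict_mono r" "(Q \<circ> r) \<longlonglongrightarrow> Q'" by blast
  have c': "c' \<ge> 0" by (rule LIMSEQ_le_const[OF lim]) (use lagrange_value_nonneg[OF l] in auto)
  show ?thesis
  proof (rule glue_segments[of c' "4 * sqrt (c' + 1)" Q'])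
    fix e T :: real assume e: "e > 0"
    \<comment> \<open>\<open>segment_exists\<close> asks for a tolerance of at most 1; segments for
      a smaller tolerance are segments for \<open>e\<close>.\<close>
    define e' where "e' = min e 1"
    have e': "0 < e'" "e' \<le> 1" "e' \<le> e" "e' / 2 > 0" using e by (auto simp: e'_def)
    obtain N where N: "\<And>n. n \<ge> N \<Longrightarrow> norm (Q (r n) - Q') < e' / 2"
      using LIMSEQ_D[OF r(2) e'(4)] by (auto simp: o_def)
    obtain N' where N': "\<And>n. n \<ge> N' \<Longrightarrow> norm (c n - c') < e' / 2"
      using LIMSEQ_D[OF lim e'(4)] by auto
    define n where "n = max N N'"
    have "r n \<ge> N'" using seq_suble[OF r(1), of n] by (simp add: n_def)
    then have "\<bar>c (r n) - c'\<bar> \<le> e' / 2" using N'[of "r n"] by simp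
    moreover have "norm (Q (r n) - Q') \<le> e' / 2" using N[of n] by (simp add: n_def)
    moreover have "sqrt (c' + 1) \<ge> 0" using c' by simp
    ultimately have "\<exists>t h g tau. segment c' (4 * sqrt (c' + 1)) Q' e' T (x (r n)) t h g tau"
      using c' e' by (intro segment_exists[OF x l Q(2)]) auto
    then obtain t h g tau where "segment c' (4 * sqrt (c' + 1)) Q' e' T (x (r n)) t h g tau" by blast
    then have "segment c' (4 * sqrt (c' + 1)) Q' e T (x (r n)) t h g tau"
      using e'(3) unfolding segment_def by (smt (verit, best))
    then show "\<exists>x t h g tau. segment c' (4 * sqrt (c' + 1)) Q' e T x t h g tau" by blast
  qed (use c' in auto)
qed

text \<open>The first columns of the returning matrices are images of the primitive column (1, 0);
  at the return time both entries are bounded, and the product is invariant under the flow. This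
  makes the lower limit finite.\<close>

lemma bounded_approximations:
  assumes x: "x \<notin> rationals"
  obtains C where "\<forall>X. \<exists>v\<in>primitive. norm (v$2) \<ge> X \<and> norm_prod (unip x *v v) \<le> C"
proof -
  obtain C where C: "C \<ge> 1" "\<And>x T. x \<notin> rationals \<Longrightarrow>
    \<exists>t\<ge>T. \<exists>g\<in>cong_group. \<forall>i j. norm ((flow t ** unip x ** g) $ i $ j) \<le> C"
    using recurrence by blast
  have "\<exists>v\<in>primitive. norm (v$2) \<ge> X \<and> norm_prod (unip x *v v) \<le> C * C" for X
  proof -
    obtain t0 where t0: "\<forall>t\<ge>t0. \<forall>v. v$1 \<in> R \<longrightarrow> v$2 \<in> R \<longrightarrow> v \<noteq> 0 \<longrightarrow>
      norm ((flow t *v (unip x *v v)) $ 1) \<le> C \<longrightarrow> norm (v$2) \<ge> X"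
      by (rule large_denominator[OF x])
    obtain t g where t: "t \<ge> t0" and g: "g \<in> cong_group"
      and b: "\<And>i j. norm ((flow t ** unip x ** g) $ i $ j) \<le> C" using C(2)[OF x] by blast
    define v :: "hamilton^2" where "v = g *v vector [1, 0]"
    have "vector [1, 0] \<in> primitive"
      unfolding primitive_def using one_R zero_R zero_J
      by (auto simp: ddet_def intro!: bexI[of _ 0] bexI[of _ 1])
    then have v: "v \<in> primitive" unfolding v_def by (intro cong_group_primitive g)
    have "flow t *v (unip x *v v) = flow t ** unip x ** g *v vector [1, 0]"
      by (simp add: v_def matrix_vector_mul_assoc matrix_mul_assoc)
    then have "(flow t *v (unip x *v v)) $ i = (flow t ** unip x ** g) $ i $ 1" for i
      by (simp only: mat_vec_mult_nth[of "flow t ** unip x ** g"]) simp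
    then have n: "norm ((flow t *v (unip x *v v)) $ i) \<le> C" for i using b by simp
    have "norm_prod (unip x *v v) = norm_prod (flow t *v (unip x *v v))" by simp
    also have "\<dots> \<le> C * C" unfolding norm_prod_def using C(1) by (intro mult_mono n) auto
    finally show ?thesis using t0 t n[of 1] primitive_R[OF v] v by blast
  qed
  then show ?thesis using that by blast
qed

end

section \<open>The reduced norm of a ramified quaternion algebra\<close>

lemma standard_involution_hcnj: "standard_involution hcnj"
proof -
  have "linear hcnj"
    by (rule linearI) (simp_all add: hamilton_eq_iff)
  then show ?thesis by (simp add: standard_involution_def hcnj_mult_self image_iff del: of_real_power)
qed

text \<open>Comparing the scalars for x and x + 1 gives \<sigma> x = t - x with t real. If x is not
  real, then x (t - x) is real only for t = 2 Re x; if x is real, linearity decides.\<close>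

lemma standard_involution_hamilton:
  assumes "standard_involution \<sigma>" shows "\<sigma> = hcnj"
proof
  fix x
  note \<sigma> = assms[unfolded standard_involution_def]
  interpret linear \<sigma> using \<sigma> by blast
  have real: "y * \<sigma> y \<in> range of_real" for y using \<sigma> by blast
  obtain r s where r: "x * \<sigma> x = of_real r" and s: "(x + 1) * \<sigma> (x + 1) = of_real s"
    using real by (metis imageE)
  have "\<sigma> x = of_real (s - r - 1) - x"
    using s \<sigma> unfolding add distrib_left distrib_right r by (simp add: algebra_simps)
  then obtain t where t: "\<sigma> x = of_real t - x" by blast
  show "\<sigma> x = hcnj x"
  proof (cases "Im_i x = 0 \<and> Im_j x = 0 \<and> Im_k x = 0")
    case True
    then have x: "x = Re0 x *\<^sub>R 1" by (simp add: hamilton_eq_iff)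
    then have "\<sigma> x = Re0 x *\<^sub>R 1" using \<sigma> scale[of "Re0 x" 1] by metis
    then show ?thesis using True by (simp add: hamilton_eq_iff)
  next
    case False
    have "x * (of_real t - x) = of_real r" using r t by simp
    then have "(t - 2 * Re0 x) * Im_i x = 0" "(t - 2 * Re0 x) * Im_j x = 0" "(t - 2 * Re0 x) * Im_k x = 0"
      by (simp_all add: hamilton_eq_iff hamilton_sel_mult algebra_simps)
    then have "t = 2 * Re0 x" using False by auto
    then show ?thesis unfolding t hcnj_conv by simp
  qed
qed

locale hamilton_isomorphism =
  fixes \<phi> :: "'b::real_algebra_1 \<Rightarrow> hamilton"
  assumes bij: "bij \<phi>" and linear: "linear \<phi>" and one: "\<phi> 1 = 1" and mult: "\<phi> (x * y) = \<phi> x * \<phi> y"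
begin

lemma phi_of_real [simp]: "\<phi> (of_real r) = of_real r"
  using linear_cmul[OF linear, of r 1] by (simp add: of_real_def one)

lemma inv_phi [simp]: "\<phi> (inv \<phi> x) = x" "inv \<phi> (\<phi> y) = y"
  using bij by (simp_all add: bij_is_surj surj_f_inv_f bij_is_inj)

lemma eq_iff: "\<phi> x = \<phi> y \<longleftrightarrow> x = y"
  using bij by (metis inv_phi(2))

lemma inv_linear: "linear (inv \<phi>)"
  by (rule linearI; subst eq_iff[symmetric]) (simp_all add: linear_add[OF linear] linear_cmul[OF linear])

lemma inv_mult: "inv \<phi> (x * y) = inv \<phi> x * inv \<phi> y"
  by (subst eq_iff[symmetric]) (simp add: mult)

lemma inv_one: "inv \<phi> 1 = 1"
  by (subst eq_iff[symmetric]) (simp add: one)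

lemma standard_involution_iff: "standard_involution \<sigma> \<longleftrightarrow> \<sigma> = inv \<phi> \<circ> hcnj \<circ> \<phi>"
proof
  assume \<sigma>: "standard_involution \<sigma>"
  have "standard_involution (\<phi> \<circ> \<sigma> \<circ> inv \<phi>)"
    unfolding standard_involution_def
  proof (intro conjI allI)
    note \<sigma>' = \<sigma>[unfolded standard_involution_def]
    show "Real_Vector_Spaces.linear (\<phi> \<circ> \<sigma> \<circ> inv \<phi>)"
      using \<sigma>' by (intro linear_compose linear inv_linear) auto
    show "(\<phi> \<circ> \<sigma> \<circ> inv \<phi>) 1 = 1" using \<sigma>' by (simp add: inv_one one)
    show "(\<phi> \<circ> \<sigma> \<circ> inv \<phi>) ((\<phi> \<circ> \<sigma> \<circ> inv \<phi>) x) = x" for x using \<sigma>' by simp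
    show "(\<phi> \<circ> \<sigma> \<circ> inv \<phi>) (x * y) = (\<phi> \<circ> \<sigma> \<circ> inv \<phi>) y * (\<phi> \<circ> \<sigma> \<circ> inv \<phi>) x" for x y
      using \<sigma>' by (simp add: inv_mult mult)
    fix x
    obtain r where "inv \<phi> x * \<sigma> (inv \<phi> x) = of_real r" using \<sigma>' by (metis imageE)
    then have "\<phi> (inv \<phi> x * \<sigma> (inv \<phi> x)) = of_real r" by simp
    then show "x * (\<phi> \<circ> \<sigma> \<circ> inv \<phi>) x \<in> range of_real" by (simp add: mult)
  qed
  from standard_involution_hamilton[OF this] have "\<phi> (\<sigma> x) = hcnj (\<phi> x)" for x
    by (metis comp_apply inv_phi(2))
  then show "\<sigma> = inv \<phi> \<circ> hcnj \<circ> \<phi>" by (auto simp: fun_eq_iff simp flip: eq_iff)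
next
  assume \<sigma>: "\<sigma> = inv \<phi> \<circ> hcnj \<circ> \<phi>"
  note h = standard_involution_hcnj[unfolded standard_involution_def]
  show "standard_involution \<sigma>"
    unfolding standard_involution_def \<sigma>
  proof (intro conjI allI)
    show "Real_Vector_Spaces.linear (inv \<phi> \<circ> hcnj \<circ> \<phi>)"
      using h by (intro linear_compose linear inv_linear) auto
    show "(inv \<phi> \<circ> hcnj \<circ> \<phi>) 1 = 1" by (simp add: inv_one one)
    show "(inv \<phi> \<circ> hcnj \<circ> \<phi>) ((inv \<phi> \<circ> hcnj \<circ> \<phi>) x) = x" for x by simp
    show "(inv \<phi> \<circ> hcnj \<circ> \<phi>) (x * y) = (inv \<phi> \<circ> hcnj \<circ> \<phi>) y * (inv \<phi> \<circ> hcnj \<circ> \<phi>) x" for x y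
      by (simp add: inv_mult mult)
    fix x
    have "x * (inv \<phi> \<circ> hcnj \<circ> \<phi>) x = of_real (norm (\<phi> x) ^ 2)"
      by (subst eq_iff[symmetric]) (simp add: mult hcnj_mult_self del: of_real_power)
    then show "x * (inv \<phi> \<circ> hcnj \<circ> \<phi>) x \<in> range of_real" by blast
  qed
qed

lemma reduced_norm_eq: "reduced_norm x = norm (\<phi> x) ^ 2"
proof -
  have "conjugation = inv \<phi> \<circ> hcnj \<circ> \<phi>"
    unfolding conjugation_def standard_involution_iff by simp
  from fun_cong[OF this, of x] have "\<phi> (conjugation x) = hcnj (\<phi> x)" by simp
  then have "x * conjugation x = of_real (norm (\<phi> x) ^ 2)"
    by (subst eq_iff[symmetric]) (simp add: mult hcnj_mult_self del: of_real_power)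
  then have "reduced_norm x = (THE t. of_real t = (of_real (norm (\<phi> x) ^ 2) :: 'b))"
    unfolding reduced_norm_def by simp
  also have "\<dots> = norm (\<phi> x) ^ 2" by (rule the_equality) (simp_all only: of_real_eq_iff)
  finally show ?thesis .
qed

end

section \<open>The tensor product\<close>

text \<open>The real-linear extension of a rational functional. The value 0 for nonlinear
  \<open>f\<close> makes the lifted function respect \<open>tensor_eq\<close> for every
  \<open>f\<close>.\<close>

lift_definition tensor_eval :: "('a::rat_algebra_1 \<Rightarrow> rat) \<Rightarrow> 'a real_tensor \<Rightarrow> real"
  is "\<lambda>f M. if Vector_Spaces.linear scaleQ (*) f then \<Sum>u\<in>#M. of_rat (f (fst u)) * snd u else 0"
proof -
  fix f :: "'a \<Rightarrow> rat" and M N :: "('a \<times> real) multiset"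
  assume eq: "tensor_eq M N"
  show "(if Vector_Spaces.linear scaleQ (*) f then \<Sum>u\<in>#M. of_rat (f (fst u)) * snd u else 0) =
    (if Vector_Spaces.linear scaleQ (*) f then \<Sum>u\<in>#N. of_rat (f (fst u)) * snd u else 0)"
  proof (cases "Vector_Spaces.linear scaleQ (*) f")
    case True
    then interpret f: Vector_Spaces.linear scaleQ "(*)" f .
    from eq have "(\<Sum>u\<in>#M. of_rat (f (fst u)) * snd u) = (\<Sum>u\<in>#N. of_rat (f (fst u)) * snd u)"
      by induction (simp_all add: f.add f.scale f.zero of_rat_add of_rat_mult algebra_simps)
    then show ?thesis by simp
  qed simp
qed

lemma tensor_eval_linear:
  "linear (tensor_eval f)"
proof (rule linearI)
  show "tensor_eval f (x + y) = tensor_eval f x + tensor_eval f y" for x y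
    by transfer simp
  show "tensor_eval f (r *\<^sub>R x) = r *\<^sub>R tensor_eval f x" for r x
    by transfer (simp add: multiset.map_comp comp_def mult.left_commute sum_mset_distrib_left)
qed

lemma tensor_eval_to_real:
  "Vector_Spaces.linear scaleQ (*) f \<Longrightarrow> tensor_eval f (to_real a) = of_rat (f a)"
  unfolding to_real_def by transfer simp

lemma to_real_add: "to_real (a + b) = to_real a + to_real b"
  unfolding to_real_def by transfer (metis add_mset_add_single add_mset_commute tensor_add_left)

lemma to_real_mult: "to_real (a * b) = to_real a * to_real b"
  unfolding to_real_def by transfer (simp add: tensor_pair_mult_def tensor_refl)

lemma to_real_one: "to_real 1 = 1"
  unfolding to_real_def by transfer (simp add: tensor_refl)

lemma pure_tensor_eq: "pure_tensor a r = r *\<^sub>R to_real a"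
  unfolding to_real_def by transfer (simp add: tensor_refl)

lemma to_real_scaleQ: "to_real (c *\<^sub>Q a) = of_rat c *\<^sub>R to_real a"
  unfolding to_real_def by transfer (use tensor_balanced[of _ _ 1] in simp)

lemma span_range_to_real: "span (range to_real) = (UNIV :: 'a::rat_algebra_1 real_tensor set)"
proof -
  have "abs_real_tensor M \<in> span (range to_real)" for M :: "('a \<times> real) multiset"
  proof (induction M)
    case empty
    have "abs_real_tensor {#} = (0 :: 'a real_tensor)" by (simp add: zero_real_tensor.abs_eq)
    then show ?case by (simp add: span_zero)
  next
    case (add u M)
    have "abs_real_tensor (add_mset u M) = pure_tensor (fst u) (snd u) + abs_real_tensor M"
      by (simp add: pure_tensor.abs_eq plus_real_tensor.abs_eq)
    then show ?case using add by (simp add: pure_tensor_eq span_add span_scale span_base)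
  qed
  then have "x \<in> span (range to_real)" for x :: "'a real_tensor"
    by (induction x rule: real_tensor.abs_induct) blast
  then show ?thesis by blast
qed

lemma rational_functional:
  assumes "\<not> module.dependent scaleQ S"
  obtains f :: "'a::rat_algebra_1 \<Rightarrow> rat" where "Vector_Spaces.linear scaleQ (*) f" "\<forall>s\<in>S. f s = g s"
proof -
  interpret Q: vector_space "scaleQ :: rat \<Rightarrow> 'a \<Rightarrow> 'a" by (rule vector_space_scaleQ)
  interpret QQ: vector_space "(*) :: rat \<Rightarrow> rat \<Rightarrow> rat"
    by unfold_locales (auto simp: algebra_simps)
  interpret P: vector_space_pair "scaleQ :: rat \<Rightarrow> 'a \<Rightarrow> 'a" "(*) :: rat \<Rightarrow> rat \<Rightarrow> rat" ..
  from P.linear_independent_extend[OF assms, of g] show ?thesis using that by blast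
qed

section \<open>Integrality of the norm\<close>

lemma common_denominator:
  assumes "finite S" "S \<subseteq> \<rat>"
  shows "\<exists>d::int. d > 0 \<and> (\<forall>r\<in>S. of_int d * r \<in> (\<int> :: real set))"
  using assms
proof (induction rule: finite_induct)
  case (insert x S)
  then obtain d :: int where d: "d > 0" "\<forall>r\<in>S. of_int d * r \<in> \<int>" by blast
  obtain a b :: int where ab: "b > 0" "x = of_int a / of_int b" using insert.prems by (auto elim: Rats_cases')
  have "of_int (d * b) * x = of_int (d * a)" using ab by simp
  moreover have "of_int (d * b) * r = of_int b * (of_int d * r)" for r :: real by simp
  ultimately have "\<forall>r\<in>insert x S. of_int (d * b) * r \<in> \<int>"
    using d by (metis Ints_mult Ints_of_int insert_iff)
  with d ab show ?case by (intro exI[of _ "d * b"]) simp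
qed (auto intro: exI[of _ 1])

text \<open>If b is the reduced denominator of r, then every power of b divides d, which is
  impossible for b at least 2.\<close>

lemma bounded_denominator_powers:
  fixes r :: real and d :: int
  assumes "r \<in> \<rat>" "d > 0" and pow: "\<And>k. of_int d * r ^ k \<in> \<int>"
  shows "r \<in> \<int>"
proof -
  obtain a b :: int where ab: "b > 0" "coprime a b" "r = of_int a / of_int b"
    using assms(1) by (auto elim: Rats_cases')
  have "b ^ k dvd d" for k
  proof -
    obtain m where "of_int d * r ^ k = of_int m" using pow[of k] by (auto elim: Ints_cases)
    then have "of_int (d * a ^ k) = (of_int (b ^ k * m) :: real)"
      using ab by (simp add: power_divide field_simps)
    then have "d * a ^ k = b ^ k * m" by (simp only: of_int_eq_iff)
    then have "b ^ k dvd d * a ^ k" by simp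
    moreover have "coprime (b ^ k) (a ^ k)" using ab(2) by (simp add: coprime_commute)
    ultimately show ?thesis by (simp add: coprime_dvd_mult_left_iff)
  qed
  then have "b ^ nat d \<le> d" using assms(2) by (intro zdvd_imp_le) auto
  moreover have "d < 2 ^ nat d" using less_exp[of "nat d"] assms(2)
    by (metis nat_less_numeral_power_cancel_iff)
  moreover have "2 ^ nat d \<le> b ^ nat d" if "b \<ge> 2" using that by (intro power_mono) auto
  ultimately have "b = 1" using ab(1) by fastforce
  then show ?thesis using ab by simp
qed

lemma int_module: "module (\<lambda>(n::int) (x::'a::ring_1). of_int n * x)"
  by unfold_locales (simp_all add: algebra_simps)

section \<open>Limits inferior of real functions\<close>

lemma Liminf_eq_ereal_iff:
  fixes f :: "'a \<Rightarrow> real"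
  shows "Liminf F (\<lambda>z. ereal (f z)) = ereal c \<longleftrightarrow>
    (\<forall>e>0. eventually (\<lambda>z. c - e \<le> f z) F) \<and> (\<forall>e>0. frequently (\<lambda>z. f z \<le> c + e) F)"
    (is "?L = ereal c \<longleftrightarrow> ?R")
proof
  assume L: "?L = ereal c"
  show ?R
  proof (intro conjI allI impI)
    fix e :: real assume e: "e > 0"
    have "ereal (c - e) < ?L" using e by (simp add: L)
    from less_LiminfD[OF this] show "eventually (\<lambda>z. c - e \<le> f z) F"
      by (rule eventually_mono) simp
    show "frequently (\<lambda>z. f z \<le> c + e) F"
    proof (rule ccontr)
      assume "\<not> frequently (\<lambda>z. f z \<le> c + e) F"
      then have "eventually (\<lambda>z. ereal (c + e) \<le> ereal (f z)) F"
        unfolding not_frequently by (rule eventually_mono) simp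
      from Liminf_bounded[OF this] show False using e by (simp add: L)
    qed
  qed
next
  assume R: ?R
  show "?L = ereal c"
  proof (rule antisym)
    show "ereal c \<le> ?L"
    proof (rule ereal_le_epsilon2)
      fix e :: real assume "e > 0"
      with R have "eventually (\<lambda>z. ereal (c - e) \<le> ereal (f z)) F" by simp
      from Liminf_bounded[OF this] have "ereal (c - e) + ereal e \<le> ?L + ereal e" by (rule add_right_mono)
      then show "ereal c \<le> ?L + ereal e" by simp
    qed
    show "?L \<le> ereal c"
    proof (rule ereal_le_epsilon2, rule ccontr)
      fix e :: real assume e: "e > 0" and "\<not> ?L \<le> ereal c + ereal e"
      then have "ereal (c + e) < ?L" by simp
      from less_LiminfD[OF this] have "eventually (\<lambda>z. \<not> f z \<le> c + e) F"
        by (rule eventually_mono) simp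
      moreover have "frequently (\<lambda>z. f z \<le> c + e) F" using R e by blast
      ultimately show False by (simp add: frequently_def)
    qed
  qed
qed

lemma Liminf_real_exists:
  fixes f :: "'a \<Rightarrow> real"
  assumes "\<And>z. f z \<ge> 0" "frequently (\<lambda>z. f z \<le> C) F"
  obtains c where "Liminf F (\<lambda>z. ereal (f z)) = ereal c"
proof -
  have "ereal 0 \<le> Liminf F (\<lambda>z. ereal (f z))"
    by (rule Liminf_bounded) (use assms(1) in simp)
  moreover have "Liminf F (\<lambda>z. ereal (f z)) \<le> ereal C"
  proof (rule ccontr)
    assume "\<not> Liminf F (\<lambda>z. ereal (f z)) \<le> ereal C"
    then have "ereal C < Liminf F (\<lambda>z. ereal (f z))" by simp
    from less_LiminfD[OF this] have "eventually (\<lambda>z. \<not> f z \<le> C) F"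
      by (rule eventually_mono) simp
    with assms(2) show False by (simp add: frequently_def)
  qed
  ultimately show ?thesis using that by (cases "Liminf F (\<lambda>z. ereal (f z))") auto
qed

lemma of_int_inner: "inner (of_int n * x) y = of_int n * inner x (y::hamilton)"
  by (metis inner_scaleR_left of_real_of_int_eq scaleR_conv_of_real)

section \<open>Orders in ramified quaternion algebras\<close>

locale ramified_order = hamilton_isomorphism \<phi> for \<phi> :: "'a::rat_algebra_1 real_tensor \<Rightarrow> hamilton" +
  fixes \<O> \<I> :: "'a set"
  assumes order: "is_order \<O>" and ideal: "two_sided_ideal \<O> \<I>" and ideal_nonzero: "\<I> \<noteq> {0}"
begin

section \<open>The embedding of the algebra, and integrality on the order\<close>

definition emb :: "'a \<Rightarrow> hamilton" where "emb a = \<phi> (to_real a)"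

lemma emb_add [simp]: "emb (a + b) = emb a + emb b"
  by (simp add: emb_def to_real_add linear_add[OF linear])

lemma emb_0 [simp]: "emb 0 = 0" using emb_add[of 0 0] by simp

lemma emb_minus [simp]: "emb (- a) = - emb a"
  using emb_add[of a "- a"] by (simp add: minus_unique)

lemma emb_diff [simp]: "emb (a - b) = emb a - emb b" using emb_add[of a "- b"] by simp

lemma emb_mult [simp]: "emb (a * b) = emb a * emb b" by (simp add: emb_def to_real_mult mult)

lemma emb_1 [simp]: "emb 1 = 1" by (simp add: emb_def to_real_one one)

lemma emb_scaleQ [simp]: "emb (c *\<^sub>Q a) = of_rat c *\<^sub>R emb a"
  by (simp add: emb_def to_real_scaleQ linear_cmul[OF linear])

lemma emb_of_nat [simp]: "emb (of_nat n) = of_nat n" by (induction n) simp_all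

lemma emb_of_int [simp]: "emb (of_int n) = of_int n" by (cases n rule: int_cases2) simp_all

text \<open>Rational functionals extend to real ones on Hamilton's quaternions, so that a
  real-linear relation between images of the algebra can be evaluated to rational numbers.\<close>

lemma emb_eval:
  assumes "Vector_Spaces.linear scaleQ (*) f"
  obtains F :: "hamilton \<Rightarrow> real" where "Real_Vector_Spaces.linear F" "\<forall>a. F (emb a) = of_rat (f a)"
proof (rule that)
  show "Real_Vector_Spaces.linear (tensor_eval f \<circ> inv \<phi>)"
    by (intro linear_compose inv_linear tensor_eval_linear)
  show "\<forall>a. (tensor_eval f \<circ> inv \<phi>) (emb a) = of_rat (f a)"
    by (simp add: emb_def tensor_eval_to_real[OF assms])
qed

lemma emb_eq_0_iff [simp]: "emb a = 0 \<longleftrightarrow> a = 0"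
proof
  assume 0: "emb a = 0"
  interpret Q: vector_space "scaleQ :: rat \<Rightarrow> 'a \<Rightarrow> 'a" by (rule vector_space_scaleQ)
  show "a = 0"
  proof (rule ccontr)
    assume "a \<noteq> 0"
    then have "Q.independent {a}" by simp
    then obtain f :: "'a \<Rightarrow> rat" where f: "Vector_Spaces.linear scaleQ (*) f" "\<forall>s\<in>{a}. f s = 1"
      by (rule rational_functional)
    obtain F :: "hamilton \<Rightarrow> real" where "Real_Vector_Spaces.linear F" "\<forall>a. F (emb a) = of_rat (f a)"
      by (rule emb_eval[OF f(1)])
    then have "of_rat (f a) = (0 :: real)" using 0 by (metis linear_0)
    then show False using f by simp
  qed
qed simp

lemma emb_eq_iff [simp]: "emb a = emb b \<longleftrightarrow> a = b"
  using emb_eq_0_iff[of "a - b"] by (simp del: emb_eq_0_iff)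

text \<open>If \<open>a\<close> is not a scalar, some rational functional maps 1 to 1 and
  \<open>a\<close> to 0. Applied to the quadratic equation of \<open>a\<close>, its real extension
  removes the trace term and expresses the norm by the rational number
  \<open>f (a * a)\<close>.\<close>

lemma norm_emb_rational: "norm (emb a) ^ 2 \<in> \<rat>"
proof -
  interpret Q: vector_space "scaleQ :: rat \<Rightarrow> 'a \<Rightarrow> 'a" by (rule vector_space_scaleQ)
  show ?thesis
  proof (cases "a \<in> Q.span {1}")
    case True
    then obtain c where "a = c *\<^sub>Q 1" by (auto simp: Q.span_singleton)
    then have "norm (emb a) ^ 2 = of_rat (c ^ 2)" by (simp flip: of_rat_power)
    then show ?thesis by simp
  next
    case False
    then have "Q.independent {a, 1}" using Q.independent_empty by (intro Q.independent_insertI) auto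
    then obtain f :: "'a \<Rightarrow> rat" where f: "Vector_Spaces.linear scaleQ (*) f"
      "\<forall>s\<in>{a, 1}. f s = (if s = 1 then 1 else 0)" by (rule rational_functional)
    obtain F :: "hamilton \<Rightarrow> real" where F: "Real_Vector_Spaces.linear F" "\<forall>a. F (emb a) = of_rat (f a)"
      by (rule emb_eval[OF f(1)])
    have "a \<noteq> 1" using False Q.span_base[of 1 "{1}"] by auto
    then have fa: "f a = 0" "f 1 = 1" using f(2) by auto
    have "emb (a * a) = (2 * Re0 (emb a)) *\<^sub>R emb a - norm (emb a) ^ 2 *\<^sub>R emb 1"
    proof -
      have "emb a * emb a = emb a * (of_real (2 * Re0 (emb a)) - hcnj (emb a))"
        by (simp add: hcnj_conv)
      also have "\<dots> = of_real (2 * Re0 (emb a)) * emb a - of_real (norm (emb a) ^ 2)"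
        by (simp only: right_diff_distrib hcnj_mult_self of_real_commute)
      finally show ?thesis by (simp add: scaleR_conv_of_real)
    qed
    from arg_cong[OF this, of F] have "of_rat (f (a * a)) = - (norm (emb a) ^ 2)"
      by (simp only: linear_diff[OF F(1)] linear_cmul[OF F(1)] F(2)[rule_format] fa) simp
    then have "norm (emb a) ^ 2 = of_rat (- f (a * a))" by (simp add: of_rat_minus)
    then show ?thesis by simp
  qed
qed

lemma inner_emb_rational: "inner (emb a) (emb b) \<in> \<rat>"
proof -
  have "inner (emb a) (emb b) = (norm (emb (a + b)) ^ 2 - norm (emb a) ^ 2 - norm (emb b) ^ 2) / 2"
    by (simp add: power2_norm_eq_inner inner_add_left inner_add_right inner_commute)
  also have "\<dots> \<in> \<rat>" by (intro Rats_divide Rats_diff norm_emb_rational) simp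
  finally show ?thesis .
qed

lemma order_closed: "1 \<in> \<O>" "a \<in> \<O> \<Longrightarrow> b \<in> \<O> \<Longrightarrow> a - b \<in> \<O>" "a \<in> \<O> \<Longrightarrow> b \<in> \<O> \<Longrightarrow> a * b \<in> \<O>"
  using order by (auto simp: is_order_def)

lemma order_pow: "a \<in> \<O> \<Longrightarrow> a ^ k \<in> \<O>"
  by (induction k) (auto intro: order_closed)

text \<open>Finite generation gives one denominator \<open>d\<close> for all inner products of
  elements of the order. The powers of \<open>a\<close> stay in the order and have the powers of its
  norm as norms, so the denominators of these powers are bounded.\<close>

lemma norm_emb_integral:
  assumes "a \<in> \<O>" shows "norm (emb a) ^ 2 \<in> \<int>"
proof -
  obtain B where B: "finite B" "\<O> = module.span (\<lambda>(n::int) x. of_int n * x) B"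
    using order by (auto simp: is_order_def)
  interpret Z: module "\<lambda>(n::int) (x::'a). of_int n * x" by (rule int_module)
  let ?S = "(\<lambda>(b, b'). inner (emb b) (emb b')) ` (B \<times> B)"
  have "finite ?S" "?S \<subseteq> \<rat>" using B(1) inner_emb_rational by auto
  from common_denominator[OF this] obtain d :: int where d: "d > 0"
    and dB: "\<forall>r\<in>?S. of_int d * r \<in> \<int>" by blast
  have sub: "Z.subspace {x. of_int d * inner (emb x) y \<in> \<int>}" for y
  proof (rule Z.subspaceI; unfold mem_Collect_eq)
    fix u v :: 'a and k :: int
    show "of_int d * inner (emb 0) y \<in> \<int>" by simp
    assume u: "of_int d * inner (emb u) y \<in> \<int>"
    show "of_int d * inner (emb (u + v)) y \<in> \<int>" if "of_int d * inner (emb v) y \<in> \<int>"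
      using Ints_add[OF u that] by (simp add: inner_add_left distrib_left)
    have "of_int d * inner (emb (of_int k * u)) y = of_int k * (of_int d * inner (emb u) y)"
      by (simp add: of_int_inner)
    then show "of_int d * inner (emb (of_int k * u)) y \<in> \<int>"
      using Ints_mult[OF Ints_of_int u] by metis
  qed
  have 1: "of_int d * inner (emb x) (emb b) \<in> \<int>" if "x \<in> \<O>" "b \<in> B" for x b
  proof -
    have "B \<subseteq> {x. of_int d * inner (emb x) (emb b) \<in> \<int>}" using dB that(2) by auto
    from Z.span_minimal[OF this sub] show ?thesis using that(1) B(2) by blast
  qed
  have 2: "of_int d * inner (emb x) (emb z) \<in> \<int>" if "x \<in> \<O>" "z \<in> \<O>" for x z
  proof -
    have "B \<subseteq> {x. of_int d * inner (emb x) (emb z) \<in> \<int>}"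
      using 1[OF that(2)] by (auto simp: inner_commute[of _ "emb z"])
    from Z.span_minimal[OF this sub] show ?thesis using that(1) B(2) by blast
  qed
  show ?thesis
  proof (rule bounded_denominator_powers[OF norm_emb_rational d])
    fix k
    have "emb (a ^ k) = emb a ^ k" by (induction k) simp_all
    then have "(norm (emb a) ^ 2) ^ k = inner (emb (a ^ k)) (emb (a ^ k))"
      by (simp add: norm_power power_mult[symmetric] mult.commute flip: power2_norm_eq_inner)
    then show "of_int d * (norm (emb a) ^ 2) ^ k \<in> \<int>"
      using 2[OF order_pow[OF assms] order_pow[OF assms]] by simp
  qed
qed

text \<open>The elements with an integer denominator form a rational subspace that contains the
  order, and the order spans.\<close>

lemma order_clear_denominator: "\<exists>n::int. n \<noteq> 0 \<and> of_int n * a \<in> \<O>"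
proof -
  interpret Q: vector_space "scaleQ :: rat \<Rightarrow> 'a \<Rightarrow> 'a" by (rule vector_space_scaleQ)
  have add: "x + y \<in> \<O>" if "x \<in> \<O>" "y \<in> \<O>" for x y
  proof -
    have "0 \<in> \<O>" using order_closed(2)[OF order_closed(1,1)] by simp
    then have "0 - y \<in> \<O>" using that order_closed(2) by blast
    then show ?thesis using order_closed(2)[OF that(1)] by fastforce
  qed
  have nat: "of_nat n \<in> \<O>" for n
    using order_closed(2)[OF order_closed(1,1)] by (induction n) (auto intro: add order_closed(1))
  have int: "of_int n \<in> \<O>" for n
    using order_closed(2)[OF nat[of 0] nat] by (cases n rule: int_cases2) (auto intro: nat)
  have "Q.subspace {a. \<exists>n::int. n \<noteq> 0 \<and> of_int n * a \<in> \<O>}"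
  proof (rule Q.subspaceI; clarify)
    show "\<exists>n::int. n \<noteq> 0 \<and> of_int n * 0 \<in> \<O>" using int[of 0] by (intro exI[of _ 1]) simp
  next
    fix x y and n m :: int
    assume nm: "n \<noteq> 0" "of_int n * x \<in> \<O>" "m \<noteq> 0" "of_int m * y \<in> \<O>"
    have "of_int (n * m) * x = of_int m * (of_int n * x)" "of_int (n * m) * y = of_int n * (of_int m * y)"
      by (metis mult.assoc mult.commute of_int_mult)+
    then have "of_int (n * m) * (x + y) = of_int m * (of_int n * x) + of_int n * (of_int m * y)"
      by (simp only: distrib_left)
    also have "\<dots> \<in> \<O>" by (intro add order_closed int nm)
    finally show "\<exists>k::int. k \<noteq> 0 \<and> of_int k * (x + y) \<in> \<O>"
      using nm by (intro exI[of _ "n * m"]) simp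
  next
    fix c :: rat and x and n :: int
    assume n: "n \<noteq> 0" "of_int n * x \<in> \<O>"
    obtain p q :: int where pq: "c = of_int p / of_int q" "q > 0" by (cases c) (auto simp: Fract_of_int_quotient)
    have "of_int (q * n) * (c *\<^sub>Q x) = of_int p * (of_int n * x)"
    proof -
      have "emb (of_int (q * n) * (c *\<^sub>Q x)) = emb (of_int p * (of_int n * x))"
      proof -
        have "of_int k * z = of_int k *\<^sub>R z" for k and z :: hamilton by (simp add: scaleR_conv_of_real)
        then show ?thesis using pq by (simp add: of_rat_divide del: of_int_mult) simp
      qed
      then show ?thesis by (simp only: emb_eq_iff)
    qed
    also have "\<dots> \<in> \<O>" by (intro order_closed int n)
    finally show "\<exists>k::int. k \<noteq> 0 \<and> of_int k * (c *\<^sub>Q x) \<in> \<O>"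
      using n pq by (intro exI[of _ "q * n"]) simp
  qed
  moreover have "\<O> \<subseteq> {a. \<exists>n::int. n \<noteq> 0 \<and> of_int n * a \<in> \<O>}" by (auto intro!: exI[of _ 1])
  ultimately have "Q.span \<O> \<subseteq> {a. \<exists>n::int. n \<noteq> 0 \<and> of_int n * a \<in> \<O>}" by (rule Q.span_minimal[rotated])
  moreover have "Q.span \<O> = UNIV" using order by (simp add: is_order_def)
  ultimately show ?thesis by auto
qed

lemma span_emb_order: "span (emb ` \<O>) = UNIV"
proof -
  have "emb a \<in> span (emb ` \<O>)" for a
  proof -
    obtain n :: int where n: "n \<noteq> 0" "of_int n * a \<in> \<O>" using order_clear_denominator by blast
    have "emb a = inverse (of_int n) *\<^sub>R emb (of_int n * a)"
      using n by (simp add: scaleR_conv_of_real flip: mult.assoc)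
    then show ?thesis using n by (metis imageI span_base span_scale)
  qed
  then have "span (range emb) \<subseteq> span (emb ` \<O>)" by (intro span_minimal) auto
  moreover have "range emb = \<phi> ` range to_real" by (auto simp: emb_def)
  then have "span (range emb) = \<phi> ` span (range to_real)" by (simp add: linear_span_image[OF linear])
  then have "span (range emb) = UNIV" using bij by (simp add: span_range_to_real bij_is_surj)
  ultimately show ?thesis by blast
qed

sublocale H: hamilton_order "emb ` \<O>" "emb ` \<I>"
proof
  note I = ideal[unfolded two_sided_ideal_def]
  show "1 \<in> emb ` \<O>" using order_closed(1) emb_1 by (metis imageI)
  show "x - y \<in> emb ` \<O>" "x * y \<in> emb ` \<O>" if "x \<in> emb ` \<O>" "y \<in> emb ` \<O>" for x y
    using that order_closed(2,3) by (auto simp flip: emb_diff emb_mult)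
  show "norm x ^ 2 \<in> \<int>" if "x \<in> emb ` \<O>" for x using that norm_emb_integral by auto
  show "span (emb ` \<O>) = UNIV" by (rule span_emb_order)
  show "two_sided_ideal (emb ` \<O>) (emb ` \<I>)"
    unfolding two_sided_ideal_def
  proof (intro conjI ballI)
    show "emb ` \<I> \<subseteq> emb ` \<O>" using I by blast
    show "0 \<in> emb ` \<I>" using I emb_0 by (metis imageI)
    show "x - y \<in> emb ` \<I>" if "x \<in> emb ` \<I>" "y \<in> emb ` \<I>" for x y
      using that I by (auto simp flip: emb_diff)
    show "a * x \<in> emb ` \<I>" "x * a \<in> emb ` \<I>" if "a \<in> emb ` \<O>" "x \<in> emb ` \<I>" for a x
      using that I by (auto simp flip: emb_mult)
  qed
  show "emb ` \<I> \<noteq> {0}"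
  proof
    assume "emb ` \<I> = {0}"
    then have "a = 0" if "a \<in> \<I>" for a using that by (metis emb_eq_0_iff imageI singletonD)
    moreover have "0 \<in> \<I>" using I by blast
    ultimately show False using ideal_nonzero by blast
  qed
qed

lemma rationals_eq: "H.rationals = range emb"
proof (intro set_eqI iffI)
  fix x assume "x \<in> H.rationals"
  then obtain n :: int and a where n: "n \<noteq> 0" "of_int n * x = emb a" by (auto simp: H.rationals_def)
  have "x = inverse (of_int n) *\<^sub>R (of_int n * x)"
    using n(1) by (simp add: scaleR_conv_of_real flip: mult.assoc)
  also have "\<dots> = emb (inverse (of_int n) *\<^sub>Q a)" unfolding n(2) by (simp add: of_rat_inverse)
  finally show "x \<in> range emb" by blast
next
  fix x assume "x \<in> range emb"
  then obtain a where a: "x = emb a" by blast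
  obtain n :: int where "n \<noteq> 0" "of_int n * a \<in> \<O>" using order_clear_denominator by blast
  then show "x \<in> H.rationals" unfolding H.rationals_def a
    by (intro CollectI exI[of _ n]) (auto simp flip: emb_of_int emb_mult)
qed

lemma irrational_iff: "\<phi> x \<in> H.rationals \<longleftrightarrow> x \<in> range to_real"
  unfolding rationals_eq by (auto simp: emb_def eq_iff)

text \<open>The trace t and the norm n of q are rational, so the quaternionic inverse (t - q) / n is
  already the image of an element of the algebra.\<close>

lemma emb_ring_inverse:
  assumes "q \<noteq> 0" shows "emb (ring_inverse q) = inverse (emb q)"
proof -
  have "2 * Re0 (emb q) = norm (emb (q + 1)) ^ 2 - norm (emb q) ^ 2 - norm (emb 1) ^ 2"
    by (simp add: norm_add_sq)
  also have "\<dots> \<in> \<rat>" by (intro Rats_diff norm_emb_rational)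
  finally obtain t where t: "2 * Re0 (emb q) = of_rat t" by (auto elim: Rats_cases)
  obtain n where n: "norm (emb q) ^ 2 = of_rat n" using norm_emb_rational[of q] by (auto elim: Rats_cases)
  define y where "y = inverse n *\<^sub>Q (t *\<^sub>Q 1 - q)"
  have y: "emb y = inverse (emb q)"
    unfolding inverse_hamilton_def hcnj_conv t n y_def emb_scaleQ emb_diff emb_1 of_rat_inverse
      of_real_def ..
  have "emb q \<noteq> 0" using assms by simp
  then have "emb (q * y) = emb 1" "emb (y * q) = emb 1" unfolding emb_mult y emb_1 by simp_all
  then have inv: "q * y = 1" "y * q = 1" unfolding emb_eq_iff .
  have "ring_inverse q = y"
    unfolding ring_inverse_def
  proof (rule the_equality)
    fix z assume "q * z = 1 \<and> z * q = 1"
    then show "z = y" using inv by (metis mult.assoc mult_1 mult_1_right)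
  qed (use inv in simp)
  then show ?thesis by (simp add: y)
qed

section \<open>Approximants as primitive columns\<close>

lemma norm_to_real: "reduced_norm (to_real a) = norm (emb a) ^ 2"
  by (simp add: reduced_norm_eq emb_def)

text \<open>For nonzero q this is \<open>ddet_nz_col\<close>. For q = 0 the norm in
  \<open>approx_pairs\<close> is 0, not 1, although the column may be primitive.\<close>

lemma approx_pairs_iff:
  "(p, q) \<in> approx_pairs \<O> \<I> \<longleftrightarrow> q \<noteq> 0 \<and> vector [emb p, emb q] \<in> H.primitive"
proof (cases "q = 0")
  case True
  then show ?thesis by (simp add: approx_pairs_def norm_to_real)
next
  case False
  have "reduced_norm (to_real (q * r - q * p * ring_inverse q * s)) =
    ddet (mat2 (emb p) (emb r) (emb q) (emb s))" for r s
  proof -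
    have "emb (q * r - q * p * ring_inverse q * s) = emb q * (emb r - emb p * inverse (emb q) * emb s)"
      by (simp add: emb_ring_inverse False right_diff_distrib mult.assoc)
    then show ?thesis using False by (simp add: norm_to_real ddet_nz_col norm_mult power_mult_distrib)
  qed
  then show ?thesis using False by (auto simp: approx_pairs_def H.primitive_def)
qed

lemma primitive_obtain:
  assumes "v \<in> H.primitive" "v$2 \<noteq> 0"
  obtains p q where "v = vector [emb p, emb q]" "(p, q) \<in> approx_pairs \<O> \<I>"
proof -
  from assms(1) obtain p q where pq: "v$1 = emb p" "v$2 = emb q" by (auto simp: H.primitive_def)
  then have "v = vector [emb p, emb q]" by (simp add: vec2_eq_iff)
  moreover from this have "(p, q) \<in> approx_pairs \<O> \<I>" using assms by (simp add: approx_pairs_iff)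
  ultimately show ?thesis by (rule that)
qed

definition approx_value :: "'a real_tensor \<Rightarrow> 'a \<times> 'a \<Rightarrow> real" where
  "approx_value x = (\<lambda>(p, q). reduced_norm (to_real q) *
     sqrt (reduced_norm (x - to_real (p * ring_inverse q))))"

lemma approx_value_nonneg: "approx_value x z \<ge> 0"
  by (simp add: approx_value_def split_beta reduced_norm_eq)

text \<open>The reduced norm of q is |q|^2; one factor |q| turns |x - p q^-1| into |p - x q|, the
  other remains as the second entry.\<close>

lemma approx_value_eq:
  assumes "q \<noteq> 0"
  shows "approx_value x (p, q) = norm_prod (unip (\<phi> x) *v vector [emb p, emb q])"
proof -
  have "norm (emb q) * norm (\<phi> x - emb p * inverse (emb q)) = norm ((\<phi> x - emb p * inverse (emb q)) * emb q)"
    by (simp add: norm_mult)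
  also have "(\<phi> x - emb p * inverse (emb q)) * emb q = \<phi> x * emb q - emb p"
    using assms by (simp add: left_diff_distrib mult.assoc)
  finally have "norm (emb q) * norm (\<phi> x - emb p * inverse (emb q)) = norm (emb p - \<phi> x * emb q)"
    by (simp add: norm_minus_commute)
  moreover have "\<phi> (x - to_real (p * ring_inverse q)) = \<phi> x - emb p * inverse (emb q)"
    using linear_diff[OF linear] emb_ring_inverse[OF assms] emb_mult by (simp add: emb_def)
  ultimately show ?thesis
    by (simp add: approx_value_def reduced_norm_eq norm_prod_def power2_eq_square mult.assoc
        mult.commute[of "norm (emb p - \<phi> x * emb q)"] flip: emb_def)
qed

lemma eventually_approx_filter:
  "eventually P (approx_filter \<O> \<I>) \<longleftrightarrow>
    (\<exists>X. \<forall>p q. (p, q) \<in> approx_pairs \<O> \<I> \<longrightarrow> norm (emb q) \<ge> X \<longrightarrow> P (p, q))"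
proof -
  have "eventually P (approx_filter \<O> \<I>) \<longleftrightarrow>
    (\<exists>X. \<forall>z. norm (emb (snd z)) ^ 2 \<ge> X \<longrightarrow> z \<in> approx_pairs \<O> \<I> \<longrightarrow> P z)"
    by (simp add: approx_filter_def eventually_inf_principal eventually_filtercomap_at_top_linorder
        split_beta norm_to_real)
  also have "\<dots> \<longleftrightarrow> (\<exists>X. \<forall>p q. (p, q) \<in> approx_pairs \<O> \<I> \<longrightarrow> norm (emb q) \<ge> X \<longrightarrow> P (p, q))"
  proof
    assume "\<exists>X. \<forall>z. norm (emb (snd z)) ^ 2 \<ge> X \<longrightarrow> z \<in> approx_pairs \<O> \<I> \<longrightarrow> P z"
    then obtain X where X: "\<And>z. norm (emb (snd z)) ^ 2 \<ge> X \<Longrightarrow> z \<in> approx_pairs \<O> \<I> \<Longrightarrow> P z" by blast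
    \<comment> \<open>Above 1 squaring does not decrease, so the threshold for the reduced norm also
      serves for the norm.\<close>
    have "X \<le> norm (emb q) ^ 2" if "norm (emb q) \<ge> max 1 X" for q
      using that self_le_power[of "norm (emb q)" 2] by simp
    then show "\<exists>X. \<forall>p q. (p, q) \<in> approx_pairs \<O> \<I> \<longrightarrow> norm (emb q) \<ge> X \<longrightarrow> P (p, q)"
      using X by (intro exI[of _ "max 1 X"]) (metis snd_conv)
  next
    assume "\<exists>X. \<forall>p q. (p, q) \<in> approx_pairs \<O> \<I> \<longrightarrow> norm (emb q) \<ge> X \<longrightarrow> P (p, q)"
    then obtain X where X: "\<And>p q. (p, q) \<in> approx_pairs \<O> \<I> \<Longrightarrow> norm (emb q) \<ge> X \<Longrightarrow> P (p, q)" by blast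
    have "X \<le> norm (emb q)" if "norm (emb q) ^ 2 \<ge> (max 1 X) ^ 2" for q
      using power2_le_imp_le[OF that] by simp
    then show "\<exists>X. \<forall>z. norm (emb (snd z)) ^ 2 \<ge> X \<longrightarrow> z \<in> approx_pairs \<O> \<I> \<longrightarrow> P z"
      using X by (intro exI[of _ "(max 1 X) ^ 2"]) auto
  qed
  finally show ?thesis .
qed

lemma eventually_approx_value:
  "eventually (\<lambda>z. P (approx_value x z)) (approx_filter \<O> \<I>) \<longleftrightarrow>
    (\<exists>X. \<forall>v\<in>H.primitive. norm (v$2) \<ge> X \<longrightarrow> P (norm_prod (unip (\<phi> x) *v v)))"
  unfolding eventually_approx_filter
proof
  assume "\<exists>X. \<forall>p q. (p, q) \<in> approx_pairs \<O> \<I> \<longrightarrow> norm (emb q) \<ge> X \<longrightarrow> P (approx_value x (p, q))"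
  then obtain X where X: "\<And>p q. (p, q) \<in> approx_pairs \<O> \<I> \<Longrightarrow> norm (emb q) \<ge> X \<Longrightarrow> P (approx_value x (p, q))"
    by blast
  show "\<exists>X. \<forall>v\<in>H.primitive. norm (v$2) \<ge> X \<longrightarrow> P (norm_prod (unip (\<phi> x) *v v))"
  \<comment> \<open>The bound 1 excludes primitive columns with lower entry 0, which come from no
    approximant.\<close>
  proof (intro exI[of _ "max 1 X"] ballI impI)
    fix v assume v: "v \<in> H.primitive" "norm (v$2) \<ge> max 1 X"
    then have "v$2 \<noteq> 0" by auto
    with v(1) obtain p q where pq: "v = vector [emb p, emb q]" "(p, q) \<in> approx_pairs \<O> \<I>"
      by (rule primitive_obtain)
    then have "P (approx_value x (p, q))" using X v(2) by simp
    moreover have "q \<noteq> 0" using pq(2) by (simp add: approx_pairs_iff)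
    ultimately show "P (norm_prod (unip (\<phi> x) *v v))" by (simp add: approx_value_eq pq(1))
  qed
next
  assume "\<exists>X. \<forall>v\<in>H.primitive. norm (v$2) \<ge> X \<longrightarrow> P (norm_prod (unip (\<phi> x) *v v))"
  then obtain X where X: "\<And>v. v \<in> H.primitive \<Longrightarrow> norm (v$2) \<ge> X \<Longrightarrow> P (norm_prod (unip (\<phi> x) *v v))" by blast
  show "\<exists>X. \<forall>p q. (p, q) \<in> approx_pairs \<O> \<I> \<longrightarrow> norm (emb q) \<ge> X \<longrightarrow> P (approx_value x (p, q))"
  proof (intro exI[of _ X] allI impI)
    fix p q assume "(p, q) \<in> approx_pairs \<O> \<I>" "norm (emb q) \<ge> X"
    then show "P (approx_value x (p, q))"
      using X[of "vector [emb p, emb q]"] by (simp add: approx_pairs_iff approx_value_eq)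
  qed
qed

lemma frequently_approx_value:
  "frequently (\<lambda>z. P (approx_value x z)) (approx_filter \<O> \<I>) \<longleftrightarrow>
    (\<forall>X. \<exists>v\<in>H.primitive. norm (v$2) \<ge> X \<and> P (norm_prod (unip (\<phi> x) *v v)))"
  using eventually_approx_value[of "\<lambda>t. \<not> P t" x] unfolding frequently_def by auto

lemma approx_constant_eq:
  "approx_constant \<O> \<I> x = Liminf (approx_filter \<O> \<I>) (\<lambda>z. ereal (approx_value x z))"
  by (simp add: approx_constant_def approx_value_def case_prod_unfold)

lemma approx_constant_iff: "approx_constant \<O> \<I> x = ereal c \<longleftrightarrow> H.lagrange_value (\<phi> x) c"
  by (simp only: approx_constant_eq Liminf_eq_ereal_iff eventually_approx_value
      frequently_approx_value[of "\<lambda>t. t \<le> c + e" x for e] H.lagrange_value_def)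

lemma approx_constant_finite:
  assumes "x \<notin> range to_real" obtains c where "approx_constant \<O> \<I> x = ereal c"
proof -
  have "\<phi> x \<notin> H.rationals" using assms by (simp add: irrational_iff)
  then obtain C where "\<forall>X. \<exists>v\<in>H.primitive. norm (v$2) \<ge> X \<and> norm_prod (unip (\<phi> x) *v v) \<le> C"
    by (rule H.bounded_approximations)
  then have "frequently (\<lambda>z. approx_value x z \<le> C) (approx_filter \<O> \<I>)"
    using frequently_approx_value[of "\<lambda>t. t \<le> C" x] by blast
  from Liminf_real_exists[OF approx_value_nonneg this] show ?thesis using that unfolding approx_constant_eq by blast
qed

text \<open>Writing the spectrum as the image of a set of reals includes that every constant is
  finite; closedness is then the sequential statement \<open>lagrange_values_closed\<close>.\<close>

theorem approx_spectrum_closed: "\<exists>S :: real set. approx_spectrum \<O> \<I> = ereal ` S \<and> closed S"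
proof (intro exI conjI)
  let ?S = "{c. \<exists>y. y \<notin> H.rationals \<and> H.lagrange_value y c}"
  show "approx_spectrum \<O> \<I> = ereal ` ?S"
  proof (intro set_eqI iffI)
    fix t assume "t \<in> approx_spectrum \<O> \<I>"
    then obtain x where x: "x \<notin> range to_real" "t = approx_constant \<O> \<I> x"
      by (auto simp: approx_spectrum_def)
    obtain c where c: "approx_constant \<O> \<I> x = ereal c" by (rule approx_constant_finite[OF x(1)])
    then have "H.lagrange_value (\<phi> x) c" by (simp add: approx_constant_iff)
    moreover have "\<phi> x \<notin> H.rationals" using x by (simp add: irrational_iff)
    ultimately show "t \<in> ereal ` ?S" using x c by blast
  next
    fix t assume "t \<in> ereal ` ?S"
    then obtain y c where y: "y \<notin> H.rationals" "H.lagrange_value y c" "t = ereal c" by blast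
    have "approx_constant \<O> \<I> (inv \<phi> y) = ereal c" using y by (simp add: approx_constant_iff)
    moreover have "inv \<phi> y \<notin> range to_real" using y irrational_iff[of "inv \<phi> y"] by simp
    ultimately show "t \<in> approx_spectrum \<O> \<I>" unfolding approx_spectrum_def y(3) by (metis DiffI UNIV_I imageI)
  qed
  show "closed ?S"
    unfolding closed_sequential_limits
  proof (intro allI impI, elim conjE)
    fix c l assume "\<forall>n. c n \<in> ?S" and lim: "c \<longlonglongrightarrow> l"
    then obtain y where "\<And>n. y n \<notin> H.rationals" "\<And>n. H.lagrange_value (y n) (c n)"
      by (auto simp: choice_iff)
    from H.lagrange_values_closed[OF this lim] show "l \<in> ?S" by blast
  qed
qed

end

theorem theorem5:
  fixes \<O> \<I> :: "'a::rat_algebra_1 set"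
  assumes "quaternion_algebra (scaleQ :: rat \<Rightarrow> 'a \<Rightarrow> 'a)"
    and "ramified_over_reals TYPE('a)"
    and "is_order \<O>"
    and "two_sided_ideal \<O> \<I>"
    and "\<I> \<noteq> {0}"
  shows "\<exists>S :: real set. approx_spectrum \<O> \<I> = ereal ` S \<and> closed S"
proof -
  from assms(2) obtain \<phi> :: "'a real_tensor \<Rightarrow> hamilton"
    where "bij \<phi>" "linear \<phi>" "\<phi> 1 = 1" "\<And>x y. \<phi> (x * y) = \<phi> x * \<phi> y"
    unfolding ramified_over_reals_def by blast
  with assms(3-5) interpret ramified_order \<phi> \<O> \<I>
    by (intro ramified_order.intro hamilton_isomorphism.intro ramified_order_axioms.intro)
  show ?thesis by (rule approx_spectrum_closed)
qed

end
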